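(* Let $\mathrm{R}$ be a root system of type $\mathrm{A}_{n-1}$ ($n\ge 2$), $\mathrm{B}_n$ ($n\ge 2$), $\mathrm{C}_n$ ($n\ge 2$), $\mathrm{D}_n$ ($n\ge 4$) or $\mathrm{G}_2$ (in which case put $n=3$). Let $r$ be the rank of $\mathrm{R}$, that is, $r=n-1$ for $\mathrm{A}_{n-1}$, $r=2=n-1$ for $\mathrm{G}_2$, and $r=n$ otherwise. Let $\mathcal{G}\subseteq \mathrm{GL}_r(\mathbb{Z})$ be the integer representation of the Weyl group of $\mathrm{R}$ with respect to the fundamental weights, and let $\widehat{T}_{k e_1}\in\mathbb{Q}[z]=\mathbb{Q}[z_1,\dots,z_r]$ ($k\in\mathbb{N}$) be the real generalized Chebyshev polynomials. Define the matrix $H\in\mathbb{Q}[z]^{n\times n}$ by \[ 2^{i+j}H_{ij} = -\widehat{T}_{(i+j)e_1} + \sum_{\ell=1}^{\lceil (i+j)/2\rceil-1}\left(4\binom{i+j-2}{\ell-1}-\binom{i+j}{\ell}\right)\widehat{T}_{(i+j-2\ell)e_1} + \frac12\begin{cases}4\binom{i+j-2}{(i+j)/2-1}-\binom{i+j}{(i+j)/2}, & i+j \text{ even},\\ 0, & i+j\text{ odd},\end{cases} \] for $1\le i,j\le n$. (So $H$ is a Hankel matrix whose entry for $i+j=2,3,4,5,6,\dots$ is $\frac{\widehat T_0-\widehat T_{2e_1}}{4}$, $\frac{\widehat T_{e_1}-\widehat T_{3e_1}}{8}$, $\frac{\widehat T_0-\widehat T_{4e_1}}{16}$, $\frac{2\widehat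 T_{e_1}-\widehat T_{3e_1}-\widehat T_{5e_1}}{32}$, $\frac{2\widehat T_0+\widehat T_{2e_1}-2\widehat T_{4e_1}-\widehat T_{6e_1}}{64},\dots$.) Then the real $\mathbb{T}$-orbit space of $\mathcal{G}$ is \[ \mathcal{T}_{\mathbb{R}}=\{z\in\mathbb{R}^r \mid H(z)\succeq 0\}. \]
   Context: $\mathbb{T}=\{x\in\mathbb{C}\mid |x|=1\}$. "$\succeq 0$" means positive semidefinite (for real symmetric matrices). Weyl groups $\mathcal{W}$ and fundamental weights $\omega_1,\dots,\omega_r$ (here $\epsilon_i$ denote the standard basis vectors of $\mathbb{R}^n$): - $\mathrm{A}_{n-1}$: $\mathcal{W}\cong\mathfrak{S}_n$ permuting coordinates on $\{u\in\mathbb{R}^n\mid\sum u_i=0\}$; $\omega_i=\sum_{j\le i}\epsilon_j-\frac{i}{n}\sum_{j=1}^n \epsilon_j$ ($1\le i\le n-1$). - $\mathrm{C}_n$: $\mathcal{W}\cong\mathfrak{S}_n\ltimes\{\pm1\}^n$, all signed permutations of coordinates of $\mathbb{R}^n$; $\omega_i=\epsilon_1+\dots+\epsilon_i$ ($1\le i\le n$). - $\mathrm{B}_n$: same $\mathcal{W}$ as $\mathrm{C}_n$; $\omega_i=\epsilon_1+\dots+\epsilon_i$ ($1\le i\le n-1$), $\omega_n=(\epsilon_1+\dots+\epsilon_n)/2$. - $\mathrm{D}_n$: $\mathcal{W}\cong\mathfrak{S}_n\ltimes\{\pm1\}^n_+$, signed permutations with an even number of sign changes; $\omega_i=\epsilon_1+\dots+\epsilon_i$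 ($1\le i\le n-2$), $\omega_{n-1}=(\epsilon_1+\dots+\epsilon_{n-1}-\epsilon_n)/2$, $\omega_n=(\epsilon_1+\dots+\epsilon_n)/2$. - $\mathrm{G}_2$: $\mathcal{W}\cong\mathfrak{S}_3\ltimes\{\pm1\}$ acting on $\{u\in\mathbb{R}^3\mid\sum u_i=0\}$ by permuting coordinates and multiplication by $\pm1$; $\omega_1=(0,-1,1)$, $\omega_2=(-1,-1,2)$. The lattice $\mathbb{Z}\omega_1\oplus\dots\oplus\mathbb{Z}\omega_r$ is $\mathcal{W}$-invariant, and the integer representation $\mathcal{G}\subseteq\mathrm{GL}_r(\mathbb{Z})$ is the group of matrices of the elements of $\mathcal{W}$ in the basis $\omega_1,\dots,\omega_r$ (acting on column vectors in $\mathbb{Z}^r$). For $\alpha\in\mathbb{Z}^r$, $x^\alpha=x_1^{\alpha_1}\cdots x_r^{\alpha_r}$, and the orbit polynomial is $\Theta_\alpha=\frac{1}{|\mathcal{G}|}\sum_{B\in\mathcal{G}}x^{B\alpha}$, a Laurent polynomial. With $e_i$ the standard basis of $\mathbb{Z}^r$, put $\theta_i=\Theta_{e_i}$. There is a permutation $\sigma$ of $\{1,\dots,r\}$ of order at most 2 with $-e_i\in\mathcal{G}e_{\sigma(i)}$; then $\overline{\theta_i(x)}=\theta_{\sigma(i)}(x)$ for $x\in\mathbb{T}^r$. ($\sigma(i)=n-i$ for $\mathrm{A}_{n-1}$; $\sigma$ swaps $n-1$ and $n$ for $\mathrm{D}_n$ with $n$ odd; otherwise $\sigma=\mathrm{id}$.)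 Put $\theta_{j,\mathbb{R}}=\theta_j$ if $\sigma(j)=j$, and for $j<\sigma(j)$ put $\theta_{j,\mathbb{R}}=(\theta_j+\theta_{\sigma(j)})/2$ and $\theta_{\sigma(j),\mathbb{R}}=(\theta_j-\theta_{\sigma(j)})/(2\mathrm{i})$. Let $\vartheta_{\mathbb{R}}:\mathbb{T}^r\to\mathbb{R}^r$, $x\mapsto(\theta_{1,\mathbb{R}}(x),\dots,\theta_{r,\mathbb{R}}(x))$. The real $\mathbb{T}$-orbit space of $\mathcal{G}$ is $\mathcal{T}_{\mathbb{R}}=\vartheta_{\mathbb{R}}(\mathbb{T}^r)$. For $k\in\mathbb{N}$ (including $0$), $\widehat{T}_{ke_1}\in\mathbb{Q}[z_1,\dots,z_r]$ is the unique polynomial with $\widehat{T}_{ke_1}(\vartheta_{\mathbb{R}}(x))=\frac{\Theta_{ke_1}(x)+\Theta_{-ke_1}(x)}{2}$ for all $x\in\mathbb{T}^r$; in particular $\widehat T_0=1$. *)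

theory Defs
  imports Complex_Main "Jordan_Normal_Form.Matrix" "HOL-Combinatorics.Permutations"
    "HOL-Library.Poly_Mapping"
begin

text \<open>
  Vectors and matrices are those of \<^theory>\<open>Jordan_Normal_Form.Matrix\<close>, indexed from 0: index \<open>i\<close>
  stands for the mathematical index \<open>i + 1\<close>.
\<close>

text \<open>
  The parameter \<open>n\<close> is the dimension of the ambient space \<open>\<real>\<^sup>n\<close>, so that \<open>A_type\<close> with parameter \<open>n\<close> is
  the root system \<open>A\<close> of rank \<open>n - 1\<close>, and \<open>G2_type\<close> is meant with \<open>n = 3\<close>.
\<close>

datatype root_type = A_type | B_type | C_type | D_type | G2_type

fun root_rank :: "root_type \<Rightarrow> nat \<Rightarrow> nat" where
  "root_rank A_type n = n - 1"
| "root_rank G2_type n = n - 1"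
| "root_rank _ n = n"

text \<open>The matrix of the signed permutation sending the basis vector \<open>\<epsilon>\<^sub>j\<close> to \<open>s j \<cdot> \<epsilon>\<^bsub>p j\<^esub>\<close>.\<close>

definition signed_perm_mat :: "nat \<Rightarrow> (nat \<Rightarrow> nat) \<Rightarrow> (nat \<Rightarrow> real) \<Rightarrow> real mat" where
  "signed_perm_mat n p s = mat n n (\<lambda>(i, j). if i = p j then s j else 0)"

text \<open>
  In types \<open>A\<close> and \<open>G\<^sub>2\<close> the group acts on the hyperplane of vectors with coordinate sum 0; its
  elements are represented by the \<open>n \<times> n\<close> matrices of the evident extension to \<open>\<real>\<^sup>n\<close>.
\<close>

fun weyl_group :: "root_type \<Rightarrow> nat \<Rightarrow> real mat set" where
  "weyl_group A_type n = {signed_perm_mat n p (\<lambda>_. 1) | p. p permutes {..<n}}"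
| "weyl_group B_type n =
     {signed_perm_mat n p s | p s. p permutes {..<n} \<and> (\<forall>j<n. s j \<in> {1, -1})}"
| "weyl_group C_type n =
     {signed_perm_mat n p s | p s. p permutes {..<n} \<and> (\<forall>j<n. s j \<in> {1, -1})}"
| "weyl_group D_type n =
     {signed_perm_mat n p s | p s. p permutes {..<n} \<and> (\<forall>j<n. s j \<in> {1, -1}) \<and>
        even (card {j. j < n \<and> s j = -1})}"
| "weyl_group G2_type n =
     {signed_perm_mat n p (\<lambda>_. c) | p c. p permutes {..<n} \<and> c \<in> {1, -1}}"

text \<open>
  \<open>fund_weight R n i\<close> is \<open>\<omega>\<^sub>i\<close> for the mathematical index \<open>1 \<le> i \<le> r\<close>; only its coordinates
  are indexed from 0.
\<close>

fun fund_weight :: "root_type \<Rightarrow> nat \<Rightarrow> nat \<Rightarrow> real vec" where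
  "fund_weight A_type n i = vec n (\<lambda>j. (if j < i then 1 else 0) - real i / real n)"
| "fund_weight B_type n i =
     (if i = n then vec n (\<lambda>_. 1/2) else vec n (\<lambda>j. if j < i then 1 else 0))"
| "fund_weight C_type n i = vec n (\<lambda>j. if j < i then 1 else 0)"
| "fund_weight D_type n i =
     (if i = n then vec n (\<lambda>_. 1/2)
      else if i = n - 1 then vec n (\<lambda>j. if j < n - 1 then 1/2 else - 1/2)
      else vec n (\<lambda>j. if j < i then 1 else 0))"
| "fund_weight G2_type n i =
     (if i = 1 then vec_of_list [0, -1, 1] else vec_of_list [-1, -1, 2])"

definition weight_mat :: "root_type \<Rightarrow> nat \<Rightarrow> real mat" where
  "weight_mat R n = mat_of_cols n (map (fund_weight R n) [1..<root_rank R n + 1])"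

text \<open>
  If the columns of \<open>\<Omega>\<close> are the fundamental weights, then \<open>w \<Omega> = \<Omega> B\<close> says that \<open>B\<close> is the matrix
  of \<open>w\<close> in the basis \<open>\<omega>\<^sub>1, \<dots>, \<omega>\<^sub>r\<close>.
\<close>

definition int_rep :: "root_type \<Rightarrow> nat \<Rightarrow> int mat set" where
  "int_rep R n = {B \<in> carrier_mat (root_rank R n) (root_rank R n).
     \<exists>w \<in> weyl_group R n. w * weight_mat R n = weight_mat R n * map_mat real_of_int B}"

definition torus :: "nat \<Rightarrow> complex vec set" where
  "torus r = {x \<in> carrier_vec r. \<forall>i<r. cmod (x $ i) = 1}"

definition monomial_powi :: "complex vec \<Rightarrow> int vec \<Rightarrow> complex" where
  "monomial_powi x \<alpha> = (\<Prod>i<dim_vec \<alpha>. (x $ i) powi (\<alpha> $ i))"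

text \<open>The value of the Laurent polynomial \<open>\<Theta>\<^sub>\<alpha>\<close> at a point \<open>x\<close> with nonzero coordinates.\<close>

definition orbit_poly :: "root_type \<Rightarrow> nat \<Rightarrow> int vec \<Rightarrow> complex vec \<Rightarrow> complex" where
  "orbit_poly R n \<alpha> x =
     1 / of_nat (card (int_rep R n)) * (\<Sum>B \<in> int_rep R n. monomial_powi x (B *\<^sub>v \<alpha>))"

definition fund_orbit_poly :: "root_type \<Rightarrow> nat \<Rightarrow> nat \<Rightarrow> complex vec \<Rightarrow> complex" where
  "fund_orbit_poly R n i = orbit_poly R n (unit_vec (root_rank R n) i)"

definition conj_perm :: "root_type \<Rightarrow> nat \<Rightarrow> nat \<Rightarrow> nat" where
  "conj_perm R n i = (THE j. j < root_rank R n \<and>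
     (\<exists>B \<in> int_rep R n. - unit_vec (root_rank R n) i = B *\<^sub>v unit_vec (root_rank R n) j))"

definition real_fund_orbit_poly :: "root_type \<Rightarrow> nat \<Rightarrow> nat \<Rightarrow> complex vec \<Rightarrow> complex" where
  "real_fund_orbit_poly R n i x =
     (let j = conj_perm R n i; \<theta> = (\<lambda>k. fund_orbit_poly R n k x) in
      if i = j then \<theta> i
      else if i < j then (\<theta> i + \<theta> j) / 2
      else (\<theta> j - \<theta> i) / (2 * \<i>))"

text \<open>
  On the torus the functions \<open>\<theta>\<^bsub>i,\<real>\<^esub>\<close> take real values, so \<^const>\<open>Re\<close> only serves to change the type.
\<close>

definition real_orbit_map :: "root_type \<Rightarrow> nat \<Rightarrow> complex vec \<Rightarrow> real vec" where
  "real_orbit_map R n x = vec (root_rank R n) (\<lambda>i. Re (real_fund_orbit_poly R n i x))"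

definition real_orbit_space :: "root_type \<Rightarrow> nat \<Rightarrow> real vec set" where
  "real_orbit_space R n = real_orbit_map R n ` torus (root_rank R n)"

text \<open>
  Multivariate polynomials over \<open>\<rat>\<close> in variables indexed by \<^typ>\<open>nat\<close>: a monomial is a finitely
  supported exponent function, a polynomial a finitely supported coefficient function on monomials.
\<close>

type_synonym rat_mpoly = "(nat \<Rightarrow>\<^sub>0 nat) \<Rightarrow>\<^sub>0 rat"

definition mpoly_ring :: "nat \<Rightarrow> rat_mpoly set" where
  "mpoly_ring r = {p. \<forall>m \<in> Poly_Mapping.keys p. Poly_Mapping.keys m \<subseteq> {..<r}}"

definition mpoly_const :: "rat \<Rightarrow> rat_mpoly" where
  "mpoly_const c = Poly_Mapping.single 0 c"

definition mpoly_eval :: "rat_mpoly \<Rightarrow> real vec \<Rightarrow> real" where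
  "mpoly_eval p z = (\<Sum>m \<in> Poly_Mapping.keys p. of_rat (Poly_Mapping.lookup p m) *
     (\<Prod>i \<in> Poly_Mapping.keys m. (z $ i) ^ Poly_Mapping.lookup m i))"

text \<open>The polynomial \<open>T\<close> with subscript \<open>k e\<^sub>1\<close>.\<close>

definition real_cheb :: "root_type \<Rightarrow> nat \<Rightarrow> nat \<Rightarrow> rat_mpoly" where
  "real_cheb R n k = (THE p. p \<in> mpoly_ring (root_rank R n) \<and>
     (\<forall>x \<in> torus (root_rank R n).
        let \<alpha> = int k \<cdot>\<^sub>v unit_vec (root_rank R n) 0 in
        complex_of_real (mpoly_eval p (real_orbit_map R n x)) =
          (orbit_poly R n \<alpha> x + orbit_poly R n (- \<alpha>) x) / 2))"

text \<open>The entry \<open>H\<^bsub>ij\<^esub>\<close> with \<open>m = i + j\<close> for the mathematical indices \<open>1 \<le> i, j \<le> n\<close>.\<close>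

definition hankel_entry :: "root_type \<Rightarrow> nat \<Rightarrow> nat \<Rightarrow> rat_mpoly" where
  "hankel_entry R n m = mpoly_const (1 / 2 ^ m) *
     (- real_cheb R n m
      + (\<Sum>l = 1..nat \<lceil>real m / 2\<rceil> - 1.
           mpoly_const (4 * of_nat ((m - 2) choose (l - 1)) - of_nat (m choose l))
             * real_cheb R n (m - 2 * l))
      + mpoly_const (1 / 2 *
          (if even m
           then 4 * of_nat ((m - 2) choose (m div 2 - 1)) - of_nat (m choose (m div 2))
           else 0)))"

definition hankel_mat :: "root_type \<Rightarrow> nat \<Rightarrow> rat_mpoly mat" where
  "hankel_mat R n = mat n n (\<lambda>(i, j). hankel_entry R n ((i + 1) + (j + 1)))"

definition pos_semidef :: "real mat \<Rightarrow> bool" where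
  "pos_semidef M \<longleftrightarrow> square_mat M \<and> transpose_mat M = M \<and>
     (\<forall>v \<in> carrier_vec (dim_row M). v \<bullet> (M *\<^sub>v v) \<ge> 0)"

end

theory Submission
  imports Defs "HOL-Computational_Algebra.Fundamental_Theorem_Algebra"
begin

text \<open>
  Write \<open>x\<close> in exponential coordinates, \<open>x\<^sub>i = exp \<langle>\<omega>\<^sub>i, v\<rangle>\<close>. The orbit of \<open>\<omega>\<^sub>1\<close> then provides nonzero complex numbers
  \<open>y\<^sub>1, \<dots>, y\<^sub>n\<close> such that, with \<open>c\<^sub>l = (y\<^sub>l + y\<^sub>l\<^sup>-\<^sup>1) / 2\<close>, the average of \<open>\<Theta>\<close> at \<open>\<plusminus>k e\<^sub>1\<close> is the mean of the
  classical Chebyshev values \<open>T\<^sub>k(c\<^sub>l)\<close>, and \<open>x\<close> lies on the torus iff all \<open>y\<^sub>l\<close> have modulus one. A binomial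
  identity turns the entry of \<open>H\<close> with \<open>m = i + j\<close> into the mean of \<open>c\<^sub>l\<^bsup>m - 2\<^esup> (1 - c\<^sub>l\<^sup>2) / 2\<close>, so on the orbit space \<open>H\<close> is
  positive semidefinite.

  Conversely, every real \<open>z\<close> is the image of some \<open>x\<close> with nonzero complex coordinates: the elementary
  symmetric functions of the \<open>c\<^sub>l\<close> (of the \<open>y\<^sub>l\<close> in type \<open>A\<close>) are polynomials in \<open>z\<close>, and one extracts roots and
  logarithms. By density of the torus the Chebyshev identities persist at \<open>x\<close>, hence all power sums of the
  \<open>c\<^sub>l\<close> are real, and \<open>H(z) \<succeq> 0\<close> forces \<open>-1 \<le> c\<^sub>l \<le> 1\<close> by Hermite's root counting form. Then \<open>\<bar>y\<^sub>l\<bar> = 1\<close>, so \<open>x\<close> lies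
  on the torus.
\<close>

subsection \<open>Evaluation of multivariate polynomials\<close>

text \<open>\<open>H\<close> is a moment matrix of the n values c_l, and polynomials of degree below
  n separate the distinct ones among them; this fixes its size as n even where the rank is smaller.
  The main obstacle is that \<open>real_cheb\<close> and the orbit space are described on the torus
  only, whereas \<open>H\<close> must be read at every real point. Outside the orbit space a real
  point has preimages only off the torus, where the c_l need not be real; what remains is that they
  form a multiset closed under conjugation. The second obstacle is lifting. The symmetric functions
  of the c_l see only the squares of the half-angle products belonging to spin weights in types B
  and D, so logarithms must be changed until the signs fit. In type A the orbit polynomials are
  symmetric in the y_l and not in the c_l, hence a separate treatment. Finally, the averages run
  over integer matrices; they are transported to pairs of a permutation and a set of sign changes in
  the ambient space, where they factor.\<close>

lemma mpoly_eval_superset: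
  assumes "finite A" "Poly_Mapping.keys p \<subseteq> A"
  shows "mpoly_eval p z = (\<Sum>m \<in> A. of_rat (Poly_Mapping.lookup p m) *
     (\<Prod>i \<in> Poly_Mapping.keys m. (z $ i) ^ Poly_Mapping.lookup m i))"
  unfolding mpoly_eval_def
  by (rule sum.mono_neutral_left) (use assms in \<open>auto simp: in_keys_iff\<close>)

lemma mpoly_eval_zero [simp]: "mpoly_eval 0 z = 0"
  by (simp add: mpoly_eval_def)

lemma mpoly_eval_add: "mpoly_eval (p + q) z = mpoly_eval p z + mpoly_eval q z"
proof -
  let ?A = "Poly_Mapping.keys p \<union> Poly_Mapping.keys q"
  have "finite ?A" "Poly_Mapping.keys (p + q) \<subseteq> ?A" "Poly_Mapping.keys p \<subseteq> ?A" 
    "Poly_Mapping.keys q \<subseteq> ?A"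
    using Poly_Mapping.keys_add[of p q] by auto
  then show ?thesis
    by (simp add: mpoly_eval_superset[of ?A] lookup_add of_rat_add distrib_right sum.distrib)
qed

lemma mpoly_eval_uminus: "mpoly_eval (- p) z = - mpoly_eval p z"
proof -
  have "mpoly_eval p z + mpoly_eval (- p) z = 0"
    by (metis mpoly_eval_add mpoly_eval_zero add.right_inverse)
  then show ?thesis by simp
qed

lemma mpoly_eval_diff: "mpoly_eval (p - q) z = mpoly_eval p z - mpoly_eval q z"
  using mpoly_eval_add[of p "- q" z] by (simp add: mpoly_eval_uminus)

lemma mpoly_eval_sum: "mpoly_eval (\<Sum>i\<in>A. f i) z = (\<Sum>i\<in>A. mpoly_eval (f i) z)"
  by (induction A rule: infinite_finite_induct) (simp_all add: mpoly_eval_add)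

lemma mpoly_eval_single:
  "mpoly_eval (Poly_Mapping.single m a) z =
     of_rat a * (\<Prod>i \<in> Poly_Mapping.keys m. (z $ i) ^ Poly_Mapping.lookup m i)"
  by (simp add: mpoly_eval_def)

lemma mpoly_eval_const [simp]: "mpoly_eval (mpoly_const c) z = of_rat c"
  by (simp add: mpoly_const_def mpoly_eval_single)

lemma monomial_eval_add:
  "(\<Prod>i \<in> Poly_Mapping.keys (m + m'). (z $ i) ^ Poly_Mapping.lookup (m + m') i) =
   (\<Prod>i \<in> Poly_Mapping.keys m. (z $ i) ^ Poly_Mapping.lookup m i) *
   (\<Prod>i \<in> Poly_Mapping.keys m'. (z $ i) ^ Poly_Mapping.lookup m' i)"
  for z :: "'a :: comm_semiring_1 vec" and m m' :: "nat \<Rightarrow>\<^sub>0 nat"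
proof -
  let ?A = "Poly_Mapping.keys m \<union> Poly_Mapping.keys m'"
  have eq: "(\<Prod>i \<in> Poly_Mapping.keys k. (z $ i) ^ Poly_Mapping.lookup k i) =
      (\<Prod>i \<in> ?A. (z $ i) ^ Poly_Mapping.lookup k i)" if "Poly_Mapping.keys k \<subseteq> ?A" for k
    by (rule prod.mono_neutral_left) (use that in \<open>auto simp: in_keys_iff\<close>)
  show ?thesis
    unfolding eq[OF Poly_Mapping.keys_add] eq[of m, OF Un_upper1] eq[of m', OF Un_upper2]
    by (simp add: lookup_add power_add prod.distrib)
qed

lemma poly_mapping_sum_single: "p = (\<Sum>m \<in> Poly_Mapping.keys p. Poly_Mapping.single m (Poly_Mapping.lookup p m))"
  by (rule poly_mapping_eqI) (auto simp: lookup_sum lookup_single when_def in_keys_iff)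

lemma mpoly_eval_mult: "mpoly_eval (p * q) z = mpoly_eval p z * mpoly_eval q z"
proof -
  have "mpoly_eval (Poly_Mapping.single m a * Poly_Mapping.single m' b) z =
      mpoly_eval (Poly_Mapping.single m a) z * mpoly_eval (Poly_Mapping.single m' b) z" for m m' a b
    unfolding mult_single mpoly_eval_single monomial_eval_add by (simp add: of_rat_mult)
  \<comment> \<open>Abstract sums of single terms are used because
    \<open>poly_mapping_sum_single\<close> has \<open>p\<close> on both sides, so it cannot be
    unfolded from left to right.\<close>
  then have "mpoly_eval (sum P A * sum Q B) z = mpoly_eval (sum P A) z * mpoly_eval (sum Q B) z"
    if "\<And>i. i \<in> A \<Longrightarrow> \<exists>m a. P i = Poly_Mapping.single m a"
      "\<And>j. j \<in> B \<Longrightarrow> \<exists>m a. Q j = Poly_Mapping.single m a"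
    for P Q :: "(nat \<Rightarrow>\<^sub>0 nat) \<Rightarrow> rat_mpoly" and A B
    unfolding sum_product mpoly_eval_sum using that by (intro sum.cong refl) metis
  from this[of "Poly_Mapping.keys p" "\<lambda>m. Poly_Mapping.single m (Poly_Mapping.lookup p m)"
      "Poly_Mapping.keys q" "\<lambda>m. Poly_Mapping.single m (Poly_Mapping.lookup q m)"]
  show ?thesis
    unfolding poly_mapping_sum_single[symmetric] by blast
qed

lemma mpoly_ring_add: "p \<in> mpoly_ring r \<Longrightarrow> q \<in> mpoly_ring r \<Longrightarrow> p + q \<in> mpoly_ring r"
  using Poly_Mapping.keys_add[of p q] unfolding mpoly_ring_def by blast

lemma mpoly_ring_mult:
  assumes "p \<in> mpoly_ring r" "q \<in> mpoly_ring r"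
  shows "p * q \<in> mpoly_ring r"
  unfolding mpoly_ring_def
proof (intro CollectI ballI)
  fix m assume "m \<in> Poly_Mapping.keys (p * q)"
  then obtain a b where "m = a + b" "a \<in> Poly_Mapping.keys p" "b \<in> Poly_Mapping.keys q"
    using Poly_Mapping.keys_mult[of p q] by auto
  then show "Poly_Mapping.keys m \<subseteq> {..<r}"
    using assms Poly_Mapping.keys_add[of a b] unfolding mpoly_ring_def by blast
qed

lemma mpoly_ring_const: "mpoly_const c \<in> mpoly_ring r"
  by (simp add: mpoly_ring_def mpoly_const_def)

lemma mpoly_ring_single:
  assumes "i < r"
  shows "Poly_Mapping.single (Poly_Mapping.single i 1) c \<in> mpoly_ring r"
  using assms by (auto simp: mpoly_ring_def)

lemma mpoly_eval_var [simp]: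
  "mpoly_eval (Poly_Mapping.single (Poly_Mapping.single i 1) 1) z = z $ i"
  by (simp add: mpoly_eval_single)

section \<open>Complex functions with rational polynomial real and imaginary parts\<close>

lemma complex_of_rat: "complex_of_rat c = complex_of_real (real_of_rat c)"
  by (cases c) (simp add: of_rat_rat)

definition ratpoly_fun :: "nat \<Rightarrow> (real vec \<Rightarrow> complex) \<Rightarrow> bool" where
  "ratpoly_fun r f \<longleftrightarrow> (\<exists>p \<in> mpoly_ring r. \<exists>q \<in> mpoly_ring r.
     \<forall>z \<in> carrier_vec r. f z = Complex (mpoly_eval p z) (mpoly_eval q z))"

lemma ratpoly_funI:
  assumes "p \<in> mpoly_ring r" "q \<in> mpoly_ring r"
    "\<And>z. z \<in> carrier_vec r \<Longrightarrow> f z = Complex (mpoly_eval p z) (mpoly_eval q z)"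
  shows "ratpoly_fun r f"
  using assms unfolding ratpoly_fun_def by blast

lemma ratpoly_fun_Re:
  assumes "ratpoly_fun r f"
  shows "\<exists>p \<in> mpoly_ring r. \<forall>z \<in> carrier_vec r. mpoly_eval p z = Re (f z)"
  using assms unfolding ratpoly_fun_def by (metis complex.sel(1))

lemma ratpoly_fun_of_rat: "ratpoly_fun r (\<lambda>_. of_rat c)"
  by (rule ratpoly_funI[of "mpoly_const c" _ "mpoly_const 0"])
    (auto simp: mpoly_ring_const complex_eq_iff complex_of_rat)

lemma ratpoly_fun_ii: "ratpoly_fun r (\<lambda>_. \<i>)"
  by (rule ratpoly_funI[of "mpoly_const 0" _ "mpoly_const 1"])
    (auto simp: mpoly_ring_const complex_eq_iff)

lemma ratpoly_fun_var: "i < r \<Longrightarrow> ratpoly_fun r (\<lambda>z. complex_of_real (z $ i))"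
  by (rule ratpoly_funI[OF mpoly_ring_single[of i r 1] mpoly_ring_const[of 0]])
    (auto simp: complex_eq_iff simp del: One_nat_def)

lemma ratpoly_fun_add:
  assumes "ratpoly_fun r f" "ratpoly_fun r g"
  shows "ratpoly_fun r (\<lambda>z. f z + g z)"
proof -
  from assms obtain p q p' q' where *: "p \<in> mpoly_ring r" "q \<in> mpoly_ring r" "p' \<in> mpoly_ring r" "q' \<in> mpoly_ring r"
    "\<And>z. z \<in> carrier_vec r \<Longrightarrow> f z = Complex (mpoly_eval p z) (mpoly_eval q z)"
    "\<And>z. z \<in> carrier_vec r \<Longrightarrow> g z = Complex (mpoly_eval p' z) (mpoly_eval q' z)"
    unfolding ratpoly_fun_def by blast
  show ?thesis
    by (rule ratpoly_funI[of "p + p'" _ "q + q'"])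
      (simp_all add: * mpoly_ring_add mpoly_eval_add complex_eq_iff)
qed

lemma ratpoly_fun_mult:
  assumes "ratpoly_fun r f" "ratpoly_fun r g"
  shows "ratpoly_fun r (\<lambda>z. f z * g z)"
proof -
  from assms obtain p q p' q' where *: "p \<in> mpoly_ring r" "q \<in> mpoly_ring r" "p' \<in> mpoly_ring r" "q' \<in> mpoly_ring r"
    "\<And>z. z \<in> carrier_vec r \<Longrightarrow> f z = Complex (mpoly_eval p z) (mpoly_eval q z)"
    "\<And>z. z \<in> carrier_vec r \<Longrightarrow> g z = Complex (mpoly_eval p' z) (mpoly_eval q' z)"
    unfolding ratpoly_fun_def by blast
  show ?thesis
    by (rule ratpoly_funI[of "p * p' + mpoly_const (-1) * (q * q')" _ "p * q' + q * p'"])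
      (simp_all add: * mpoly_ring_add mpoly_ring_mult mpoly_ring_const mpoly_eval_add
        mpoly_eval_mult complex_eq_iff)
qed

lemma ratpoly_fun_numeral: "ratpoly_fun r (\<lambda>_. numeral k)"
  using ratpoly_fun_of_rat[of r "numeral k"] by simp

lemma ratpoly_fun_1: "ratpoly_fun r (\<lambda>_. 1)"
  using ratpoly_fun_of_rat[of r 1] by simp

lemma ratpoly_fun_0: "ratpoly_fun r (\<lambda>_. 0)"
  using ratpoly_fun_of_rat[of r 0] by simp

lemma ratpoly_fun_of_nat: "ratpoly_fun r (\<lambda>_. of_nat k)"
  using ratpoly_fun_of_rat[of r "of_nat k"] by simp

lemma ratpoly_fun_uminus: "ratpoly_fun r f \<Longrightarrow> ratpoly_fun r (\<lambda>z. - f z)"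
  using ratpoly_fun_mult[OF ratpoly_fun_of_rat[of r "-1"]] by simp

lemma ratpoly_fun_diff: "ratpoly_fun r f \<Longrightarrow> ratpoly_fun r g \<Longrightarrow> ratpoly_fun r (\<lambda>z. f z - g z)"
  using ratpoly_fun_add[OF _ ratpoly_fun_uminus] by fastforce

lemma ratpoly_fun_power: "ratpoly_fun r f \<Longrightarrow> ratpoly_fun r (\<lambda>z. f z ^ k)"
  by (induction k) (auto intro: ratpoly_fun_1 ratpoly_fun_mult)

lemma ratpoly_fun_sum:
  "(\<And>i. i \<in> A \<Longrightarrow> ratpoly_fun r (f i)) \<Longrightarrow> ratpoly_fun r (\<lambda>z. \<Sum>i\<in>A. f i z)"
  by (induction A rule: infinite_finite_induct) (auto intro: ratpoly_fun_0 ratpoly_fun_add)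

lemma ratpoly_fun_divide_numeral: "ratpoly_fun r f \<Longrightarrow> ratpoly_fun r (\<lambda>z. f z / numeral k)"
  using ratpoly_fun_mult[OF _ ratpoly_fun_of_rat[of r "1 / numeral k"], of f]
  by (simp add: of_rat_divide)

lemmas ratpoly_fun_intros =
  ratpoly_fun_numeral ratpoly_fun_1 ratpoly_fun_0 ratpoly_fun_of_nat ratpoly_fun_of_rat
  ratpoly_fun_ii ratpoly_fun_var ratpoly_fun_add ratpoly_fun_mult ratpoly_fun_uminus
  ratpoly_fun_diff ratpoly_fun_power ratpoly_fun_sum ratpoly_fun_divide_numeral

subsection \<open>Elementary symmetric functions and power sums\<close>

text \<open>Taking coefficients of a product of factors 1 + w_l t makes the function total in
  \<open>i\<close>, with value 0 beyond \<open>n\<close>, and turns prescribing its values into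
  factoring a polynomial. \<open>esym_eq_sum_subsets\<close> gives the form as a sum over
  subsets.\<close>

definition esym :: "nat \<Rightarrow> (nat \<Rightarrow> 'a :: comm_ring_1) \<Rightarrow> nat \<Rightarrow> 'a" where
  "esym n w i = coeff (\<Prod>l<n. [:1, w l:]) i"

lemma esym_Suc_0: "esym (Suc n) w 0 = esym n w 0"
  by (simp add: esym_def mult.commute)

lemma esym_0 [simp]: "esym n w 0 = 1"
  by (induction n) (simp_all add: esym_Suc_0, simp add: esym_def)

lemma esym_Suc_Suc: "esym (Suc n) w (Suc i) = esym n w (Suc i) + w n * esym n w i"
proof -
  have "(\<Prod>l<Suc n. [:1, w l:]) = (\<Prod>l<n. [:1, w l:]) + pCons 0 (smult (w n) (\<Prod>l<n. [:1, w l:]))"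
    by (simp add: mult.commute[of _ "[:1, w n:]"])
  then show ?thesis by (simp add: esym_def)
qed

lemma degree_prod_esym: "degree (\<Prod>l<n. [:1, w l:]) \<le> n"
proof (induction n)
  case (Suc n)
  have "degree ((\<Prod>l<n. [:1, w l:]) * [:1, w n:]) \<le> n + 1"
    by (rule order.trans[OF degree_mult_le]) (use Suc degree_pCons_le[of 1 "[:w n:]"] in auto)
  then show ?case by simp
qed simp

lemma esym_eq_0: "n < i \<Longrightarrow> esym n w i = 0"
  unfolding esym_def by (rule coeff_eq_0) (use degree_prod_esym[of w n] in simp)

lemma prod_eq_sum_esym: "(\<Prod>l<n. 1 + t * w l) = (\<Sum>i\<le>n. esym n w i * t ^ i)"
proof -
  let ?q = "\<Prod>l<n. [:1, w l:]"
  have "(\<Prod>l<n. 1 + t * w l) = poly ?q t"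
    by (simp add: poly_prod)
  also have "\<dots> = (\<Sum>i\<le>n. esym n w i * t ^ i)"
    unfolding esym_def
    by (rule poly_altdef[THEN trans])
      (rule sum.mono_neutral_left, use degree_prod_esym[of w n] in \<open>auto simp: coeff_eq_0\<close>)
  finally show ?thesis .
qed

text \<open>Newton's identities, by induction on the number of values: a new value x multiplies the
  generating polynomial by 1 + x t, and the power sums split into the old part \<open>P\<close> and
  the powers \<open>Q\<close> of x.\<close>

lemma newton_identity:
  fixes w :: "nat \<Rightarrow> 'a :: comm_ring_1"
  shows "of_nat (Suc i) * esym n w (Suc i) =
    (\<Sum>j\<le>i. esym n w (i - j) * ((-1) ^ j * (\<Sum>l<n. w l ^ Suc j)))"
proof (induction n arbitrary: i)
  case 0
  show ?case by (simp add: esym_eq_0)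
next
  case (Suc n)
  define x where "x = w n"
  define E where "E = esym n w"
  define P where "P j = (-1) ^ j * (\<Sum>l<n. w l ^ Suc j)" for j
  define Q where "Q j = (-1) ^ j * x ^ Suc j" for j
  have IH: "of_nat (Suc i) * E (Suc i) = (\<Sum>j\<le>i. E (i - j) * P j)" for i
    using Suc.IH[of i] by (simp add: E_def P_def)
  have E0: "E 0 = 1" by (simp add: E_def)
  have S0: "esym (Suc n) w 0 = 1" by simp
  have SS: "esym (Suc n) w (Suc k) = E (Suc k) + x * E k" for k
    by (simp add: esym_Suc_Suc E_def x_def)
  \<comment> \<open>In generating functions, (1 + x t) E(t) times x / (1 + x t) is x E(t).\<close>
  have tele: "(\<Sum>j\<le>k. esym (Suc n) w (k - j) * Q j) = x * E k" for k
  proof (induction k)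
    case 0
    show ?case by (simp add: E0 Q_def)
  next
    case (Suc k)
    have "(\<Sum>j\<le>Suc k. esym (Suc n) w (Suc k - j) * Q j) =
        esym (Suc n) w (Suc k) * x + (\<Sum>j\<le>k. esym (Suc n) w (k - j) * Q (Suc j))"
      by (subst sum.atMost_Suc_shift) (simp add: Q_def)
    also have "(\<Sum>j\<le>k. esym (Suc n) w (k - j) * Q (Suc j)) =
        - x * (\<Sum>j\<le>k. esym (Suc n) w (k - j) * Q j)"
      by (simp add: Q_def sum_distrib_left algebra_simps sum_negf)
    finally have "(\<Sum>j\<le>Suc k. esym (Suc n) w (Suc k - j) * Q j) = (E (Suc k) + x * E k) * x + - x * (x * E k)"
      unfolding Suc SS .
    also have "\<dots> = x * E (Suc k)" by (simp add: algebra_simps)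
    finally show ?case .
  qed
  have "(\<Sum>j\<le>i. esym (Suc n) w (i - j) * P j) =
      of_nat (Suc i) * E (Suc i) + of_nat i * x * E i"
  proof (cases i)
    case 0
    then show ?thesis using IH[of 0] by (simp add: E0)
  next
    case (Suc k)
    have "(\<Sum>j\<le>Suc k. esym (Suc n) w (Suc k - j) * P j) =
        (\<Sum>j\<le>k. (E (Suc k - j) + x * E (k - j)) * P j) + P (Suc k)"
      by (simp add: Suc_diff_le SS)
    also have "\<dots> = (\<Sum>j\<le>Suc k. E (Suc k - j) * P j) + x * (\<Sum>j\<le>k. E (k - j) * P j)"
      by (simp add: E0 algebra_simps sum.distrib sum_distrib_left)
    finally have "(\<Sum>j\<le>Suc k. esym (Suc n) w (Suc k - j) * P j) =
        of_nat (Suc (Suc k)) * E (Suc (Suc k)) + x * (of_nat (Suc k) * E (Suc k))"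
      by (simp only: IH)
    then show ?thesis
      unfolding Suc by (simp only: algebra_simps)
  qed
  moreover have split: "(\<Sum>j\<le>i. esym (Suc n) w (i - j) * ((-1) ^ j * (\<Sum>l<Suc n. w l ^ Suc j))) =
      (\<Sum>j\<le>i. esym (Suc n) w (i - j) * P j) + (\<Sum>j\<le>i. esym (Suc n) w (i - j) * Q j)"
    by (simp add: P_def Q_def x_def algebra_simps sum.distrib)
  ultimately show ?case
    unfolding split tele SS by (simp add: algebra_simps)
qed

text \<open>Newton's identities express power sums through elementary symmetric functions with
  integer coefficients. The quantifier over \<open>w\<close> lies inside, so that one
  \<open>P\<close> serves every family whose symmetric functions are prescribed by
  \<open>z\<close>.\<close>

lemma power_sum_ratpoly_fun:
  assumes "\<And>i. ratpoly_fun r (E i)"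
  shows "\<exists>P. ratpoly_fun r P \<and> (\<forall>z \<in> carrier_vec r. \<forall>w.
     (\<forall>i. esym n w i = E i z) \<longrightarrow> (\<Sum>l<n. w l ^ k) = P z)"
proof (induction k rule: less_induct)
  case (less k)
  show ?case
  proof (cases k)
    case 0
    show ?thesis unfolding 0
      by (rule exI[of _ "\<lambda>_. of_nat n"]) (simp add: ratpoly_fun_of_nat)
  next
    case (Suc i)
    have "\<exists>P. \<forall>j. j < k \<longrightarrow> ratpoly_fun r (P j) \<and> (\<forall>z \<in> carrier_vec r. \<forall>w.
     (\<forall>i. esym n w i = E i z) \<longrightarrow> (\<Sum>l<n. w l ^ j) = P j z)"
      using less by (intro choice) blast
    then obtain P where P0: "\<forall>j. j < k \<longrightarrow> ratpoly_fun r (P j) \<and> (\<forall>z \<in> carrier_vec r. \<forall>w.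
     (\<forall>i. esym n w i = E i z) \<longrightarrow> (\<Sum>l<n. w l ^ j) = P j z)" by blast
    have P: "\<And>j. j < k \<Longrightarrow> ratpoly_fun r (P j)"
      "\<And>j z w. j < k \<Longrightarrow> z \<in> carrier_vec r \<Longrightarrow> (\<And>i. esym n w i = E i z) \<Longrightarrow> (\<Sum>l<n. w l ^ j) = P j z"
      using P0 by blast+
    \<comment> \<open>The Newton identity solved for its summand j = i, whose factor e_0 is
      1.\<close>
    define Q where "Q z = (-1) ^ i * (of_nat (Suc i) * E (Suc i) z -
      (\<Sum>j<i. E (i - j) z * ((-1) ^ j * P (Suc j) z)))" for z
    have "ratpoly_fun r Q"
      unfolding Q_def by (intro ratpoly_fun_intros assms P(1)) (auto simp: Suc)
    moreover have "(\<Sum>l<n. w l ^ k) = Q z" if z: "z \<in> carrier_vec r" and w: "\<And>i. esym n w i = E i z" for z w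
    proof -
      have "of_nat (Suc i) * E (Suc i) z = (\<Sum>j\<le>i. E (i - j) z * ((-1) ^ j * (\<Sum>l<n. w l ^ Suc j)))"
        using newton_identity[of i n w] by (simp add: w)
      also have "\<dots> = (\<Sum>j<i. E (i - j) z * ((-1) ^ j * (\<Sum>l<n. w l ^ Suc j))) + (-1) ^ i * (\<Sum>l<n. w l ^ k)"
        using w[of 0] by (simp add: lessThan_Suc_atMost[symmetric] Suc)
      also have "(\<Sum>j<i. E (i - j) z * ((-1) ^ j * (\<Sum>l<n. w l ^ Suc j))) =
          (\<Sum>j<i. E (i - j) z * ((-1) ^ j * P (Suc j) z))"
        using P(2)[OF _ z w] by (intro sum.cong refl) (simp add: Suc del: power_Suc)
      finally have "Q z = (-1) ^ i * ((-1) ^ i * (\<Sum>l<n. w l ^ k))"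
        by (simp add: Q_def)
      then show ?thesis
        by (simp add: mult.assoc[symmetric] power_mult_distrib[symmetric])
    qed
    ultimately show ?thesis by blast
  qed
qed

text \<open>Constant coefficient 1 excludes the root 0, so a root a splits off as the factor 1 - t /
  a, and the quotient again has constant coefficient 1.\<close>

lemma poly_eq_prod_linear:
  fixes q :: "complex poly"
  assumes "degree q \<le> n" "coeff q 0 = 1"
  shows "\<exists>w. q = (\<Prod>l<n. [:1, w l:])"
  using assms
proof (induction n arbitrary: q)
  case 0
  then show ?case by (metis degree_0_id lessThan_0 prod.empty le_zero_eq one_pCons)
next
  case (Suc n)
  show ?case
  proof (cases "degree q = 0")
    case True
    then have "q = 1" using Suc.prems by (metis degree_0_id one_pCons)
    \<comment> \<open>Zero parameters give factors 1 and pad the product when the degree is below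
      the number of factors.\<close>
    then show ?thesis by (intro exI[of _ "\<lambda>_. 0"]) (simp add: one_pCons[symmetric])
  next
    case False
    then have "\<not> constant (poly q)" by (simp add: constant_degree)
    then obtain a where a: "poly q a = 0" using fundamental_theorem_of_algebra by blast
    have a0: "a \<noteq> 0" using a Suc.prems by (metis poly_0_coeff_0 zero_neq_one)
    obtain q' where q': "q = [:-a, 1:] * q'" using a by (metis dvdE poly_eq_0_iff_dvd)
    define q'' where "q'' = smult (-a) q'"
    have q: "q = [:1, -1/a:] * q''"
      unfolding q' q''_def using a0 by (simp add: field_simps)
    have "degree q = Suc (degree q'')"
      unfolding q by (subst degree_mult_eq) (use a0 False q in auto)
    moreover have "coeff q'' 0 = 1"
      using Suc.prems(2) unfolding q by simp
    ultimately obtain w where w: "q'' = (\<Prod>l<n. [:1, w l:])"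
      using Suc by (metis Suc_le_mono)
    show ?thesis
      by (rule exI[of _ "w(n := -1/a)"]) (simp add: q w mult.commute)
  qed
qed

text \<open>Here algebraic closedness enters the lifting of real points: the family is read off the
  linear factors of the polynomial with coefficients \<open>e i\<close>.\<close>

lemma esym_surj:
  fixes e :: "nat \<Rightarrow> complex"
  assumes "e 0 = 1"
  shows "\<exists>w. \<forall>i\<le>n. esym n w i = e i"
proof -
  let ?q = "\<Sum>i\<le>n. monom (e i) i"
  have c: "coeff ?q i = (if i \<le> n then e i else 0)" for i
    by (simp add: coeff_sum if_distrib)
  have "degree ?q \<le> n" by (rule degree_le) (simp add: c)
  then obtain w where "?q = (\<Prod>l<n. [:1, w l:])"
    using poly_eq_prod_linear[of ?q n] c[of 0] assms by auto
  then show ?thesis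
    by (intro exI[of _ w]) (metis c esym_def)
qed

subsection \<open>Chebyshev polynomials and the Hankel identity\<close>

fun cheb :: "nat \<Rightarrow> complex \<Rightarrow> complex" where
  "cheb 0 c = 1"
| "cheb (Suc 0) c = c"
| "cheb (Suc (Suc k)) c = 2 * c * cheb (Suc k) c - cheb k c"

lemma cheb_joukowski:
  assumes "y \<noteq> 0"
  shows "cheb k ((y + inverse y) / 2) = (y ^ k + inverse y ^ k) / 2"
proof (induction k rule: induct_nat_012)
  case (ge2 k)
  show ?case
    unfolding cheb.simps ge2 using assms by (simp add: field_simps)
qed simp_all

text \<open>The factor \<open>w l ^ j\<close> makes the induction close, since the three-term
  recurrence multiplies by 2 w_l and thereby raises j.\<close>

lemma cheb_sum_ratpoly_fun:
  assumes "\<And>i. ratpoly_fun r (E i)"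
  shows "\<exists>P. ratpoly_fun r P \<and> (\<forall>z \<in> carrier_vec r. \<forall>w.
     (\<forall>i. esym n w i = E i z) \<longrightarrow> (\<Sum>l<n. w l ^ j * cheb k (w l)) = P z)"
proof (induction k arbitrary: j rule: induct_nat_012)
  case 0
  show ?case using power_sum_ratpoly_fun[of r E n j] assms by simp
next
  case 1
  show ?case using power_sum_ratpoly_fun[of r E n "Suc j"] assms by (simp add: mult.commute)
next
  case (ge2 k)
  obtain P where P: "ratpoly_fun r P" "\<forall>z \<in> carrier_vec r. \<forall>w. (\<forall>i. esym n w i = E i z) \<longrightarrow>
      (\<Sum>l<n. w l ^ Suc j * cheb (Suc k) (w l)) = P z"
    using ge2(2) by blast
  obtain Q where Q: "ratpoly_fun r Q" "\<forall>z \<in> carrier_vec r. \<forall>w. (\<forall>i. esym n w i = E i z) \<longrightarrow>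
      (\<Sum>l<n. w l ^ j * cheb k (w l)) = Q z"
    using ge2(1) by blast
  show ?case
  proof (intro exI[of _ "\<lambda>z. 2 * P z - Q z"] conjI ballI allI impI)
    show "ratpoly_fun r (\<lambda>z. 2 * P z - Q z)"
      by (intro ratpoly_fun_intros P Q)
    fix z w assume "z \<in> carrier_vec r" "\<forall>i. esym n w i = E i z"
    then have "P z = (\<Sum>l<n. w l ^ Suc j * cheb (Suc k) (w l))" "Q z = (\<Sum>l<n. w l ^ j * cheb k (w l))"
      using P(2) Q(2) by auto
    then show "(\<Sum>l<n. w l ^ j * cheb (Suc (Suc k)) (w l)) = 2 * P z - Q z"
      by (simp add: sum_distrib_left sum_subtractf algebra_simps)
  qed
qed

text \<open>By c T_(k+1) = (T_(k+2) + T_k) / 2 a power of c is traded for Chebyshev values of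
  neighbouring index, so mixed sums with all \<open>k\<close> are carried through the induction on
  \<open>j\<close>.\<close>

lemma power_sum_real_of_cheb:
  assumes "\<And>k. (\<Sum>l<n. cheb k (c l)) \<in> \<real>"
  shows "(\<Sum>l<n. c l ^ j) \<in> \<real>"
proof -
  have "(\<Sum>l<n. c l ^ j * cheb k (c l)) \<in> \<real>" for k
  proof (induction j arbitrary: k)
    case 0
    then show ?case using assms by simp
  next
    case (Suc j)
    show ?case
    proof (cases k)
      case 0
      then show ?thesis using Suc[of 1] by (simp add: mult.commute)
    next
      case (Suc i)
      have "(\<Sum>l<n. c l ^ Suc j * cheb k (c l)) =
          ((\<Sum>l<n. c l ^ j * cheb (Suc k) (c l)) + (\<Sum>l<n. c l ^ j * cheb i (c l))) / 2"
        unfolding sum.distrib[symmetric] sum_divide_distrib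
        by (intro sum.cong refl) (simp add: Suc algebra_simps)
      then show ?thesis by (simp only: Suc.IH Reals_add Reals_divide Reals_numeral)
    qed
  qed
  from this[of 0] show ?thesis by simp
qed

lemma sum_fold_symmetric:
  fixes g :: "nat \<Rightarrow> 'a :: comm_monoid_add"
  shows "(\<Sum>l\<le>m. g l) = (\<Sum>l<(m + 1) div 2. g l + g (m - l)) + (if even m then g (m div 2) else 0)"
proof -
  define h where "h = (m + 1) div 2"
  have "(\<Sum>l<h. g (m - l)) = (\<Sum>l\<in>{m - h<..m}. g l)"
    by (rule sum.reindex_bij_witness[of _ "\<lambda>l. m - l" "\<lambda>l. m - l"]) (auto simp: h_def)
  moreover have "{..m} = {..<h} \<union> {m - h<..m} \<union> (if even m then {m div 2} else {})"
    unfolding h_def by (auto elim!: evenE oddE)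
  moreover have "sum g ({..<h} \<union> {m - h<..m} \<union> (if even m then {m div 2} else {})) =
      sum g {..<h} + sum g {m - h<..m} + (if even m then g (m div 2) else 0)"
    by (subst sum.union_disjoint, force, force, force simp: h_def elim!: evenE oddE,
        subst sum.union_disjoint, force, force, force simp: h_def elim!: evenE oddE, simp)
  ultimately show ?thesis
    by (simp add: sum.distrib h_def)
qed

text \<open>With s = y + y^-1 = 2 c the right-hand side is (4 s^(m-2) - s^m) / 2. Expanding both
  powers binomially and pairing the exponents m - 2l and -(m - 2l) gives the Chebyshev values; the
  two binomial coefficients are those of y^(m-2l) in s^(m-2) and in s^m.\<close>

lemma hankel_cheb_identity:
  assumes y: "y \<noteq> 0" and m: "m \<ge> 2"
  defines "c \<equiv> (y + inverse y) / 2"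
  shows "- cheb m c + (\<Sum>l = 1..nat \<lceil>real m / 2\<rceil> - 1.
           (4 * of_nat ((m - 2) choose (l - 1)) - of_nat (m choose l)) * cheb (m - 2 * l) c)
      + 1 / 2 * (if even m
           then 4 * of_nat ((m - 2) choose (m div 2 - 1)) - of_nat (m choose (m div 2)) else 0)
    = 2 ^ m * (c ^ (m - 2) * (1 - c\<^sup>2) / 2)"
proof -
  define f where "f l = y ^ (m - l) * inverse y ^ l" for l
  \<comment> \<open>In s^(m-2) the power y^(m-2l) has index l - 1. The guard is essential at l = 0,
    where truncated subtraction would give 4 in place of 0.\<close>
  define b where "b l = (if 1 \<le> l \<and> l \<le> m - 1 then 4 * of_nat ((m - 2) choose (l - 1)) else 0 :: complex)" for l
  define a where "a l = b l - of_nat (m choose l)" for l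
  obtain m' where m': "m = m' + 2" using m le_Suc_ex[of 2 m] by auto
  have y1: "y ^ (i + j) * inverse y ^ j = y ^ i" for i j
    using y by (simp add: power_add power_mult_distrib[symmetric] mult.assoc)
  have y2: "y ^ j * inverse y ^ (i + j) = inverse y ^ i" for i j
    using y by (simp add: power_add field_simps)
  have f_sym: "f l + f (m - l) = 2 * cheb (m - 2 * l) c" if "2 * l \<le> m" for l
  proof -
    define i where "i = m - 2 * l"
    have i: "m = i + 2 * l" using that by (simp add: i_def)
    have "f l = y ^ i" "f (m - l) = inverse y ^ i"
      unfolding f_def i using y1[of i l] y2[of l i] by (simp_all add: mult_2)
    then show ?thesis by (simp add: i c_def cheb_joukowski[OF y])
  qed
  have "(y + inverse y) ^ m = (\<Sum>l\<le>m. of_nat (m choose l) * f l)"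
    unfolding add.commute[of y] binomial_ring by (simp add: f_def mult_ac)
  moreover have "4 * (y + inverse y) ^ (m - 2) = (\<Sum>l\<le>m. b l * f l)"
  proof -
    have "4 * (y + inverse y) ^ m' = (\<Sum>l\<le>m'. 4 * of_nat (m' choose l) * f (Suc l))"
      unfolding add.commute[of y] binomial_ring sum_distrib_left
    proof (intro sum.cong refl)
      fix l assume "l \<in> {..m'}"
      then obtain i where "m' = i + l" using le_Suc_ex[of l m'] by auto
      then show "4 * (of_nat (m' choose l) * inverse y ^ l * y ^ (m' - l)) =
          4 * of_nat (m' choose l) * f (Suc l)"
        using y1[of i 1] y by (simp add: f_def m')
    qed
    also have "\<dots> = (\<Sum>l\<le>m'. b (Suc l) * f (Suc l))"
      by (intro sum.cong refl) (auto simp: b_def m')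
    also have "\<dots> = (\<Sum>l\<le>m. b l * f l)"
    proof -
      have "b 0 = 0" "b (Suc (Suc m')) = 0" by (auto simp: b_def m')
      then show ?thesis
        using sum.atMost_Suc_shift[of "\<lambda>l. b l * f l" m'] unfolding m' by simp
    qed
    finally show ?thesis by (simp add: m')
  qed
  ultimately have "4 * (y + inverse y) ^ (m - 2) - (y + inverse y) ^ m = (\<Sum>l\<le>m. a l * f l)"
    by (simp add: a_def sum_subtractf algebra_simps)
  moreover have "2 ^ m * (c ^ (m - 2) * (1 - c\<^sup>2)) = 4 * (y + inverse y) ^ (m - 2) - (y + inverse y) ^ m"
  proof -
    have "2 ^ m * ((s / 2) ^ (m - 2) * (1 - (s / 2)\<^sup>2)) = 4 * s ^ (m - 2) - s ^ m" for s :: complex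
    proof -
      have "2 ^ m' * (s / 2) ^ m' = s ^ m'" by (simp add: power_divide)
      moreover have "2 ^ m * ((s / 2) ^ m' * (1 - (s / 2)\<^sup>2)) = (2 ^ m' * (s / 2) ^ m') * (4 - s\<^sup>2)"
        by (simp add: m' power_add power2_eq_square algebra_simps)
      ultimately show ?thesis by (simp add: m' power_add power2_eq_square algebra_simps)
    qed
    from this[of "y + inverse y"] show ?thesis by (simp add: c_def)
  qed
  \<comment> \<open>For even m the middle term has no partner: it occurs once while each pair
    contributes twice a Chebyshev value, which is the origin of the factor 1/2 in
    \<open>hankel_entry\<close>.\<close>
  moreover have "(\<Sum>l\<le>m. a l * f l) = (\<Sum>l<(m + 1) div 2. a l * (2 * cheb (m - 2 * l) c)) +
      (if even m then a (m div 2) else 0)"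
  proof -
    have "a (m - l) = a l" if "l < (m + 1) div 2" for l
    proof -
      have "m choose (m - l) = m choose l"
        by (rule binomial_symmetric[symmetric]) (use that in auto)
      moreover have "b (m - l) = b l"
        using that binomial_symmetric[of "l - 1" "m - 2"] by (auto simp: b_def m')
      ultimately show ?thesis by (simp add: a_def)
    qed
    moreover have "f (m div 2) = 1" if "even m"
      using f_sym[of "m div 2"] that by (auto elim!: evenE)
    ultimately have "(\<Sum>l\<le>m. a l * f l) = (\<Sum>l<(m + 1) div 2. a l * (f l + f (m - l))) +
        (if even m then a (m div 2) else 0)"
      by (subst sum_fold_symmetric) (simp add: distrib_left)
    also have "(\<Sum>l<(m + 1) div 2. a l * (f l + f (m - l))) = (\<Sum>l<(m + 1) div 2. a l * (2 * cheb (m - 2 * l) c))"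
      by (intro sum.cong refl) (subst f_sym, auto)
    finally show ?thesis .
  qed
  ultimately have main: "2 ^ m * (c ^ (m - 2) * (1 - c\<^sup>2) / 2) = (\<Sum>l<(m + 1) div 2. a l * cheb (m - 2 * l) c) +
      (if even m then a (m div 2) else 0) / 2"
    by (simp add: sum_distrib_left add_divide_distrib sum_divide_distrib)
  have h: "nat \<lceil>real m / 2\<rceil> = (m + 1) div 2"
    by linarith
  \<comment> \<open>The summand l = 0 is the leading term - T_m, since \<open>a 0\<close> is
    -1.\<close>
  have "{..<(m + 1) div 2} = insert 0 {1..(m + 1) div 2 - 1}"
    using m by auto
  then have "(\<Sum>l<(m + 1) div 2. a l * cheb (m - 2 * l) c) =
      - cheb m c + (\<Sum>l = 1..(m + 1) div 2 - 1. a l * cheb (m - 2 * l) c)"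
    by (simp add: a_def b_def)
  also have "(\<Sum>l = 1..(m + 1) div 2 - 1. a l * cheb (m - 2 * l) c) =
      (\<Sum>l = 1..(m + 1) div 2 - 1. (4 * of_nat ((m - 2) choose (l - 1)) - of_nat (m choose l)) * cheb (m - 2 * l) c)"
    by (intro sum.cong refl) (auto simp: a_def b_def)
  finally have fold: "(\<Sum>l<(m + 1) div 2. a l * cheb (m - 2 * l) c) =
      - cheb m c + (\<Sum>l = 1..(m + 1) div 2 - 1. (4 * of_nat ((m - 2) choose (l - 1)) - of_nat (m choose l)) * cheb (m - 2 * l) c)" .
  have half: "a (m div 2) = 4 * of_nat ((m - 2) choose (m div 2 - 1)) - of_nat (m choose (m div 2))" if "even m"
  proof -
    have "m div 2 \<ge> 1" "m div 2 \<le> m - 1" using m that by (auto elim!: evenE)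
    then show ?thesis by (simp add: a_def b_def)
  qed
  show ?thesis
    unfolding main h fold using half by simp
qed

subsection \<open>Zariski density of the torus\<close>

text \<open>Induction on the number of variables: the sum is a polynomial in the last variable, and
  its coefficient at the exponent \<open>ex m r\<close> collects exactly the monomials of
  \<open>?M\<close>, which differ in the remaining variables. Abstract exponent functions
  \<open>ex\<close> let the same index type serve all r.\<close>

lemma monomials_independent:
  fixes ex :: "'a \<Rightarrow> nat \<Rightarrow> nat" and a :: "'a \<Rightarrow> 'b :: {idom, ring_char_0}"
  assumes "finite M" "\<And>m m'. m \<in> M \<Longrightarrow> m' \<in> M \<Longrightarrow> (\<And>i. i < r \<Longrightarrow> ex m i = ex m' i) \<Longrightarrow> m = m'"
    and "\<And>z :: nat \<Rightarrow> 'b. (\<Sum>m\<in>M. a m * (\<Prod>i<r. z i ^ ex m i)) = 0" and "m \<in> M"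
  shows "a m = 0"
  using assms
proof (induction r arbitrary: M)
  case 0
  then have "M = {m}" by auto
  then show ?case using "0.prems"(3) by simp
next
  case (Suc r)
  let ?M = "{m' \<in> M. ex m' r = ex m r}"
  have "(\<Sum>m\<in>?M. a m * (\<Prod>i<r. z i ^ ex m i)) = 0" for z
  proof -
    define q where "q = (\<Sum>m\<in>M. monom (a m * (\<Prod>i<r. z i ^ ex m i)) (ex m r))"
    have "poly q t = 0" for t
    proof -
      have "poly q t = (\<Sum>m\<in>M. a m * (\<Prod>i<Suc r. (z(r := t)) i ^ ex m i))"
        unfolding q_def poly_sum by (intro sum.cong refl) (simp add: poly_monom mult.assoc)
      then show ?thesis using Suc.prems(3)[of "z(r := t)"] by simp
    qed
    then have "q = 0" using poly_all_0_iff_0 by blast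
    then have "coeff q (ex m r) = 0" by simp
    moreover have "coeff q (ex m r) = (\<Sum>m\<in>?M. a m * (\<Prod>i<r. z i ^ ex m i))"
      unfolding q_def coeff_sum using Suc.prems(1)
      by (intro sum.mono_neutral_cong_right) auto
    ultimately show ?thesis by simp
  qed
  then show ?case
  proof (intro Suc.IH[of ?M])
    fix m1 m2 assume "m1 \<in> ?M" "m2 \<in> ?M" "\<And>i. i < r \<Longrightarrow> ex m1 i = ex m2 i"
    then show "m1 = m2" by (intro Suc.prems(2)) (auto simp: less_Suc_eq)
  qed (use Suc.prems in auto)
qed

lemma mpoly_eq_0:
  assumes "p \<in> mpoly_ring r" and "\<And>z. z \<in> carrier_vec r \<Longrightarrow> mpoly_eval p z = 0"
  shows "p = 0"
proof -
  have keys: "Poly_Mapping.keys m \<subseteq> {..<r}" if "m \<in> Poly_Mapping.keys p" for m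
    using assms(1) that by (auto simp: mpoly_ring_def)
  have "real_of_rat (Poly_Mapping.lookup p m) = 0" if "m \<in> Poly_Mapping.keys p" for m
  proof (rule monomials_independent[where M = "Poly_Mapping.keys p" and r = r
        and a = "\<lambda>m. real_of_rat (Poly_Mapping.lookup p m)" and ex = Poly_Mapping.lookup])
    fix m m' assume *: "m \<in> Poly_Mapping.keys p" "m' \<in> Poly_Mapping.keys p"
      "\<And>i. i < r \<Longrightarrow> Poly_Mapping.lookup m i = Poly_Mapping.lookup m' i"
    show "m = m'"
    proof (rule poly_mapping_eqI)
      fix i
      show "Poly_Mapping.lookup m i = Poly_Mapping.lookup m' i"
      proof (cases "i < r")
        case False
        then have "i \<notin> Poly_Mapping.keys m" "i \<notin> Poly_Mapping.keys m'"
          using keys[OF *(1)] keys[OF *(2)] by auto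
        then show ?thesis by (simp add: in_keys_iff)
      qed (use * in auto)
    qed
  next
    fix z :: "nat \<Rightarrow> real"
    have "(\<Prod>i<r. z i ^ Poly_Mapping.lookup m i) =
        (\<Prod>i\<in>Poly_Mapping.keys m. (vec r z $ i) ^ Poly_Mapping.lookup m i)" if "m \<in> Poly_Mapping.keys p" for m
      using keys[OF that] by (intro prod.mono_neutral_cong_right) (auto simp: in_keys_iff subset_iff)
    then have "(\<Sum>m\<in>Poly_Mapping.keys p. real_of_rat (Poly_Mapping.lookup p m) * (\<Prod>i<r. z i ^ Poly_Mapping.lookup m i)) =
        mpoly_eval p (vec r z)"
      unfolding mpoly_eval_def by (intro sum.cong refl) simp
    then show "(\<Sum>m\<in>Poly_Mapping.keys p. real_of_rat (Poly_Mapping.lookup p m) * (\<Prod>i<r. z i ^ Poly_Mapping.lookup m i)) = 0"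
      using assms(2)[of "vec r z"] by simp
  qed (use that in auto)
  then show ?thesis by (intro poly_mapping_eqI) (metis in_keys_iff lookup_zero of_rat_eq_0_iff)
qed

section \<open>Laurent polynomials in one variable\<close>

definition laurent_fun :: "(complex \<Rightarrow> complex) \<Rightarrow> bool" where
  "laurent_fun f \<longleftrightarrow> (\<exists>N q. \<forall>t. t \<noteq> 0 \<longrightarrow> f t * t ^ N = poly q t)"

lemma laurent_fun_const: "laurent_fun (\<lambda>_. c)"
  unfolding laurent_fun_def by (intro exI[of _ 0] exI[of _ "[:c:]"]) simp

lemma laurent_fun_add:
  assumes "laurent_fun f" "laurent_fun g"
  shows "laurent_fun (\<lambda>t. f t + g t)"
proof -
  from assms obtain N q M p where *: "\<And>t. t \<noteq> 0 \<Longrightarrow> f t * t ^ N = poly q t" "\<And>t. t \<noteq> 0 \<Longrightarrow> g t * t ^ M = poly p t"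
    unfolding laurent_fun_def by metis
  have "(f t + g t) * t ^ (N + M) = poly (q * monom 1 M + p * monom 1 N) t" if "t \<noteq> 0" for t
    by (simp add: poly_monom *(1)[OF that, symmetric] *(2)[OF that, symmetric] power_add algebra_simps)
  then show ?thesis unfolding laurent_fun_def by blast
qed

lemma laurent_fun_mult:
  assumes "laurent_fun f" "laurent_fun g"
  shows "laurent_fun (\<lambda>t. f t * g t)"
proof -
  from assms obtain N q M p where *: "\<And>t. t \<noteq> 0 \<Longrightarrow> f t * t ^ N = poly q t" "\<And>t. t \<noteq> 0 \<Longrightarrow> g t * t ^ M = poly p t"
    unfolding laurent_fun_def by metis
  have "(f t * g t) * t ^ (N + M) = poly (q * p) t" if "t \<noteq> 0" for t
    by (simp add: *(1)[OF that, symmetric] *(2)[OF that, symmetric] power_add algebra_simps)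
  then show ?thesis unfolding laurent_fun_def by blast
qed

lemma laurent_fun_powi: "laurent_fun (\<lambda>t. t powi k)"
proof (cases "k \<ge> 0")
  case True
  then show ?thesis
    unfolding laurent_fun_def by (intro exI[of _ 0] exI[of _ "monom 1 (nat k)"]) (simp add: poly_monom power_int_def)
next
  case False
  then show ?thesis
    unfolding laurent_fun_def by (intro exI[of _ "nat (- k)"] exI[of _ 1]) (simp add: power_int_def field_simps)
qed

lemma laurent_fun_sum: "(\<And>i. i \<in> A \<Longrightarrow> laurent_fun (f i)) \<Longrightarrow> laurent_fun (\<lambda>t. \<Sum>i\<in>A. f i t)"
  by (induction A rule: infinite_finite_induct) (auto intro: laurent_fun_const laurent_fun_add)

lemma laurent_fun_prod: "(\<And>i. i \<in> A \<Longrightarrow> laurent_fun (f i)) \<Longrightarrow> laurent_fun (\<lambda>t. \<Prod>i\<in>A. f i t)"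
  by (induction A rule: infinite_finite_induct) (auto intro: laurent_fun_const laurent_fun_mult)

lemma laurent_fun_power: "laurent_fun f \<Longrightarrow> laurent_fun (\<lambda>t. f t ^ k)"
  by (induction k) (auto intro: laurent_fun_const laurent_fun_mult)

lemma laurent_fun_diff: "laurent_fun f \<Longrightarrow> laurent_fun g \<Longrightarrow> laurent_fun (\<lambda>t. f t - g t)"
  using laurent_fun_add[OF _ laurent_fun_mult[OF laurent_fun_const[of "-1"]], of f g] by simp

lemma laurent_fun_divide_const: "laurent_fun f \<Longrightarrow> laurent_fun (\<lambda>t. f t / c)"
  using laurent_fun_mult[OF _ laurent_fun_const[of "1 / c"], of f] by simp

lemma laurent_fun_If: "laurent_fun f \<Longrightarrow> laurent_fun g \<Longrightarrow> laurent_fun (\<lambda>t. if P then f t else g t)"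
  by (cases P) simp_all

lemma infinite_unit_circle: "infinite {t. cmod t = 1}"
proof -
  have "infinite ((\<lambda>s. Complex s (sqrt (1 - s\<^sup>2))) ` {0<..<1})"
    by (subst finite_image_iff) (auto simp: inj_on_def)
  moreover have "cmod (Complex s (sqrt (1 - s\<^sup>2))) = 1" if "0 < s" "s < 1" for s
  proof -
    have "s\<^sup>2 \<le> 1" using that by (simp add: abs_square_le_1)
    then show ?thesis by (simp add: cmod_def)
  qed
  then have "(\<lambda>s. Complex s (sqrt (1 - s\<^sup>2))) ` {0<..<1} \<subseteq> {t. cmod t = 1}" by auto
  ultimately show ?thesis using finite_subset by blast
qed

lemma laurent_fun_eq_0:
  assumes "laurent_fun f" "\<And>t. cmod t = 1 \<Longrightarrow> f t = 0" "t \<noteq> 0"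
  shows "f t = 0"
proof -
  obtain N q where q: "\<And>t. t \<noteq> 0 \<Longrightarrow> f t * t ^ N = poly q t"
    using assms(1) unfolding laurent_fun_def by blast
  have "poly q s = 0" if "cmod s = 1" for s
  proof -
    have "s \<noteq> 0" using that by auto
    then show ?thesis using q[of s] assms(2)[OF that] by simp
  qed
  then have "{t. cmod t = 1} \<subseteq> {t. poly q t = 0}" by blast
  then have "q = 0" using poly_roots_finite infinite_unit_circle finite_subset by blast
  then show ?thesis using q[OF assms(3)] assms(3) by simp
qed

text \<open>The coordinates leave the unit circle one at a time: \<open>j\<close> counts those
  already arbitrary, and in each step the one-variable Laurent function vanishes on the circle,
  hence at all nonzero arguments. Thus being Laurent in each variable separately is enough.\<close>

lemma torus_zariski_dense:
  fixes F :: "complex vec \<Rightarrow> complex"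
  assumes laurent: "\<And>x k. x \<in> carrier_vec r \<Longrightarrow> (\<And>i. i < r \<Longrightarrow> x $ i \<noteq> 0) \<Longrightarrow> k < r \<Longrightarrow>
      laurent_fun (\<lambda>t. F (vec r (\<lambda>i. if i = k then t else x $ i)))"
    and zero: "\<And>x. x \<in> torus r \<Longrightarrow> F x = 0"
    and x: "x \<in> carrier_vec r" "\<And>i. i < r \<Longrightarrow> x $ i \<noteq> 0"
  shows "F x = 0"
proof -
  have "F x = 0" if "x \<in> carrier_vec r" "\<And>i. i < r \<Longrightarrow> x $ i \<noteq> 0"
      "\<And>i. j \<le> i \<Longrightarrow> i < r \<Longrightarrow> cmod (x $ i) = 1" "j \<le> r" for j x
    using that
  proof (induction j arbitrary: x)
    case 0
    then show ?case by (intro zero) (auto simp: torus_def)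
  next
    case (Suc j)
    let ?x = "\<lambda>t. vec r (\<lambda>i. if i = j then t else x $ i)"
    have "F (?x (x $ j)) = 0"
    proof (rule laurent_fun_eq_0[where f = "\<lambda>t. F (?x t)"])
      show "laurent_fun (\<lambda>t. F (?x t))" using Suc.prems by (intro laurent) auto
      show "F (?x t) = 0" if "cmod t = 1" for t
        using that Suc.prems by (intro Suc.IH) auto
    qed (use Suc.prems in auto)
    moreover have "?x (x $ j) = x" using Suc.prems(1) by (intro eq_vecI) auto
    ultimately show ?case by simp
  qed
  from this[of x r] x(1) x(2) show ?thesis by auto
qed

text \<open>Off the torus the functions \<theta>_j may take non-real values even in their real
  versions, so the identities to be extended by density have to be stated for complex
  arguments.\<close>

definition mpoly_ceval :: "rat_mpoly \<Rightarrow> (nat \<Rightarrow> complex) \<Rightarrow> complex" where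
  "mpoly_ceval p z = (\<Sum>m \<in> Poly_Mapping.keys p. of_rat (Poly_Mapping.lookup p m) *
     (\<Prod>i \<in> Poly_Mapping.keys m. z i ^ Poly_Mapping.lookup m i))"

lemma mpoly_ceval_of_real:
  assumes "p \<in> mpoly_ring r" "\<And>i. i < r \<Longrightarrow> z i = of_real (z' $ i)"
  shows "mpoly_ceval p z = of_real (mpoly_eval p z')"
  unfolding mpoly_ceval_def mpoly_eval_def of_real_sum of_real_mult of_real_prod of_real_power
proof (intro sum.cong refl arg_cong2[where f = "(*)"] prod.cong arg_cong2[where f = "(^)"])
  fix m i assume "m \<in> Poly_Mapping.keys p" "i \<in> Poly_Mapping.keys m"
  then have "i < r" using assms(1) by (auto simp: mpoly_ring_def)
  then show "z i = of_real (z' $ i)" by (rule assms(2))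
qed (simp add: complex_of_rat)

lemma laurent_fun_mpoly_ceval:
  assumes "\<And>i. laurent_fun (\<lambda>t. z t i)"
  shows "laurent_fun (\<lambda>t. mpoly_ceval p (z t))"
  unfolding mpoly_ceval_def
  by (intro laurent_fun_sum laurent_fun_mult laurent_fun_const laurent_fun_prod laurent_fun_power assms)

subsection \<open>Hermite's criterion\<close>

lemma sum_eq_sum_multiplicities:
  fixes f :: "'a \<Rightarrow> 'b :: semiring_1" and n :: nat
  assumes "finite B" "\<And>x. x \<notin> B \<Longrightarrow> f x = 0"
  shows "(\<Sum>l<n. f (c l)) = (\<Sum>b\<in>B. of_nat (card {l. l < n \<and> c l = b}) * f b)"
proof -
  have "(\<Sum>l<n. f (c l)) = (\<Sum>l<n. \<Sum>b\<in>B. if c l = b then f b else 0)"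
    using assms by (intro sum.cong refl) (simp add: sum.delta)
  also have "\<dots> = (\<Sum>b\<in>B. \<Sum>l<n. if c l = b then f b else 0)"
    by (rule sum.swap)
  also have "\<dots> = (\<Sum>b\<in>B. of_nat (card {l. l < n \<and> c l = b}) * f b)"
    by (intro sum.cong refl) (simp flip: sum.inter_filter)
  finally show ?thesis .
qed

lemma sum_poly_cnj:
  fixes c :: "nat \<Rightarrow> complex"
  assumes "\<And>k. (\<Sum>l<n. c l ^ k) \<in> \<real>"
  shows "(\<Sum>l<n. poly q (cnj (c l))) = (\<Sum>l<n. poly q (c l))"
proof -
  have "cnj (\<Sum>l<n. c l ^ k) = (\<Sum>l<n. c l ^ k)" for k
    using assms Reals_cnj_iff by blast
  then have "(\<Sum>l<n. cnj (c l) ^ k) = (\<Sum>l<n. c l ^ k)" for k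
    by (simp add: cnj_sum)
  then show ?thesis
    unfolding poly_altdef by (subst (1 2) sum.swap) (simp add: sum_distrib_left[symmetric])
qed

text \<open>Real power sums make the sum of any polynomial over the c_l equal to that over their
  conjugates. A polynomial vanishing at all points of \<open>Z\<close> except a then compares the
  multiplicities at a.\<close>

lemma multiplicity_cnj:
  fixes c :: "nat \<Rightarrow> complex"
  assumes "\<And>k. (\<Sum>l<n. c l ^ k) \<in> \<real>"
  shows "card {l. l < n \<and> c l = cnj a} = card {l. l < n \<and> c l = a}"
proof -
  define Z where "Z = c ` {..<n} \<union> cnj ` c ` {..<n}"
  define g where "g = (\<Prod>b\<in>Z - {a}. [:-b, 1:])"
  have Z: "finite Z" by (simp add: Z_def)
  have g: "poly g x = (\<Prod>b\<in>Z - {a}. x - b)" for x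
    by (simp add: g_def poly_prod)
  have ga: "poly g a \<noteq> 0" unfolding g using Z by simp
  have g0: "poly g x = 0" if "x \<in> Z" "x \<noteq> a" for x
    unfolding g using that Z by (intro prod_zero) auto
  have eq: "(\<Sum>l<n. poly g (d l)) = of_nat (card {l. l < n \<and> d l = a}) * poly g a"
    if "d ` {..<n} \<subseteq> Z" for d
  proof -
    have "(\<Sum>l<n. poly g (d l)) = (\<Sum>l<n. (if d l = a then poly g a else 0))"
      by (intro sum.cong refl) (use that g0 in auto)
    also have "\<dots> = of_nat (card {l. l < n \<and> d l = a}) * poly g a"
      by (simp flip: sum.inter_filter)
    finally show ?thesis .
  qed
  have "of_nat (card {l. l < n \<and> cnj (c l) = a}) * poly g a = of_nat (card {l. l < n \<and> c l = a}) * poly g a"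
    using eq[of c] eq[of "\<lambda>l. cnj (c l)"] sum_poly_cnj[OF assms, of g] ga
    by (auto simp add: Z_def image_image)
  then have "card {l. l < n \<and> cnj (c l) = a} = card {l. l < n \<and> c l = a}"
    using ga by simp
  moreover have "cnj x = a \<longleftrightarrow> x = cnj a" for x by auto
  ultimately show ?thesis by simp
qed

text \<open>Symmetrising a complex polynomial with its conjugate yields real coefficients, hence a
  vector at which the quadratic form may be evaluated.\<close>

lemma sum_power_eq_poly_plus_cnj:
  assumes "degree h < n"
  shows "(\<Sum>i<n. of_real (2 * Re (coeff h i)) * z ^ i) = poly h z + cnj (poly h (cnj z))"
proof -
  have "poly h x = (\<Sum>i<n. coeff h i * x ^ i)" for x
    unfolding poly_altdef using assms
    by (intro sum.mono_neutral_left) (auto simp: coeff_eq_0)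
  moreover have "of_real (2 * Re x) = x + cnj x" for x
    by (simp add: complex_eq_iff)
  ultimately show ?thesis
    by (simp add: sum.distrib distrib_right)
qed

text \<open>Hermite's root counting form: it is evaluated at real polynomials of degree less than \<open>n\<close>
  vanishing at all roots except a chosen one and its conjugate.\<close>

lemma hermite_form_nonneg_imp:
  fixes c :: "nat \<Rightarrow> complex"
  assumes real: "\<And>k. (\<Sum>l<n. c l ^ k) \<in> \<real>"
    and nonneg: "\<And>v. 0 \<le> Re (\<Sum>l<n. (\<Sum>i<n. of_real (v i) * c l ^ i)\<^sup>2 * (1 - (c l)\<^sup>2))"
    and "l < n"
  shows "c l \<in> \<real>" "\<bar>Re (c l)\<bar> \<le> 1"
proof -
  define a where "a = c l"
  define S where "S = c ` {..<n}"
  define N where "N b = card {l. l < n \<and> c l = b}" for b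
  define g where "g = (\<Prod>b\<in>S - {a}. [:-b, 1:])"
  have "finite S" by (simp add: S_def)
  have "a \<in> S" using \<open>l < n\<close> by (simp add: S_def a_def)
  have S: "x \<in> S \<longleftrightarrow> N x > 0" for x
    by (auto simp: S_def N_def card_gt_0_iff)
  have S_cnj: "cnj x \<in> S" if "x \<in> S" for x
    using that multiplicity_cnj[OF real, of x] unfolding S by (simp add: N_def)
  have g: "poly g x = (\<Prod>b\<in>S - {a}. x - b)" for x
    by (simp add: g_def poly_prod)
  have ga: "poly g a \<noteq> 0" unfolding g using \<open>finite S\<close> by simp
  have g0: "poly g x = 0" if "x \<in> S" "x \<noteq> a" for x
    unfolding g using that \<open>finite S\<close> by (intro prod_zero) auto
  \<comment> \<open>\<open>g\<close> has one factor for each distinct value other than a, so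
    multiplicities cost no degree and the form in n variables suffices.\<close>
  have "degree g \<le> card (S - {a})"
    unfolding g_def by (rule order.trans[OF degree_prod_sum_le]) (use \<open>finite S\<close> in auto)
  also have "\<dots> < card S" using \<open>finite S\<close> \<open>a \<in> S\<close> by (rule card_Diff1_less)
  also have "\<dots> \<le> n" unfolding S_def using card_image_le[of "{..<n}" c] by simp
  finally have deg: "degree g < n" .
  \<comment> \<open>The summand of the form for b g symmetrised with its conjugate; the free complex
    factor b steers the value at a.\<close>
  define f where "f b x = (b * poly g x + cnj (b * poly g (cnj x)))\<^sup>2 * (1 - x\<^sup>2)" for b x
  have f: "0 \<le> Re (\<Sum>l<n. f b (c l))" for b
  proof -
    have "degree (smult b g) < n" using deg degree_smult_le[of b g] by linarith
    from sum_power_eq_poly_plus_cnj[OF this] show ?thesis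
      using nonneg[of "\<lambda>i. 2 * Re (coeff (smult b g) i)"] by (simp add: f_def)
  qed
  have f0: "f b x = 0" if "x \<in> S" "x \<noteq> a" "x \<noteq> cnj a" for b x
    
  proof -
    have "cnj x \<noteq> a" using that(3) by auto
    then show ?thesis using g0[of x] g0[of "cnj x"] S_cnj that by (simp add: f_def)
  qed
  have sum_f: "(\<Sum>l<n. f b (c l)) = (\<Sum>x\<in>{a, cnj a}. of_nat (N x) * f b x)" for b
  proof -
    have "(\<Sum>l<n. f b (c l)) = (\<Sum>l<n. (\<lambda>x. if x \<in> {a, cnj a} then f b x else 0) (c l))"
      by (intro sum.cong refl) (use f0 in \<open>auto simp: S_def\<close>)
    also have "\<dots> = (\<Sum>x\<in>{a, cnj a}. of_nat (N x) * (if x \<in> {a, cnj a} then f b x else 0))"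
      unfolding N_def by (rule sum_eq_sum_multiplicities) auto
    finally show ?thesis by simp
  qed
  have Na: "N (cnj a) = N a" "N a > 0"
    using multiplicity_cnj[OF real] \<open>a \<in> S\<close> S by (auto simp: N_def)
  show real_a: "c l \<in> \<real>"
  proof (rule ccontr)
    assume "c l \<notin> \<real>"
    then have ne: "cnj a \<noteq> a" by (simp add: a_def Reals_cnj_iff)
    then have "a\<^sup>2 \<noteq> 1" by (auto simp: power2_eq_1_iff)
    \<comment> \<open>Chosen so that (b g(a))^2 (1 - a^2) = -1, possible since a^2 \<noteq> 1 for
      non-real a. As g vanishes at the conjugate of a, the symmetrised polynomial equals b g at a,
      and the form takes the negative value -2 N(a).\<close>
    define u where "u = csqrt (- 1 / (1 - a\<^sup>2))"
    define b where "b = u / poly g a"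
    have ba: "b * poly g a = u" using ga by (simp add: b_def)
    have g_cnj: "poly g (cnj a) = 0" using g0 S_cnj \<open>a \<in> S\<close> ne by blast
    have u2: "u\<^sup>2 * (1 - a\<^sup>2) = - 1"
      using \<open>a\<^sup>2 \<noteq> 1\<close> by (simp add: u_def)
    have "f b a = -1" unfolding f_def by (simp add: ba g_cnj u2)
    moreover have "f b (cnj a) = cnj (u\<^sup>2 * (1 - a\<^sup>2))" unfolding f_def by (simp add: ba g_cnj)
    ultimately have "(\<Sum>l<n. f b (c l)) = - 2 * of_nat (N a)"
      unfolding sum_f u2 using ne Na by simp
    then show False using f[of b] Na by simp
  qed
  show "\<bar>Re (c l)\<bar> \<le> 1"
  proof -
    have cnj_a: "cnj a = a" using real_a by (simp add: a_def Reals_cnj_iff)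
    \<comment> \<open>For real a the symmetrisation doubles the real value 1/2, so the test
      polynomial is 1 at a and only the weight 1 - a^2 remains.\<close>
    define b where "b = 1 / (2 * poly g a)"
    have ba: "b * poly g a = 1 / 2" using ga by (simp add: b_def)
    have "f b a = 1 - a\<^sup>2"
      unfolding f_def cnj_a ba by simp
    then have "(\<Sum>l<n. f b (c l)) = of_nat (N a) * (1 - a\<^sup>2)"
      unfolding sum_f by (simp add: cnj_a)
    then have "0 \<le> N a * Re (1 - a\<^sup>2)" using f[of b] by simp
    then have "0 \<le> Re (1 - a\<^sup>2)" using Na by (simp add: zero_le_mult_iff)
    moreover have "Im a = 0" using real_a by (simp add: a_def complex_is_Real_iff)
    ultimately have "(Re a)\<^sup>2 \<le> 1" by (simp add: Re_power2)
    then show ?thesis by (simp add: a_def abs_square_le_1)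
  qed
qed

text \<open>y solves y^2 - 2 c y + 1 = 0 with real c and nonpositive discriminant, so y = c
  \<plusminus> \<i> sqrt(1 - c^2).\<close>

lemma norm_eq_1_of_joukowski:
  assumes "y \<noteq> 0" "(y + inverse y) / 2 \<in> \<real>" "\<bar>Re ((y + inverse y) / 2)\<bar> \<le> 1"
  shows "cmod y = 1"
proof -
  define c where "c = Re ((y + inverse y) / 2)"
  have c: "(y + inverse y) / 2 = of_real c" "c\<^sup>2 \<le> 1"
    unfolding c_def of_real_Re[OF assms(2)] abs_square_le_1 using assms(3) by auto
  from c(1) have "y + inverse y = of_real (2 * c)" by simp
  then have "y * y + 1 = of_real (2 * c) * y"
    using assms(1) by (simp add: field_simps)
  then have *: "(y - of_real c)\<^sup>2 = - of_real (1 - c\<^sup>2)"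
    by (simp add: power2_eq_square algebra_simps)
  have "of_real (1 - c\<^sup>2) = (complex_of_real (sqrt (1 - c\<^sup>2)))\<^sup>2"
    using c by (simp flip: of_real_power)
  then have "(y - of_real c)\<^sup>2 = (\<i> * of_real (sqrt (1 - c\<^sup>2)))\<^sup>2"
    unfolding * by (simp add: power_mult_distrib)
  then have "y = Complex c (sqrt (1 - c\<^sup>2)) \<or> y = Complex c (- sqrt (1 - c\<^sup>2))"
    unfolding power2_eq_iff by (auto simp: complex_eq_iff)
  then show ?thesis using c by (auto simp: cmod_def)
qed

subsection \<open>The orbit space in terms of the Chebyshev data\<close>

lemma laurent_fun_orbit_poly:
  "laurent_fun (\<lambda>t. orbit_poly R n \<alpha> (vec (root_rank R n) (\<lambda>i. if i = k then t else x $ i)))"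
  unfolding orbit_poly_def monomial_powi_def
proof (intro laurent_fun_mult laurent_fun_const laurent_fun_sum laurent_fun_prod)
  fix B i assume "B \<in> int_rep R n" "i \<in> {..<dim_vec (B *\<^sub>v \<alpha>)}"
  then have "i < root_rank R n" by (auto simp: int_rep_def)
  then show "laurent_fun (\<lambda>t. vec (root_rank R n) (\<lambda>i. if i = k then t else x $ i) $ i powi (B *\<^sub>v \<alpha>) $ i)"
    by (cases "i = k") (simp_all add: laurent_fun_const laurent_fun_powi)
qed

lemma laurent_fun_real_fund_orbit_poly:
  "laurent_fun (\<lambda>t. real_fund_orbit_poly R n j (vec (root_rank R n) (\<lambda>i. if i = k then t else x $ i)))"
  unfolding real_fund_orbit_poly_def Let_def fund_orbit_poly_def
  by (intro laurent_fun_If laurent_fun_divide_const laurent_fun_add laurent_fun_diff laurent_fun_orbit_poly)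

definition real_cheb_value :: "root_type \<Rightarrow> nat \<Rightarrow> nat \<Rightarrow> complex vec \<Rightarrow> complex" where
  "real_cheb_value R n k x = (let \<alpha> = int k \<cdot>\<^sub>v unit_vec (root_rank R n) 0 in
     (orbit_poly R n \<alpha> x + orbit_poly R n (- \<alpha>) x) / 2)"

lemma laurent_fun_real_cheb_value:
  "laurent_fun (\<lambda>t. real_cheb_value R n m (vec (root_rank R n) (\<lambda>i. if i = k then t else x $ i)))"
  unfolding real_cheb_value_def Let_def
  by (intro laurent_fun_divide_const laurent_fun_add laurent_fun_orbit_poly)

text \<open>What the argument uses about a root system, to be verified type by type.
  \<open>lift\<close> covers all real points because \<open>H\<close> is tested at all of them, and
  \<open>cheb_poly_exists\<close> is the existence half for the description operator in
  \<open>real_cheb\<close>.\<close>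

locale chebyshev_orbit =
  fixes R :: root_type and n r :: nat
  defines "r \<equiv> root_rank R n"
  assumes n_pos: "0 < n"
    and real_on_torus: "\<And>x i. x \<in> torus r \<Longrightarrow> i < r \<Longrightarrow> real_fund_orbit_poly R n i x \<in> \<real>"
    and lift: "\<And>z. z \<in> carrier_vec r \<Longrightarrow> \<exists>x \<in> carrier_vec r. (\<forall>i<r. x $ i \<noteq> 0) \<and>
      (\<forall>i<r. real_fund_orbit_poly R n i x = of_real (z $ i))"
    and cheb_value: "\<And>x. x \<in> carrier_vec r \<Longrightarrow> (\<And>i. i < r \<Longrightarrow> x $ i \<noteq> 0) \<Longrightarrow>
      \<exists>y. (\<forall>l<n. y l \<noteq> 0) \<and>
        (\<forall>k. real_cheb_value R n k x = (\<Sum>l<n. cheb k ((y l + inverse (y l)) / 2)) / of_nat n) \<and>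
        (x \<in> torus r \<longleftrightarrow> (\<forall>l<n. cmod (y l) = 1))"
    and cheb_poly_exists: "\<And>k. \<exists>p \<in> mpoly_ring r. \<forall>x \<in> torus r.
      of_real (mpoly_eval p (real_orbit_map R n x)) = real_cheb_value R n k x"
begin

lemma torus_nonzero: "x \<in> torus r \<Longrightarrow> x \<in> carrier_vec r \<and> (\<forall>i<r. x $ i \<noteq> 0)"
  unfolding torus_def by force

lemma real_orbit_map_torus:
  "x \<in> torus r \<Longrightarrow> i < r \<Longrightarrow> real_fund_orbit_poly R n i x = of_real (real_orbit_map R n x $ i)"
  using real_on_torus[of x i] by (simp add: real_orbit_map_def r_def)

lemma mpoly_eval_real_orbit_map:
  assumes "p \<in> mpoly_ring r" "x \<in> torus r"
  shows "mpoly_ceval p (\<lambda>i. real_fund_orbit_poly R n i x) = of_real (mpoly_eval p (real_orbit_map R n x))"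
  by (rule mpoly_ceval_of_real[OF assms(1)]) (rule real_orbit_map_torus[OF assms(2)])

lemma laurent_fun_ceval:
  "laurent_fun (\<lambda>t. mpoly_ceval p (\<lambda>j. real_fund_orbit_poly R n j (vec r (\<lambda>i. if i = k then t else x $ i))))"
  unfolding r_def by (intro laurent_fun_mpoly_ceval laurent_fun_real_fund_orbit_poly)

text \<open>The uniqueness half for \<open>real_cheb\<close>: a difference vanishing on the torus
  vanishes at all points with nonzero coordinates by density, hence at every real point by
  \<open>lift\<close>, hence identically.\<close>

lemma mpoly_eq_if_eq_on_orbit_space:
  assumes p: "p \<in> mpoly_ring r" "q \<in> mpoly_ring r"
    and eq: "\<And>x. x \<in> torus r \<Longrightarrow> mpoly_eval p (real_orbit_map R n x) = mpoly_eval q (real_orbit_map R n x)"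
  shows "p = q"
proof -
  define d where "d = p + mpoly_const (-1) * q"
  have d: "d \<in> mpoly_ring r"
    unfolding d_def by (intro mpoly_ring_add mpoly_ring_mult mpoly_ring_const p)
  have eval_d: "mpoly_eval d z = mpoly_eval p z - mpoly_eval q z" for z
    by (simp add: d_def mpoly_eval_add mpoly_eval_mult)
  have "mpoly_eval d z = 0" if z: "z \<in> carrier_vec r" for z
  proof -
    obtain x where x: "x \<in> carrier_vec r" "\<forall>i<r. x $ i \<noteq> 0"
      "\<forall>i<r. real_fund_orbit_poly R n i x = of_real (z $ i)"
      using lift[OF z] by blast
    have "mpoly_ceval d (\<lambda>i. real_fund_orbit_poly R n i x) = 0"
    proof (rule torus_zariski_dense[where r = r and F = "\<lambda>x. mpoly_ceval d (\<lambda>i. real_fund_orbit_poly R n i x)"])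
      fix x assume "x \<in> torus r"
      then show "mpoly_ceval d (\<lambda>i. real_fund_orbit_poly R n i x) = 0"
        using eq by (simp add: mpoly_eval_real_orbit_map[OF d] eval_d)
    qed (use x laurent_fun_ceval in auto)
    then show ?thesis
      using mpoly_ceval_of_real[OF d, of "\<lambda>i. real_fund_orbit_poly R n i x" z] x(3) by simp
  qed
  then have "d = 0" using mpoly_eq_0[OF d] by blast
  then have "mpoly_eval p z = mpoly_eval q z" for z using eval_d[of z] by simp
  have "p = q + d" unfolding d_def mpoly_const_def
    by (metis (no_types, lifting) add.commute add.left_inverse add.right_neutral add.assoc mult_minus1 single_uminus single_one)
  then show ?thesis using \<open>d = 0\<close> by simp
qed

lemma real_cheb:
  "real_cheb R n k \<in> mpoly_ring r"
  "x \<in> torus r \<Longrightarrow> of_real (mpoly_eval (real_cheb R n k) (real_orbit_map R n x)) = real_cheb_value R n k x"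
proof -
  let ?P = "\<lambda>p. p \<in> mpoly_ring r \<and> (\<forall>x \<in> torus r. complex_of_real (mpoly_eval p (real_orbit_map R n x)) = real_cheb_value R n k x)"
  have "\<exists>!p. ?P p"
  proof (rule ex_ex1I)
    show "\<exists>p. ?P p" using cheb_poly_exists[of k] by blast
    fix p q assume pq: "?P p" "?P q"
    show "p = q"
    proof (rule mpoly_eq_if_eq_on_orbit_space)
      fix x assume "x \<in> torus r"
      then have "complex_of_real (mpoly_eval p (real_orbit_map R n x)) = of_real (mpoly_eval q (real_orbit_map R n x))"
        using pq by metis
      then show "mpoly_eval p (real_orbit_map R n x) = mpoly_eval q (real_orbit_map R n x)"
        unfolding of_real_eq_iff .
    qed (use pq in auto)
  qed
  moreover have "real_cheb R n k = (THE p. ?P p)"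
    unfolding real_cheb_def real_cheb_value_def Let_def r_def ..
  ultimately have "?P (real_cheb R n k)" using theI'[of ?P] by simp
  then show "real_cheb R n k \<in> mpoly_ring r"
    "x \<in> torus r \<Longrightarrow> of_real (mpoly_eval (real_cheb R n k) (real_orbit_map R n x)) = real_cheb_value R n k x"
    by auto
qed

text \<open>The defining identity is known on the torus only. Both sides are Laurent in every
  coordinate, so it persists at the preimages of points outside the orbit space.\<close>

lemma real_cheb_lift:
  assumes x: "x \<in> carrier_vec r" "\<And>i. i < r \<Longrightarrow> x $ i \<noteq> 0"
    and z: "\<And>i. i < r \<Longrightarrow> real_fund_orbit_poly R n i x = of_real (z $ i)"
  shows "of_real (mpoly_eval (real_cheb R n k) z) = real_cheb_value R n k x"
proof -
  have "mpoly_ceval (real_cheb R n k) (\<lambda>i. real_fund_orbit_poly R n i x) - real_cheb_value R n k x = 0"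
  proof (rule torus_zariski_dense[where r = r and F = "\<lambda>x. mpoly_ceval (real_cheb R n k)
      (\<lambda>i. real_fund_orbit_poly R n i x) - real_cheb_value R n k x"])
    fix x assume "x \<in> torus r"
    then show "mpoly_ceval (real_cheb R n k) (\<lambda>i. real_fund_orbit_poly R n i x) - real_cheb_value R n k x = 0"
      by (simp add: mpoly_eval_real_orbit_map[OF real_cheb(1)] real_cheb(2))
  next
    fix x k'
    show "laurent_fun (\<lambda>t. mpoly_ceval (real_cheb R n k) (\<lambda>j. real_fund_orbit_poly R n j (vec r (\<lambda>i. if i = k' then t else x $ i)))
      - real_cheb_value R n k (vec r (\<lambda>i. if i = k' then t else x $ i)))"
      by (rule laurent_fun_diff[OF laurent_fun_ceval]) (unfold r_def, rule laurent_fun_real_cheb_value)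
  qed (use x in auto)
  then show ?thesis
    using mpoly_ceval_of_real[OF real_cheb(1), of "\<lambda>i. real_fund_orbit_poly R n i x" z] z by simp
qed

lemma hankel_entry_lift:
  fixes z :: "real vec"
  assumes T: "\<And>k. of_real (mpoly_eval (real_cheb R n k) z) = (\<Sum>l<n. cheb k ((y l + inverse (y l)) / 2)) / of_nat n"
    and y: "\<And>l. l < n \<Longrightarrow> y l \<noteq> 0" and m: "m \<ge> 2"
  defines "c \<equiv> \<lambda>l. (y l + inverse (y l)) / 2"
  shows "of_real (mpoly_eval (hankel_entry R n m) z) = (\<Sum>l<n. c l ^ (m - 2) * (1 - (c l)\<^sup>2)) / (2 * of_nat n)"
proof -
  let ?a = "\<lambda>l. 4 * of_nat ((m - 2) choose (l - 1)) - of_nat (m choose l) :: complex"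
  let ?h = "(if even m then 4 * of_nat ((m - 2) choose (m div 2 - 1)) - of_nat (m choose (m div 2)) else 0) :: complex"
  let ?L = "{1..nat \<lceil>real m / 2\<rceil> - 1}"
  have T': "of_real (mpoly_eval (real_cheb R n k) z) = (\<Sum>l<n. cheb k (c l)) / of_nat n" for k
    using T by (simp add: c_def)
  have "complex_of_real (mpoly_eval (hankel_entry R n m) z) =
      1 / 2 ^ m * (- of_real (mpoly_eval (real_cheb R n m) z)
        + (\<Sum>i\<in>?L. ?a i * of_real (mpoly_eval (real_cheb R n (m - 2 * i)) z)) + 1 / 2 * ?h)"
    unfolding hankel_entry_def
    by (simp add: mpoly_eval_mult mpoly_eval_add mpoly_eval_sum mpoly_eval_uminus mpoly_eval_diff of_rat_divide
        of_rat_mult of_rat_diff of_rat_power)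
  also have "\<dots> = 1 / 2 ^ m * ((\<Sum>l<n. - cheb m (c l) + (\<Sum>i\<in>?L. ?a i * cheb (m - 2 * i) (c l)) + 1 / 2 * ?h) / of_nat n)"
  proof -
    have "(\<Sum>i\<in>?L. ?a i * (\<Sum>l<n. cheb (m - 2 * i) (c l))) = (\<Sum>l<n. \<Sum>i\<in>?L. ?a i * cheb (m - 2 * i) (c l))"
      unfolding sum_distrib_left by (rule sum.swap)
    \<comment> \<open>The constant term is spread over the n summands so that
      \<open>hankel_cheb_identity\<close> applies to each c_l.\<close>
    moreover have "1 / 2 * ?h = (\<Sum>l<n. 1 / 2 * ?h) / of_nat n"
      using n_pos by simp
    moreover have "(\<Sum>i\<in>?L. ?a i * ((\<Sum>l<n. cheb (m - 2 * i) (c l)) / of_nat n)) =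
        (\<Sum>i\<in>?L. ?a i * (\<Sum>l<n. cheb (m - 2 * i) (c l))) / of_nat n"
      unfolding times_divide_eq_right by (rule sum_divide_distrib[symmetric])
    ultimately show ?thesis
      unfolding T' sum.distrib add_divide_distrib sum_negf by (simp only: minus_divide_left)
  qed
  also have "(\<Sum>l<n. - cheb m (c l) + (\<Sum>i\<in>?L. ?a i * cheb (m - 2 * i) (c l)) + 1 / 2 * ?h) =
      (\<Sum>l<n. 2 ^ m * (c l ^ (m - 2) * (1 - (c l)\<^sup>2) / 2))"
    unfolding c_def by (intro sum.cong refl hankel_cheb_identity y m) auto
  also have "1 / 2 ^ m * (\<dots> / of_nat n) = (\<Sum>l<n. c l ^ (m - 2) * (1 - (c l)\<^sup>2)) / (2 * of_nat n)"
    by (simp flip: sum_distrib_left sum_divide_distrib)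
  finally show ?thesis .
qed

abbreviation hankel_at :: "real vec \<Rightarrow> real mat" where
  "hankel_at z \<equiv> map_mat (\<lambda>p. mpoly_eval p z) (hankel_mat R n)"

text \<open>Each entry is a moment of degree i + j, with zero-based indices, for the weight 1 - c^2;
  hence the form is a weighted sum of squares of the polynomial with coefficient vector
  \<open>v\<close>. The squares may be non-real, since the c_l are arbitrary complex numbers
  here.\<close>

lemma hankel_form_lift:
  fixes z :: "real vec" and v :: "real vec"
  assumes T: "\<And>k. of_real (mpoly_eval (real_cheb R n k) z) = (\<Sum>l<n. cheb k ((y l + inverse (y l)) / 2)) / of_nat n"
    and y: "\<And>l. l < n \<Longrightarrow> y l \<noteq> 0" and v: "v \<in> carrier_vec n"
  defines "c \<equiv> \<lambda>l. (y l + inverse (y l)) / 2"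
  shows "of_real (v \<bullet> (hankel_at z *\<^sub>v v)) =
    (\<Sum>l<n. (\<Sum>i<n. of_real (v $ i) * c l ^ i)\<^sup>2 * (1 - (c l)\<^sup>2)) / (2 * of_nat n)"
proof -
  have H: "of_real (mpoly_eval (hankel_entry R n m) z) = (\<Sum>l<n. c l ^ (m - 2) * (1 - (c l)\<^sup>2)) / (2 * of_nat n)"
    if "m \<ge> 2" for m
    unfolding c_def by (rule hankel_entry_lift[OF T y that])
  have "of_real (v \<bullet> (hankel_at z *\<^sub>v v)) =
      (\<Sum>i<n. \<Sum>j<n. of_real (v $ i) * (of_real (mpoly_eval (hankel_entry R n (i + j + 2)) z) * complex_of_real (v $ j)))"
    using v by (simp add: scalar_prod_def hankel_mat_def atLeast0LessThan sum_distrib_left)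
  also have "\<dots> = (\<Sum>i<n. \<Sum>j<n. (\<Sum>l<n. of_real (v $ i) * c l ^ i * (of_real (v $ j) * c l ^ j) * (1 - (c l)\<^sup>2)) / (2 * of_nat n))"
    by (intro sum.cong refl, subst H)
      (simp_all add: power_add sum_distrib_left sum_distrib_right sum_divide_distrib mult_ac)
  also have "\<dots> = (\<Sum>i<n. \<Sum>j<n. \<Sum>l<n. of_real (v $ i) * c l ^ i * (of_real (v $ j) * c l ^ j) * (1 - (c l)\<^sup>2)) / (2 * of_nat n)"
    by (simp only: sum_divide_distrib[symmetric])
  also have "(\<Sum>i<n. \<Sum>j<n. \<Sum>l<n. of_real (v $ i) * c l ^ i * (of_real (v $ j) * c l ^ j) * (1 - (c l)\<^sup>2)) =
      (\<Sum>i<n. \<Sum>l<n. \<Sum>j<n. of_real (v $ i) * c l ^ i * (of_real (v $ j) * c l ^ j) * (1 - (c l)\<^sup>2))"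
    by (intro sum.cong refl sum.swap)
  also have "\<dots> = (\<Sum>l<n. \<Sum>i<n. \<Sum>j<n. of_real (v $ i) * c l ^ i * (of_real (v $ j) * c l ^ j) * (1 - (c l)\<^sup>2))"
    by (rule sum.swap)
  also have "\<dots> = (\<Sum>l<n. (\<Sum>i<n. of_real (v $ i) * c l ^ i)\<^sup>2 * (1 - (c l)\<^sup>2))"
    by (intro sum.cong refl) (simp only: power2_eq_square[of "sum _ _"] sum_product, simp only: sum_distrib_right)
  finally show ?thesis .
qed

lemma hankel_mat_square: "square_mat (hankel_at z)"
  "transpose_mat (hankel_at z) = hankel_at z"
  by (auto simp: hankel_mat_def add.commute)

theorem real_orbit_space_eq:
  "real_orbit_space R n = {z \<in> carrier_vec r. pos_semidef (hankel_at z)}"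
proof (intro equalityI subsetI)
  fix z assume "z \<in> real_orbit_space R n"
  then obtain x where x: "x \<in> torus r" and z: "z = real_orbit_map R n x"
    by (auto simp: real_orbit_space_def r_def)
  obtain y where y: "\<And>l. l < n \<Longrightarrow> cmod (y l) = 1"
    "\<And>k. real_cheb_value R n k x = (\<Sum>l<n. cheb k ((y l + inverse (y l)) / 2)) / of_nat n"
    using cheb_value[of x] torus_nonzero[OF x] x by blast
  have y0: "y l \<noteq> 0" if "l < n" for l using y(1)[OF that] by auto
  define c where "c = (\<lambda>l. Re (y l))"
  have c: "(y l + inverse (y l)) / 2 = of_real (c l)" if "l < n" for l
    using y(1)[OF that] by (simp add: complex_eq_iff c_def cmod_def)
  have c1: "(c l)\<^sup>2 \<le> 1" if "l < n" for l
    using abs_Re_le_cmod[of "y l"] y(1)[OF that] by (simp add: c_def abs_square_le_1)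
  have T: "of_real (mpoly_eval (real_cheb R n k) z) = (\<Sum>l<n. cheb k ((y l + inverse (y l)) / 2)) / of_nat n" for k
    using real_cheb(2)[OF x] y(2) z by simp
  have "0 \<le> v \<bullet> (hankel_at z *\<^sub>v v)" if v: "v \<in> carrier_vec n" for v
  proof -
    have "complex_of_real (v \<bullet> (hankel_at z *\<^sub>v v)) =
        (\<Sum>l<n. (\<Sum>i<n. of_real (v $ i) * ((y l + inverse (y l)) / 2) ^ i)\<^sup>2 *
          (1 - ((y l + inverse (y l)) / 2)\<^sup>2)) / (2 * of_nat n)"
      by (rule hankel_form_lift[OF T y0 v])
    also have "\<dots> = of_real ((\<Sum>l<n. (\<Sum>i<n. v $ i * c l ^ i)\<^sup>2 * (1 - (c l)\<^sup>2)) / (2 * of_nat n))"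
      unfolding of_real_divide of_real_sum
      by (intro arg_cong2[where f = "(/)"] sum.cong) (simp_all add: c)
    finally have "v \<bullet> (hankel_at z *\<^sub>v v) =
        (\<Sum>l<n. (\<Sum>i<n. v $ i * c l ^ i)\<^sup>2 * (1 - (c l)\<^sup>2)) / (2 * of_nat n)"
      unfolding of_real_eq_iff .
    also have "\<dots> \<ge> 0"
      by (intro divide_nonneg_nonneg sum_nonneg mult_nonneg_nonneg) (use c1 in auto)
    finally show ?thesis .
  qed
  then show "z \<in> {z \<in> carrier_vec r. pos_semidef (hankel_at z)}"
    using hankel_mat_square by (auto simp: pos_semidef_def z real_orbit_map_def r_def hankel_mat_def)
next
  fix z assume "z \<in> {z \<in> carrier_vec r. pos_semidef (hankel_at z)}"
  then have z: "z \<in> carrier_vec r"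
    and psd: "\<And>v. v \<in> carrier_vec n \<Longrightarrow> 0 \<le> v \<bullet> (hankel_at z *\<^sub>v v)"
    by (auto simp: pos_semidef_def hankel_mat_def)
  obtain x where x: "x \<in> carrier_vec r" "\<And>i. i < r \<Longrightarrow> x $ i \<noteq> 0"
    "\<And>i. i < r \<Longrightarrow> real_fund_orbit_poly R n i x = of_real (z $ i)"
    using lift[OF z] by blast
  obtain y where y: "\<And>l. l < n \<Longrightarrow> y l \<noteq> 0"
    "\<And>k. real_cheb_value R n k x = (\<Sum>l<n. cheb k ((y l + inverse (y l)) / 2)) / of_nat n"
    "x \<in> torus r \<longleftrightarrow> (\<forall>l<n. cmod (y l) = 1)"
    using cheb_value[OF x(1,2)] by blast
  define c where "c = (\<lambda>l. (y l + inverse (y l)) / 2)"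
  have T: "of_real (mpoly_eval (real_cheb R n k) z) = (\<Sum>l<n. cheb k ((y l + inverse (y l)) / 2)) / of_nat n" for k
    using real_cheb_lift[OF x] y(2) by simp
  have "(\<Sum>l<n. c l ^ k) \<in> \<real>" for k
  proof (rule power_sum_real_of_cheb)
    fix k
    have "(\<Sum>l<n. cheb k (c l)) = of_real (of_nat n * mpoly_eval (real_cheb R n k) z)"
      using T[of k] n_pos by (simp add: c_def)
    then show "(\<Sum>l<n. cheb k (c l)) \<in> \<real>" by simp
  qed
  moreover have "0 \<le> Re (\<Sum>l<n. (\<Sum>i<n. of_real (v i) * c l ^ i)\<^sup>2 * (1 - (c l)\<^sup>2))" for v
  proof -
    have "complex_of_real (vec n v \<bullet> (hankel_at z *\<^sub>v vec n v)) =
        (\<Sum>l<n. (\<Sum>i<n. of_real (v i) * c l ^ i)\<^sup>2 * (1 - (c l)\<^sup>2)) / (2 * of_nat n)"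
      using hankel_form_lift[OF T y(1), of "vec n v"] by (simp add: c_def)
    then have "(\<Sum>l<n. (\<Sum>i<n. of_real (v i) * c l ^ i)\<^sup>2 * (1 - (c l)\<^sup>2)) =
        of_real (2 * of_nat n * (vec n v \<bullet> (hankel_at z *\<^sub>v vec n v)))"
      using n_pos by simp
    then show ?thesis using psd[of "vec n v"] by simp
  qed
  ultimately have "c l \<in> \<real>" "\<bar>Re (c l)\<bar> \<le> 1" if "l < n" for l
    using hermite_form_nonneg_imp[of c n l] that by blast+
  then have "\<forall>l<n. cmod (y l) = 1"
    using norm_eq_1_of_joukowski y(1) by (simp add: c_def)
  then have xt: "x \<in> torus r" using y(3) by simp
  have "z = real_orbit_map R n x"
    using z x(3) by (intro eq_vecI) (auto simp: real_orbit_map_def r_def)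
  then show "z \<in> real_orbit_space R n"
    using xt by (auto simp: real_orbit_space_def r_def)
qed

end

subsection \<open>The Weyl groups and their integer representations\<close>

text \<open>A sign vector is encoded by the positions of its minus signs. This representation is
  unique, whereas sign functions are unconstrained from \<open>n\<close> on; so group sums become
  sums over a finite product set.\<close>

fun sign_sets :: "root_type \<Rightarrow> nat \<Rightarrow> nat set set" where
  "sign_sets A_type n = {{}}"
| "sign_sets B_type n = Pow {..<n}"
| "sign_sets C_type n = Pow {..<n}"
| "sign_sets D_type n = {S. S \<subseteq> {..<n} \<and> even (card S)}"
| "sign_sets G2_type n = {{}, {..<n}}"

definition set_sign :: "nat set \<Rightarrow> nat \<Rightarrow> real" where
  "set_sign S j = (if j \<in> S then - 1 else 1)"

definition weyl_params :: "root_type \<Rightarrow> nat \<Rightarrow> ((nat \<Rightarrow> nat) \<times> nat set) set" where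
  "weyl_params R n = {p. p permutes {..<n}} \<times> sign_sets R n"

lemma sign_sets_subset: "S \<in> sign_sets R n \<Longrightarrow> S \<subseteq> {..<n}"
  by (cases R) auto

lemma finite_sign_sets: "finite (sign_sets R n)"
  by (rule finite_subset[of _ "Pow {..<n}"]) (use sign_sets_subset in auto)

lemma sign_sets_nonempty: "sign_sets R n \<noteq> {}"
proof -
  have "{} \<in> sign_sets R n" by (cases R) auto
  then show ?thesis by blast
qed

lemma signed_perm_mat_cong:
  assumes "\<And>j. j < n \<Longrightarrow> s j = s' j"
  shows "signed_perm_mat n p s = signed_perm_mat n p s'"
  unfolding signed_perm_mat_def by (intro eq_matI) (use assms in auto)

lemma signed_perm_mat_set_sign:
  assumes "\<forall>j<n. s j \<in> {1, - 1}"
  shows "signed_perm_mat n p s = signed_perm_mat n p (set_sign {j. j < n \<and> s j = - 1})"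
  by (rule signed_perm_mat_cong) (use assms in \<open>auto simp: set_sign_def\<close>)

lemma set_sign_range: "set_sign S j \<in> {1, - 1}"
  by (simp add: set_sign_def)

lemma set_sign_inverse: "S \<subseteq> {..<n} \<Longrightarrow> {j. j < n \<and> set_sign S j = - 1} = S"
  by (auto simp: set_sign_def split: if_splits)

lemma weyl_group_eq:
  "weyl_group R n = (\<lambda>(p, S). signed_perm_mat n p (set_sign S)) ` weyl_params R n"
proof -
  have B: "weyl_group B_type n = (\<lambda>(p, S). signed_perm_mat n p (set_sign S)) ` weyl_params B_type n"
  proof (intro equalityI subsetI)
    fix w assume "w \<in> weyl_group B_type n"
    then obtain p s where "w = signed_perm_mat n p s" "p permutes {..<n}" "\<forall>j<n. s j \<in> {1, - 1}"
      by auto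
    then show "w \<in> (\<lambda>(p, S). signed_perm_mat n p (set_sign S)) ` weyl_params B_type n"
      using signed_perm_mat_set_sign[of n s p]
      by (intro image_eqI[of _ _ "(p, {j. j < n \<and> s j = - 1})"]) (auto simp: weyl_params_def)
  qed (use set_sign_range in \<open>fastforce simp: weyl_params_def\<close>)
  show ?thesis
  proof (cases R)
    case A_type
    have "set_sign {} = (\<lambda>_. 1)" by (auto simp: set_sign_def)
    then show ?thesis by (auto simp: A_type weyl_params_def image_iff)
  next
    case G2_type
    have *: "set_sign {} = (\<lambda>_. 1)" by (auto simp: set_sign_def)
    have **: "signed_perm_mat n p (set_sign {..<n}) = signed_perm_mat n p (\<lambda>_. - 1)" for p
      by (rule signed_perm_mat_cong) (auto simp: set_sign_def)
    have "weyl_group R n = {signed_perm_mat n p (\<lambda>_. c) | p c. p permutes {..<n} \<and> c \<in> {1, - 1}}"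
      by (simp add: G2_type)
    also have "\<dots> = (\<lambda>p. signed_perm_mat n p (\<lambda>_. 1)) ` {p. p permutes {..<n}} \<union>
        (\<lambda>p. signed_perm_mat n p (\<lambda>_. - 1)) ` {p. p permutes {..<n}}"
      by auto
    also have "\<dots> = (\<lambda>(p, S). signed_perm_mat n p (set_sign S)) ` weyl_params R n"
      unfolding weyl_params_def G2_type sign_sets.simps *[symmetric] **[symmetric] by force
    finally show ?thesis .
  next
    case B_type
    then show ?thesis using B by simp
  next
    case C_type
    then show ?thesis using B by (simp add: weyl_params_def)
  next
    case D_type
    show ?thesis
    proof (intro equalityI subsetI)
      fix w assume "w \<in> weyl_group R n"
      then obtain p s where "w = signed_perm_mat n p s" "p permutes {..<n}" "\<forall>j<n. s j \<in> {1, - 1}"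
        "even (card {j. j < n \<and> s j = - 1})"
        by (auto simp: D_type)
      then show "w \<in> (\<lambda>(p, S). signed_perm_mat n p (set_sign S)) ` weyl_params R n"
        using signed_perm_mat_set_sign[of n s p]
        by (intro image_eqI[of _ _ "(p, {j. j < n \<and> s j = - 1})"]) (auto simp: weyl_params_def D_type)
    next
      fix w assume "w \<in> (\<lambda>(p, S). signed_perm_mat n p (set_sign S)) ` weyl_params R n"
      then obtain p S where *: "w = signed_perm_mat n p (set_sign S)" "p permutes {..<n}" "S \<subseteq> {..<n}" "even (card S)"
        by (auto simp: weyl_params_def D_type)
      show "w \<in> weyl_group R n"
        using * set_sign_range[of S] set_sign_inverse[OF *(3)] by (simp add: D_type) metis
    qed
  qed
qed

text \<open>The matrix sends \<epsilon>_j to \<plusminus>\<epsilon>_(p j), so coordinate i of the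
  image comes from the index p^-1(i).\<close>

definition weyl_act :: "(nat \<Rightarrow> nat) \<Rightarrow> nat set \<Rightarrow> (nat \<Rightarrow> real) \<Rightarrow> nat \<Rightarrow> real" where
  "weyl_act p S f i = set_sign S (Hilbert_Choice.inv p i) * f (Hilbert_Choice.inv p i)"

lemma signed_perm_mat_row_sum:
  assumes p: "p permutes {..<n}" and i: "i < n"
  shows "(\<Sum>j<n. signed_perm_mat n p (set_sign S) $$ (i, j) * f j) = weyl_act p S f i"
proof -
  have inv: "Hilbert_Choice.inv p i < n" using permutes_in_image[OF permutes_inv[OF p], of i] i by simp
  have "(\<Sum>j<n. signed_perm_mat n p (set_sign S) $$ (i, j) * f j) =
      (\<Sum>j<n. if j = Hilbert_Choice.inv p i then set_sign S j * f j else 0)"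
    using i by (intro sum.cong refl) (auto simp: signed_perm_mat_def permutes_inverses[OF p])
  also have "\<dots> = weyl_act p S f i"
    using inv by (simp add: weyl_act_def)
  finally show ?thesis .
qed

lemma sum_weyl_act:
  fixes v :: "nat \<Rightarrow> complex"
  assumes "p permutes {..<n}"
  shows "(\<Sum>i<n. of_real (weyl_act p S f i) * v i) = (\<Sum>j<n. of_real (set_sign S j * f j) * v (p j))"
proof -
  have "(\<Sum>i<n. of_real (weyl_act p S f i) * v i) = (\<Sum>j<n. of_real (weyl_act p S f (p j)) * v (p j))"
    by (rule sum.permute[OF assms, unfolded o_def])
  then show ?thesis by (simp add: weyl_act_def permutes_inverses[OF assms])
qed

section \<open>Fundamental weights and their dual coordinates\<close>

definition valid_type :: "root_type \<Rightarrow> nat \<Rightarrow> bool" where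
  "valid_type R n \<longleftrightarrow> (R = A_type \<and> n \<ge> 2) \<or> (R = B_type \<and> n \<ge> 2) \<or> (R = C_type \<and> n \<ge> 2)
    \<or> (R = D_type \<and> n \<ge> 4) \<or> (R = G2_type \<and> n = 3)"

definition fund :: "root_type \<Rightarrow> nat \<Rightarrow> nat \<Rightarrow> nat \<Rightarrow> real" where
  "fund R n k j = fund_weight R n (Suc k) $ j"

text \<open>Up to values beyond \<open>n\<close>, the real span of the fundamental weights: a
  hyperplane in types A and G2, everything otherwise.\<close>

definition weight_space :: "root_type \<Rightarrow> nat \<Rightarrow> (nat \<Rightarrow> real) set" where
  "weight_space R n = {f. R \<in> {A_type, G2_type} \<longrightarrow> (\<Sum>j<n. f j) = 0}"

text \<open>A condition that is visibly stable under the group, holds for the fundamental weights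
  and forces integer coordinates, so that integrality of the matrices needs no explicit matrices. In
  types B and D the case i = j makes 2 f(i) integral.\<close>

fun weight_integral :: "root_type \<Rightarrow> nat \<Rightarrow> (nat \<Rightarrow> real) \<Rightarrow> bool" where
  "weight_integral A_type n f \<longleftrightarrow> (\<forall>i<n. \<forall>j<n. f i - f j \<in> \<int>)"
| "weight_integral B_type n f \<longleftrightarrow> (\<forall>i<n. \<forall>j<n. f i - f j \<in> \<int> \<and> f i + f j \<in> \<int>)"
| "weight_integral C_type n f \<longleftrightarrow> (\<forall>i<n. f i \<in> \<int>)"
| "weight_integral D_type n f \<longleftrightarrow> (\<forall>i<n. \<forall>j<n. f i - f j \<in> \<int> \<and> f i + f j \<in> \<int>)"
| "weight_integral G2_type n f \<longleftrightarrow> (\<forall>i<n. f i \<in> \<int>)"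

text \<open>The coordinates in the basis of fundamental weights, that is, the pairings with the
  simple coroots. The last coroot is 2 \<epsilon>_n in type B, where the last simple root is short,
  and \<epsilon>_n in type C.\<close>

fun coord :: "root_type \<Rightarrow> nat \<Rightarrow> nat \<Rightarrow> (nat \<Rightarrow> real) \<Rightarrow> real" where
  "coord A_type n i f = f i - f (Suc i)"
| "coord B_type n i f = (if Suc i = n then 2 * f i else f i - f (Suc i))"
| "coord C_type n i f = (if Suc i = n then f i else f i - f (Suc i))"
| "coord D_type n i f = (if Suc i = n then f (i - 1) + f i else f i - f (Suc i))"
| "coord G2_type n i f = (if i = 0 then f 0 - f 1 else - f 0)"

text \<open>The \<open>i\<close>-th simple coroot; for \<open>G\<^sub>2\<close> up to a multiple of \<open>(1, 1, 1)\<close>.\<close>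

definition coroot :: "root_type \<Rightarrow> nat \<Rightarrow> nat \<Rightarrow> nat \<Rightarrow> real" where
  "coroot R n i j = coord R n i (\<lambda>k. if k = j then 1 else 0)"

lemma coord_eq_sum_coroot:
  assumes "valid_type R n" "i < root_rank R n"
  shows "coord R n i f = (\<Sum>j<n. coroot R n i j * f j)"
proof -
  have 1: "(\<Sum>j<n. (if a = j then 1 else 0) * f j) = f a" if "a < n" for a
    using that by (simp add: if_distrib[of "\<lambda>x. x * _"] cong: if_cong)
  show ?thesis
  proof (cases "R = G2_type")
    case True
    then show ?thesis using assms
      by (auto simp: coroot_def valid_type_def numeral_3_eq_3)
  next
    case False
    then show ?thesis
      unfolding coroot_def using assms
      by (cases R) (auto simp: valid_type_def left_diff_distrib distrib_right sum_subtractf sum.distrib 1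
          sum_distrib_left[symmetric] mult.assoc sum_negf)
  qed
qed

lemma coord_fund:
  assumes "valid_type R n" "i < root_rank R n" "k < root_rank R n"
  shows "coord R n i (fund R n k) = (if i = k then 1 else 0)"
proof (cases R)
  case G2_type
  then show ?thesis using assms
    by (auto simp: valid_type_def fund_def vec_of_list_index less_Suc_eq numeral_3_eq_3 nth_Cons')
next
  case D_type
  then show ?thesis using assms
    by (auto simp: valid_type_def fund_def)
next
  case A_type
  then show ?thesis using assms
    by (auto simp: valid_type_def fund_def)
next
  case B_type
  then show ?thesis using assms
    by (auto simp: valid_type_def fund_def)
next
  case C_type
  then show ?thesis using assms
    by (auto simp: valid_type_def fund_def)
qed

lemma sum_telescope_from:
  fixes f :: "nat \<Rightarrow> real"
  shows "(\<Sum>i<m. (f i - f (Suc i)) * (if j < Suc i then 1 else 0)) = f (min j m) - f m"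
  by (induction m) (auto simp: min_def le_Suc_eq not_le)

lemma sum_telescope_weighted:
  fixes f :: "nat \<Rightarrow> real"
  shows "(\<Sum>i<m. (f i - f (Suc i)) * real (Suc i)) = (\<Sum>i<m. f i) - real m * f m"
  by (induction m) (auto simp: algebra_simps)

text \<open>Abel summation over the differences f(i) - f(i+1). In type A the telescoping leaves f(j)
  minus the last value, and the corrections i / n restore that value because the coordinates sum to
  0.\<close>

lemma sum_coord_fund:
  assumes "valid_type R n" "f \<in> weight_space R n" "j < n"
  shows "(\<Sum>i<root_rank R n. coord R n i f * fund R n i j) = f j"
proof (cases R)
  case A_type
  obtain m where m: "n = Suc m" "m > 0" using assms(1) by (cases n) (auto simp: A_type valid_type_def)
  have "(\<Sum>i<m. f i) + f m = 0" using assms(2) by (simp add: weight_space_def A_type m)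
  then have s: "(\<Sum>i<m. (f i - f (Suc i)) * real (Suc i)) = - real n * f m"
    unfolding sum_telescope_weighted by (simp add: m algebra_simps)
  have s': "(\<Sum>i<m. (f i - f (Suc i)) * real (Suc i)) / real n = - f m"
    unfolding s using m by (simp add: divide_eq_eq algebra_simps)
  have "(\<Sum>i<m. (f i - f (Suc i)) * ((if j < Suc i then 1 else 0) - real (Suc i) / real n)) =
      (\<Sum>i<m. (f i - f (Suc i)) * (if j < Suc i then 1 else 0)) - (\<Sum>i<m. (f i - f (Suc i)) * real (Suc i)) / real n"
    unfolding right_diff_distrib sum_subtractf sum_divide_distrib by simp
  also have "\<dots> = f j"
    unfolding s' sum_telescope_from using assms(3) m by (simp add: min_absorb1)
  finally show ?thesis
    using assms(3) m by (simp add: A_type fund_def)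
next
  case B_type
  obtain m where m: "n = Suc m" using assms(1) by (cases n) (auto simp: B_type valid_type_def)
  have "(\<Sum>i<m. coord R n i f * fund R n i j) = (\<Sum>i<m. (f i - f (Suc i)) * (if j < Suc i then 1 else 0))"
    using assms(3) by (intro sum.cong refl) (simp add: B_type m fund_def)
  then show ?thesis
    using assms(3) unfolding sum_telescope_from by (simp add: B_type m fund_def min_absorb1)
next
  case C_type
  obtain m where m: "n = Suc m" using assms(1) by (cases n) (auto simp: C_type valid_type_def)
  have "(\<Sum>i<m. coord R n i f * fund R n i j) = (\<Sum>i<m. (f i - f (Suc i)) * (if j < Suc i then 1 else 0))"
    using assms(3) by (intro sum.cong refl) (simp add: C_type m fund_def)
  then show ?thesis
    using assms(3) unfolding sum_telescope_from by (simp add: C_type m fund_def min_absorb1)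
next
  case D_type
  define m where "m = n - 2"
  have m: "n = Suc (Suc m)" using assms(1) by (simp add: D_type valid_type_def m_def)
  have "(\<Sum>i<m. coord R n i f * fund R n i j) = (\<Sum>i<m. (f i - f (Suc i)) * (if j < Suc i then 1 else 0))"
    using assms(3) by (intro sum.cong refl) (simp add: D_type m fund_def)
  then show ?thesis
    using assms(3) unfolding sum_telescope_from by (auto simp: D_type m fund_def min_def field_simps less_Suc_eq)
next
  case G2_type
  then have "n = 3" using assms(1) by (simp add: valid_type_def)
  then show ?thesis using assms(2,3)
    by (auto simp: G2_type weight_space_def fund_def vec_of_list_index less_Suc_eq numeral_3_eq_3 nth_Cons')
qed

lemma coord_Ints:
  assumes "valid_type R n" "i < root_rank R n" "weight_integral R n f"
  shows "coord R n i f \<in> \<int>"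
proof -
  have diff: "f a - f b \<in> \<int>" if "a < n" "b < n" for a b
    using assms(3) that by (cases R) simp_all
  have add: "f a + f b \<in> \<int>" if "a < n" "b < n" "R \<noteq> A_type" for a b
    using assms(3) that by (cases R) simp_all
  have int: "f a \<in> \<int>" if "a < n" "R = C_type \<or> R = G2_type" for a
    using assms(3) that by auto
  have double: "2 * f i \<in> \<int>" if "i < n" "R \<noteq> A_type"
    using add[OF that(1,1,2)] by (simp only: mult_2)
  show ?thesis
    using assms(1,2) diff[of i "Suc i"] add[of "i - 1" i] double int[of i] int[of 0] diff[of 0 1]
    by (cases R) (simp_all add: valid_type_def)
qed

lemma fund_weight_space:
  assumes "valid_type R n" "k < root_rank R n"
  shows "fund R n k \<in> weight_space R n"
proof (cases R)
  case A_type
  have "(\<Sum>j<n. if j < Suc k then 1 else 0) = real (Suc k)"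
    using assms by (simp add: A_type sum.If_cases Int_absorb1 subset_eq)
      (subst Int_absorb1, auto simp: A_type valid_type_def)
  then show ?thesis using assms
    by (simp add: A_type weight_space_def fund_def sum_subtractf valid_type_def)
next
  case G2_type
  then show ?thesis using assms
    by (auto simp: valid_type_def weight_space_def fund_def vec_of_list_index less_Suc_eq numeral_3_eq_3 nth_Cons')
qed (auto simp: weight_space_def)

lemma integers_or_half_integers:
  fixes f :: "nat \<Rightarrow> real"
  assumes "(\<forall>j<n. f j \<in> \<int>) \<or> (\<forall>j<n. f j - 1 / 2 \<in> \<int>)"
  shows "\<forall>i<n. \<forall>j<n. f i - f j \<in> \<int> \<and> f i + f j \<in> \<int>"
  using assms
proof
  assume half: "\<forall>j<n. f j - 1 / 2 \<in> \<int>"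
  show ?thesis
  proof (intro allI impI)
    fix i j assume "i < n" "j < n"
    then have h: "f i - 1 / 2 \<in> \<int>" "f j - 1 / 2 \<in> \<int>" using half by blast+
    have "(f i - 1 / 2) - (f j - 1 / 2) \<in> \<int>" "(f i - 1 / 2) + (f j - 1 / 2) + 1 \<in> \<int>"
      by (rule Ints_diff[OF h], rule Ints_add[OF Ints_add[OF h] Ints_1])
    then show "f i - f j \<in> \<int> \<and> f i + f j \<in> \<int>" by (simp add: algebra_simps)
  qed
qed simp

lemma fund_weight_integral:
  assumes "valid_type R n" "k < root_rank R n"
  shows "weight_integral R n (fund R n k)"
proof (cases R)
  case G2_type
  have "fund_weight G2_type 3 (Suc k) $ i \<in> \<int>" if "i < 3" for i
    using that by (auto simp: vec_of_list_index less_Suc_eq numeral_3_eq_3 nth_Cons')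
  then show ?thesis using assms by (simp add: G2_type valid_type_def fund_def)
next
  case A_type
  have "x - c - (y - c) \<in> \<int>" if "x \<in> \<int>" "y \<in> \<int>" for x y c :: real
    using Ints_diff[OF that] by simp
  then show ?thesis by (simp add: A_type fund_def)
next
  case B_type
  then show ?thesis
    unfolding B_type weight_integral.simps
    by (intro integers_or_half_integers) (cases "Suc k = n"; simp add: fund_def)
next
  case C_type
  then show ?thesis by (simp add: fund_def)
next
  case D_type
  have "- 1 / 2 - 1 / 2 = (- 1 :: real)" by simp
  then have "- 1 / 2 - 1 / 2 \<in> (\<int> :: real set)" by (simp only: Ints_minus Ints_1)
  then show ?thesis
    unfolding D_type weight_integral.simps
    by (intro integers_or_half_integers) (cases "Suc k = n"; cases "Suc k = n - 1"; simp add: fund_def)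
qed

lemma weyl_act_weight_integral:
  assumes "(p, S) \<in> weyl_params R n" "weight_integral R n f"
  shows "weight_integral R n (weyl_act p S f)"
proof -
  have p: "p permutes {..<n}" and S: "S \<in> sign_sets R n" using assms(1) by (auto simp: weyl_params_def)
  have inv: "Hilbert_Choice.inv p i < n" if "i < n" for i
    using permutes_in_image[OF permutes_inv[OF p], of i] that by simp
  have *: "set_sign S a * x - set_sign S b * y \<in> \<int> \<and> set_sign S a * x + set_sign S b * y \<in> \<int>"
    if "x - y \<in> \<int> \<and> x + y \<in> \<int>" for a b and x y :: real
  proof -
    have "- (x - y) \<in> \<int>" "- (x + y) \<in> \<int>" using that by (simp_all only: minus_in_Ints_iff)
    then have "y - x \<in> \<int>" "- x - y \<in> \<int>" by simp_all
    then show ?thesis using that by (simp add: set_sign_def add.commute)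
  qed
  have **: "set_sign S a * x \<in> \<int>" if "x \<in> \<int>" for a and x :: real
    using that by (simp add: set_sign_def)
  show ?thesis
  proof (cases R)
    case A_type
    then have "set_sign S a = 1" for a using S by (simp add: set_sign_def)
    then show ?thesis using assms(2) inv by (simp add: A_type weyl_act_def)
  next
    case B_type
    show ?thesis unfolding B_type weight_integral.simps weyl_act_def
      by (intro allI impI * assms(2)[unfolded B_type weight_integral.simps, rule_format] inv)
  next
    case C_type
    then show ?thesis using assms(2) inv by (simp add: weyl_act_def **)
  next
    case D_type
    show ?thesis unfolding D_type weight_integral.simps weyl_act_def
      by (intro allI impI * assms(2)[unfolded D_type weight_integral.simps, rule_format] inv)
  next
    case G2_type
    then show ?thesis using assms(2) inv by (simp add: weyl_act_def **)
  qed
qed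

lemma weyl_act_weight_space:
  assumes "(p, S) \<in> weyl_params R n" "f \<in> weight_space R n"
  shows "weyl_act p S f \<in> weight_space R n"
proof (cases "R \<in> {A_type, G2_type}")
  case True
  have p: "p permutes {..<n}" and S: "S \<in> sign_sets R n" using assms(1) by (auto simp: weyl_params_def)
  have "\<exists>s. \<forall>j<n. set_sign S j = s" using S True by (auto simp: set_sign_def)
  then obtain s where s: "\<And>j. j < n \<Longrightarrow> set_sign S j = s" by blast
  have "(\<Sum>i<n. weyl_act p S f i) = (\<Sum>j<n. weyl_act p S f (p j))"
    by (rule sum.permute[OF p, unfolded o_def])
  also have "\<dots> = s * (\<Sum>j<n. f j)"
    unfolding sum_distrib_left by (intro sum.cong refl) (simp add: weyl_act_def permutes_inverses[OF p] s)
  finally show ?thesis using assms(2) True by (auto simp: weight_space_def)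
qed (simp add: weight_space_def)

text \<open>The entries are integers by \<open>coord_Ints\<close>, so for valid parameters the floor
  only changes the type.\<close>

definition weyl_int_mat :: "root_type \<Rightarrow> nat \<Rightarrow> (nat \<Rightarrow> nat) \<times> nat set \<Rightarrow> int mat" where
  "weyl_int_mat R n = (\<lambda>(p, S). mat (root_rank R n) (root_rank R n)
     (\<lambda>(i, k). \<lfloor>coord R n i (weyl_act p S (fund R n k))\<rfloor>))"

lemma of_int_floor_coord:
  assumes "valid_type R n" "(p, S) \<in> weyl_params R n" "i < root_rank R n" "k < root_rank R n"
  shows "of_int \<lfloor>coord R n i (weyl_act p S (fund R n k))\<rfloor> = coord R n i (weyl_act p S (fund R n k))"
  using coord_Ints[OF assms(1,3) weyl_act_weight_integral[OF assms(2) fund_weight_integral[OF assms(1,4)]]]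
  by simp

lemma weight_mat_carrier: "weight_mat R n \<in> carrier_mat n (root_rank R n)"
  unfolding weight_mat_def using mat_of_cols_carrier(1)[of n "map (fund_weight R n) [1..<root_rank R n + 1]"]
  by (simp del: upt_Suc)

lemma weight_mat_index:
  assumes "j < n" "k < root_rank R n"
  shows "weight_mat R n $$ (j, k) = fund R n k j"
  using assms by (simp add: weight_mat_def mat_of_cols_index fund_def del: upt_Suc)

lemma weight_mat_mult_index:
  assumes "j < n" "k < root_rank R n" "B \<in> carrier_mat (root_rank R n) (root_rank R n)"
  shows "(weight_mat R n * map_mat real_of_int B) $$ (j, k) =
    (\<Sum>i<root_rank R n. real_of_int (B $$ (i, k)) * fund R n i j)"
proof -
  have "(weight_mat R n * map_mat real_of_int B) $$ (j, k) =
      (\<Sum>i<root_rank R n. weight_mat R n $$ (j, i) * real_of_int (B $$ (i, k)))"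
    using assms weight_mat_carrier[of R n] by (simp add: scalar_prod_def atLeast0LessThan)
  also have "\<dots> = (\<Sum>i<root_rank R n. real_of_int (B $$ (i, k)) * fund R n i j)"
    using assms by (intro sum.cong refl) (simp add: weight_mat_index)
  finally show ?thesis .
qed

lemma signed_perm_mat_mult_index:
  assumes "j < n" "k < root_rank R n" "p permutes {..<n}"
  shows "(signed_perm_mat n p (set_sign S) * weight_mat R n) $$ (j, k) = weyl_act p S (fund R n k) j"
proof -
  have "signed_perm_mat n p (set_sign S) \<in> carrier_mat n n" by (simp add: signed_perm_mat_def)
  then have "(signed_perm_mat n p (set_sign S) * weight_mat R n) $$ (j, k) =
      (\<Sum>i<n. signed_perm_mat n p (set_sign S) $$ (j, i) * fund R n k i)"
    using assms weight_mat_carrier[of R n] by (simp add: scalar_prod_def atLeast0LessThan weight_mat_index)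
  then show ?thesis
    by (simp add: signed_perm_mat_row_sum[OF assms(3,1)])
qed

lemma weight_mat_int_eq_iff:
  assumes "(p, S) \<in> weyl_params R n" "B \<in> carrier_mat (root_rank R n) (root_rank R n)"
  shows "signed_perm_mat n p (set_sign S) * weight_mat R n = weight_mat R n * map_mat real_of_int B \<longleftrightarrow>
    (\<forall>j<n. \<forall>k<root_rank R n. weyl_act p S (fund R n k) j =
      (\<Sum>i<root_rank R n. real_of_int (B $$ (i, k)) * fund R n i j))"
proof -
  have p: "p permutes {..<n}" using assms(1) by (simp add: weyl_params_def)
  have "signed_perm_mat n p (set_sign S) \<in> carrier_mat n n" by (simp add: signed_perm_mat_def)
  then have *: "signed_perm_mat n p (set_sign S) * weight_mat R n \<in> carrier_mat n (root_rank R n)"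
    "weight_mat R n * map_mat real_of_int B \<in> carrier_mat n (root_rank R n)"
    using weight_mat_carrier[of R n] assms(2) by auto
  have "X = Y \<longleftrightarrow> (\<forall>j<n. \<forall>k<r. X $$ (j, k) = Y $$ (j, k))"
    if "X \<in> carrier_mat n r" "Y \<in> carrier_mat n r" for X Y :: "real mat" and r
    using that by (auto simp: mat_eq_iff)
  from this[OF *] show ?thesis
    using signed_perm_mat_mult_index[OF _ _ p] weight_mat_mult_index[OF _ _ assms(2)] by simp
qed

lemma weyl_int_mat_carrier: "weyl_int_mat R n ps \<in> carrier_mat (root_rank R n) (root_rank R n)"
  by (simp add: weyl_int_mat_def split: prod.splits)

lemma weyl_int_mat_index:
  assumes "valid_type R n" "(p, S) \<in> weyl_params R n" "i < root_rank R n" "k < root_rank R n"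
  shows "real_of_int (weyl_int_mat R n (p, S) $$ (i, k)) = coord R n i (weyl_act p S (fund R n k))"
  using assms by (simp add: weyl_int_mat_def of_int_floor_coord)

lemma weyl_act_fund_eq:
  assumes "valid_type R n" "(p, S) \<in> weyl_params R n" "j < n" "k < root_rank R n"
  shows "weyl_act p S (fund R n k) j =
    (\<Sum>i<root_rank R n. real_of_int (weyl_int_mat R n (p, S) $$ (i, k)) * fund R n i j)"
  using sum_coord_fund[OF assms(1) weyl_act_weight_space[OF assms(2) fund_weight_space[OF assms(1,4)]] assms(3)]
    assms by (simp add: weyl_int_mat_index)

lemma coord_sum_fund:
  assumes "valid_type R n" "i < root_rank R n" "\<And>j. j < n \<Longrightarrow> f j = (\<Sum>i<root_rank R n. a i * fund R n i j)"
  shows "coord R n i f = a i"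
proof -
  have "coord R n i f = (\<Sum>j<n. coroot R n i j * (\<Sum>k<root_rank R n. a k * fund R n k j))"
    using assms by (simp add: coord_eq_sum_coroot)
  also have "\<dots> = (\<Sum>k<root_rank R n. a k * (\<Sum>j<n. coroot R n i j * fund R n k j))"
    unfolding sum_distrib_left by (subst sum.swap) (simp add: mult_ac)
  also have "\<dots> = (\<Sum>k<root_rank R n. a k * (if i = k then 1 else 0))"
    using assms by (intro sum.cong refl) (simp add: coord_fund flip: coord_eq_sum_coroot)
  also have "\<dots> = a i" using assms(2) by (simp add: if_distrib cong: if_cong)
  finally show ?thesis .
qed

text \<open>Integrality of the weights gives the existence of \<open>B\<close>, and the dual
  coordinates give its uniqueness for each signed permutation.\<close>

lemma int_rep_eq:
  assumes "valid_type R n"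
  shows "int_rep R n = weyl_int_mat R n ` weyl_params R n"
proof (intro equalityI subsetI)
  fix B assume "B \<in> int_rep R n"
  then obtain p S where B: "B \<in> carrier_mat (root_rank R n) (root_rank R n)" and ps: "(p, S) \<in> weyl_params R n"
    and eq: "signed_perm_mat n p (set_sign S) * weight_mat R n = weight_mat R n * map_mat real_of_int B"
    by (auto simp: int_rep_def weyl_group_eq)
  have "B = weyl_int_mat R n (p, S)"
  proof (rule eq_matI)
    fix i k assume "i < dim_row (weyl_int_mat R n (p, S))" "k < dim_col (weyl_int_mat R n (p, S))"
    then have ik: "i < root_rank R n" "k < root_rank R n"
      using weyl_int_mat_carrier[of R n "(p, S)"] by auto
    have "coord R n i (weyl_act p S (fund R n k)) = real_of_int (B $$ (i, k))"
      using eq ik unfolding weight_mat_int_eq_iff[OF ps B] by (intro coord_sum_fund assms) auto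
    then show "B $$ (i, k) = weyl_int_mat R n (p, S) $$ (i, k)"
      using weyl_int_mat_index[OF assms ps ik] by simp
  qed (use B weyl_int_mat_carrier[of R n "(p, S)"] in auto)
  then show "B \<in> weyl_int_mat R n ` weyl_params R n" using ps by blast
next
  fix B assume "B \<in> weyl_int_mat R n ` weyl_params R n"
  then obtain p S where ps: "(p, S) \<in> weyl_params R n" and B: "B = weyl_int_mat R n (p, S)" by auto
  have "signed_perm_mat n p (set_sign S) * weight_mat R n = weight_mat R n * map_mat real_of_int B"
    unfolding B weight_mat_int_eq_iff[OF ps weyl_int_mat_carrier]
    using weyl_act_fund_eq[OF assms ps] by blast
  moreover have "signed_perm_mat n p (set_sign S) \<in> weyl_group R n"
    unfolding weyl_group_eq using ps by (intro image_eqI[of _ _ "(p, S)"]) auto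
  ultimately show "B \<in> int_rep R n"
    unfolding int_rep_def using weyl_int_mat_carrier B by blast
qed

text \<open>A vector with trivial stabiliser. Distinct absolute values, all nonzero, let one read
  off both permutation and signs; in type A there are no signs and distinct values suffice.\<close>

lemma exists_generic_weight:
  assumes "valid_type R n"
  shows "\<exists>f \<in> weight_space R n. \<forall>p S p' S'. (p, S) \<in> weyl_params R n \<longrightarrow> (p', S') \<in> weyl_params R n \<longrightarrow>
    (\<forall>i<n. weyl_act p S f i = weyl_act p' S' f i) \<longrightarrow> p = p' \<and> S = S'"
proof -
  have main: "p = p' \<and> S = S'" if ps: "(p, S) \<in> weyl_params R n" "(p', S') \<in> weyl_params R n"
    and eq: "\<And>i. i < n \<Longrightarrow> weyl_act p S f i = weyl_act p' S' f i"
    and inj: "\<And>j k. j < n \<Longrightarrow> k < n \<Longrightarrow> set_sign S j * f j = set_sign S' k * f k \<Longrightarrow> j = k"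
    and nz: "R = A_type \<or> (\<forall>j<n. f j \<noteq> 0)" for f p S p' S'
  proof -
    have p: "p permutes {..<n}" "p' permutes {..<n}" and S: "S \<in> sign_sets R n" "S' \<in> sign_sets R n"
      using ps by (auto simp: weyl_params_def)
    have *: "p j = p' j \<and> set_sign S j * f j = set_sign S' j * f j" if j: "j < n" for j
    proof -
      have pj: "p j < n" using permutes_in_image[OF p(1), of j] j by simp
      define k where "k = Hilbert_Choice.inv p' (p j)"
      have k: "k < n" using permutes_in_image[OF permutes_inv[OF p(2)], of "p j"] pj by (simp add: k_def)
      have "set_sign S j * f j = set_sign S' k * f k"
        using eq[OF pj] by (simp add: weyl_act_def k_def permutes_inverses[OF p(1)])
      then show ?thesis using inj[OF j k] permutes_inverses(1)[OF p(2), of "p j"] by (auto simp: k_def)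
    qed
    have "p j = p' j" for j
    proof (cases "j < n")
      case False
      then show ?thesis using p by (simp add: permutes_not_in)
    qed (use * in blast)
    then have "p = p'" by blast
    moreover have "S = S'"
    proof (cases "R = A_type")
      case False
      then have "j \<in> S \<longleftrightarrow> j \<in> S'" if "j < n" for j
        using *[OF that] nz that by (auto simp: set_sign_def split: if_splits)
      then show ?thesis
        using sign_sets_subset[OF S(1)] sign_sets_subset[OF S(2)] by blast
    qed (use S in auto)
    ultimately show ?thesis by blast
  qed
  consider (A) "R = A_type" | (G) "R = G2_type" "n = 3" | (BCD) "R \<noteq> A_type" "R \<noteq> G2_type"
    using assms by (auto simp: valid_type_def)
  then show ?thesis
  proof cases
    case A
    \<comment> \<open>Distinct entries, shifted to have sum 0.\<close>
    define f where "f j = real n * real j - (\<Sum>i<n. real i)" for j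
    have "f \<in> weight_space R n"
      by (simp add: weight_space_def f_def sum_subtractf flip: sum_distrib_left)
    moreover have "j = k" if "f j = f k" for j k using that assms by (auto simp: f_def A valid_type_def)
    moreover have "set_sign S j = 1" if "(p, S) \<in> weyl_params R n" for p S j
      using that by (simp add: weyl_params_def A set_sign_def)
    ultimately show ?thesis
      by (intro bexI[of _ f] allI impI main[of _ _ _ _ f]) (auto simp: A)
  next
    case G
    \<comment> \<open>The vector (1, 2, -3): sum 0 and distinct absolute values.\<close>
    define f where "f j = (if j = 2 then - 3 else real j + 1)" for j :: nat
    have "f \<in> weight_space R n"
      by (simp add: weight_space_def f_def G numeral_3_eq_3)
    moreover have "j = k" if "j < n" "k < n" "set_sign S j * f j = set_sign S' k * f k" for j k S S'
    proof -
      have "j \<in> {0, 1, 2}" "k \<in> {0, 1, 2}" using that G by auto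
      then show ?thesis using that(3) by (auto simp: f_def set_sign_def split: if_splits)
    qed
    moreover have "\<forall>j<n. f j \<noteq> 0" by (simp add: f_def)
    ultimately show ?thesis
      by (intro bexI[of _ f] allI impI main[of _ _ _ _ f]) auto
  next
    case BCD
    define f where "f j = real j + 1" for j :: nat
    have "f \<in> weight_space R n"
      using BCD by (simp add: weight_space_def)
    moreover have "j = k" if "set_sign S j * f j = set_sign S' k * f k" for j k S S'
      using that by (auto simp: f_def set_sign_def split: if_splits)
    moreover have "f j \<noteq> 0" for j by (simp add: f_def)
    ultimately show ?thesis
      by (intro bexI[of _ f] allI impI main[of _ _ _ _ f]) auto
  qed
qed

lemma weyl_act_sum:
  "weyl_act p S (\<lambda>j. \<Sum>i\<in>A. a i * f i j) m = (\<Sum>i\<in>A. a i * weyl_act p S (f i) m)"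
  by (simp add: weyl_act_def sum_distrib_left mult_ac)

text \<open>Orbit polynomials average over matrices; injectivity allows averaging over parameters
  instead. A matrix determines the action on all fundamental weights, hence on the generic weight,
  hence the parameters.\<close>

lemma inj_on_weyl_int_mat:
  assumes "valid_type R n"
  shows "inj_on (weyl_int_mat R n) (weyl_params R n)"
proof (rule inj_onI)
  fix ps ps' assume in_params: "ps \<in> weyl_params R n" "ps' \<in> weyl_params R n"
    and eq: "weyl_int_mat R n ps = weyl_int_mat R n ps'"
  obtain p S p' S' where ps_eq: "ps = (p, S)" "ps' = (p', S')" by (cases ps, cases ps')
  note ps = in_params[unfolded ps_eq]
  obtain f where f: "f \<in> weight_space R n" and gen: "\<forall>p S p' S'. (p, S) \<in> weyl_params R n \<longrightarrow> (p', S') \<in> weyl_params R n \<longrightarrow>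
    (\<forall>i<n. weyl_act p S f i = weyl_act p' S' f i) \<longrightarrow> p = p' \<and> S = S'"
    using exists_generic_weight[OF assms] by blast
  have fund_eq: "weyl_act p S (fund R n k) m = weyl_act p' S' (fund R n k) m" if "m < n" "k < root_rank R n" for m k
    using weyl_act_fund_eq[OF assms ps(1) that] weyl_act_fund_eq[OF assms ps(2) that] eq ps_eq by simp
  have act_f: "weyl_act q T f m = (\<Sum>i<root_rank R n. coord R n i f * weyl_act q T (fund R n i) m)"
    if "(q, T) \<in> weyl_params R n" "m < n" for q T m
  proof -
    have "Hilbert_Choice.inv q m < n"
      using that permutes_in_image[OF permutes_inv[of q "{..<n}"], of m] by (auto simp: weyl_params_def)
    then have "weyl_act q T f m = weyl_act q T (\<lambda>j. \<Sum>i<root_rank R n. coord R n i f * fund R n i j) m"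
      using sum_coord_fund[OF assms f] by (simp add: weyl_act_def)
    then show ?thesis by (simp only: weyl_act_sum)
  qed
  have "weyl_act p S f m = weyl_act p' S' f m" if "m < n" for m
    unfolding act_f[OF ps(1) that] act_f[OF ps(2) that] using fund_eq that by (intro sum.cong) auto
  then show "ps = ps'" using gen ps ps_eq by blast
qed

section \<open>Exponential coordinates\<close>

definition pairing :: "nat \<Rightarrow> (nat \<Rightarrow> real) \<Rightarrow> (nat \<Rightarrow> complex) \<Rightarrow> complex" where
  "pairing n f v = (\<Sum>j<n. of_real (f j) * v j)"

text \<open>\<open>v\<close> ranges over the ambient space, where the group acts by signed
  permutations, and not over the r lattice coordinates. In types A and G2 a constant shift of
  \<open>v\<close> gives the same point, since the weights have coordinate sum 0.\<close>

definition exp_point :: "root_type \<Rightarrow> nat \<Rightarrow> (nat \<Rightarrow> complex) \<Rightarrow> complex vec" where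
  "exp_point R n v = vec (root_rank R n) (\<lambda>i. exp (pairing n (fund R n i) v))"

definition orbit_sum :: "root_type \<Rightarrow> nat \<Rightarrow> (nat \<Rightarrow> real) \<Rightarrow> (nat \<Rightarrow> complex) \<Rightarrow> complex" where
  "orbit_sum R n f v = (\<Sum>(p, S) \<in> weyl_params R n.
     exp (\<Sum>j<n. of_real (set_sign S j * f j) * v (p j)))"

text \<open>With \<lambda> = \<Sum> \<alpha>_k \<omega>_k and w the group element of matrix B, the
  monomial with exponent B \<alpha> is the exponential of the pairing of w \<lambda> with
  \<open>v\<close>.\<close>

lemma orbit_poly_exp_point:
  assumes "valid_type R n" "\<alpha> \<in> carrier_vec (root_rank R n)"
  shows "orbit_poly R n \<alpha> (exp_point R n v) =
    orbit_sum R n (\<lambda>j. \<Sum>k<root_rank R n. of_int (\<alpha> $ k) * fund R n k j) v / of_nat (card (weyl_params R n))"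
proof -
  let ?r = "root_rank R n"
  let ?f = "\<lambda>j. \<Sum>k<?r. of_int (\<alpha> $ k) * fund R n k j"
  have "monomial_powi (exp_point R n v) (weyl_int_mat R n (p, S) *\<^sub>v \<alpha>) =
      exp (\<Sum>j<n. of_real (set_sign S j * ?f j) * v (p j))" if ps: "(p, S) \<in> weyl_params R n" for p S
  proof -
    let ?B = "weyl_int_mat R n (p, S)"
    have B: "?B \<in> carrier_mat ?r ?r" by (rule weyl_int_mat_carrier)
    then have dim: "dim_row ?B = ?r" by simp
    have Ba: "(?B *\<^sub>v \<alpha>) $ i = (\<Sum>k<?r. ?B $$ (i, k) * \<alpha> $ k)" if "i < ?r" for i
      using that B assms(2) by (simp add: scalar_prod_def atLeast0LessThan)
    have "monomial_powi (exp_point R n v) (?B *\<^sub>v \<alpha>) =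
        (\<Prod>i<?r. exp (of_int ((?B *\<^sub>v \<alpha>) $ i) * pairing n (fund R n i) v))"
      unfolding monomial_powi_def by (simp add: dim exp_point_def exp_power_int)
    also have "\<dots> = exp (\<Sum>i<?r. of_int ((?B *\<^sub>v \<alpha>) $ i) * pairing n (fund R n i) v)"
      by (simp add: exp_sum)
    also have "(\<Sum>i<?r. of_int ((?B *\<^sub>v \<alpha>) $ i) * pairing n (fund R n i) v) =
        (\<Sum>i<?r. \<Sum>j<n. of_real (of_int ((?B *\<^sub>v \<alpha>) $ i) * fund R n i j) * v j)"
      by (simp add: pairing_def sum_distrib_left mult.assoc)
    also have "\<dots> = (\<Sum>j<n. of_real (\<Sum>i<?r. of_int ((?B *\<^sub>v \<alpha>) $ i) * fund R n i j) * v j)"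
      by (subst sum.swap) (simp add: sum_distrib_right)
    also have "\<dots> = (\<Sum>j<n. of_real (weyl_act p S ?f j) * v j)"
    proof (intro sum.cong refl arg_cong2[where f = "(*)"] arg_cong[where f = of_real])
      fix j assume j: "j \<in> {..<n}"
      have "(\<Sum>i<?r. of_int ((?B *\<^sub>v \<alpha>) $ i) * fund R n i j) =
          (\<Sum>i<?r. \<Sum>k<?r. of_int (\<alpha> $ k) * (of_int (?B $$ (i, k)) * fund R n i j))"
        by (intro sum.cong refl) (simp add: Ba sum_distrib_right sum_distrib_left mult_ac)
      also have "\<dots> = (\<Sum>k<?r. of_int (\<alpha> $ k) * weyl_act p S (fund R n k) j)"
        using weyl_act_fund_eq[OF assms(1) ps, of j] j
        by (subst sum.swap) (simp add: sum_distrib_left[symmetric])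
      finally show "(\<Sum>i<?r. of_int ((?B *\<^sub>v \<alpha>) $ i) * fund R n i j) = weyl_act p S ?f j"
        by (simp only: weyl_act_sum)
    qed
    also have "\<dots> = (\<Sum>j<n. of_real (set_sign S j * ?f j) * v (p j))"
      using ps by (intro sum_weyl_act) (simp add: weyl_params_def)
    finally show ?thesis .
  qed
  then have "(\<Sum>B \<in> int_rep R n. monomial_powi (exp_point R n v) (B *\<^sub>v \<alpha>)) = orbit_sum R n ?f v"
    unfolding int_rep_eq[OF assms(1)] orbit_sum_def
    by (subst sum.reindex[OF inj_on_weyl_int_mat[OF assms(1)]]) (auto intro!: sum.cong simp: o_def)
  moreover have "card (int_rep R n) = card (weyl_params R n)"
    unfolding int_rep_eq[OF assms(1)] by (rule card_image[OF inj_on_weyl_int_mat[OF assms(1)]])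
  ultimately show ?thesis unfolding orbit_poly_def by simp
qed

subsection \<open>Orbit polynomials in exponential coordinates\<close>

lemma exp_point_carrier: "exp_point R n v \<in> carrier_vec (root_rank R n)"
  by (simp add: exp_point_def)

lemma exp_point_nonzero: "i < root_rank R n \<Longrightarrow> exp_point R n v $ i \<noteq> 0"
  by (simp add: exp_point_def)

lemma exp_point_torus:
  assumes "\<And>j. j < n \<Longrightarrow> Re (v j) = 0"
  shows "exp_point R n v \<in> torus (root_rank R n)"
proof -
  have "Re (pairing n (fund R n i) v) = 0" for i
    using assms by (simp add: pairing_def)
  then show ?thesis by (simp add: torus_def exp_point_def)
qed

lemma exists_complex_log:
  assumes "x \<noteq> 0"
  shows "\<exists>w. exp w = x \<and> Re w = ln (cmod x)"
proof -
  have "exp (of_real (ln (cmod x)) + \<i> * of_real (Arg x)) = rcis (cmod x) (Arg x)"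
    using assms by (simp add: exp_add exp_of_real cis_conv_exp rcis_def)
  then show ?thesis
    by (intro exI[of _ "of_real (ln (cmod x)) + \<i> * of_real (Arg x)"]) (simp add: rcis_cmod_Arg)
qed

text \<open>Logarithms of the coordinates are combined with the simple coroots, the dual basis of
  the fundamental weights. The coefficients are real, so torus points receive imaginary
  \<open>v\<close>; in type A the coroots have sum 0.\<close>

lemma exp_point_surj:
  assumes "valid_type R n" "x \<in> carrier_vec (root_rank R n)" "\<And>i. i < root_rank R n \<Longrightarrow> x $ i \<noteq> 0"
  shows "\<exists>v. exp_point R n v = x \<and> (R = A_type \<longrightarrow> (\<Sum>j<n. v j) = 0) \<and>
    (x \<in> torus (root_rank R n) \<longrightarrow> (\<forall>j. Re (v j) = 0))"
proof -
  let ?r = "root_rank R n"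
  have "\<exists>w. \<forall>i. i < ?r \<longrightarrow> exp (w i) = x $ i \<and> Re (w i) = ln (cmod (x $ i))"
    using exists_complex_log[OF assms(3)] by (intro choice) blast
  then obtain w where w: "\<And>i. i < ?r \<Longrightarrow> exp (w i) = x $ i" "\<And>i. i < ?r \<Longrightarrow> Re (w i) = ln (cmod (x $ i))"
    by blast
  define v where "v j = (\<Sum>i<?r. w i * of_real (coroot R n i j))" for j
  have swap: "(\<Sum>j<n. of_real (f j) * v j) = (\<Sum>i<?r. w i * of_real (coord R n i f))" for f
  proof -
    have "(\<Sum>j<n. of_real (f j) * v j) = (\<Sum>i<?r. \<Sum>j<n. w i * (of_real (coroot R n i j * f j)))"
      unfolding v_def sum_distrib_left by (subst sum.swap) (simp add: mult_ac)
    then show ?thesis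
      using assms(1) by (simp add: coord_eq_sum_coroot sum_distrib_left)
  qed
  have "pairing n (fund R n k) v = w k" if "k < ?r" for k
  proof -
    have "pairing n (fund R n k) v = (\<Sum>i<?r. w i * (if i = k then 1 else 0))"
      unfolding pairing_def swap using assms(1) that by (intro sum.cong refl) (simp add: coord_fund)
    then show ?thesis using that by (simp add: if_distrib cong: if_cong)
  qed
  then have "exp_point R n v = x"
    using assms(2) w(1) by (intro eq_vecI) (auto simp: exp_point_def)
  moreover have "(\<Sum>j<n. v j) = 0" if "R = A_type"
    using swap[of "\<lambda>_. 1"] by (simp add: that)
  moreover have "Re (v j) = 0" if "x \<in> torus ?r" for j
    using that w(2) by (simp add: v_def torus_def)
  ultimately show ?thesis by blast
qed

lemma fund_orbit_poly_exp_point: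
  assumes "valid_type R n" "i < root_rank R n"
  shows "fund_orbit_poly R n i (exp_point R n v) = orbit_sum R n (fund R n i) v / of_nat (card (weyl_params R n))"
proof -
  have "(\<Sum>k<root_rank R n. of_int (unit_vec (root_rank R n) i $ k) * fund R n k j) = fund R n i j" for j
    using assms(2) by (simp add: unit_vec_def if_distrib[of "\<lambda>x. of_int x * _"] cong: if_cong)
  then show ?thesis
    unfolding fund_orbit_poly_def by (subst orbit_poly_exp_point[OF assms(1)]) auto
qed

lemma cosh_joukowski: "cosh w = (exp w + inverse (exp w)) / 2" for w :: complex
  by (simp add: cosh_field_def exp_minus)

text \<open>Averaging the exponents k and -k turns each exponential into cosh(k L), with L the
  pairing of an orbit element of \<omega>_1 with \<open>v\<close>, and cosh(k L) = T_k(cosh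
  L).\<close>

lemma real_cheb_value_exp_point:
  assumes "valid_type R n"
  shows "real_cheb_value R n k (exp_point R n v) =
    (\<Sum>(p, S) \<in> weyl_params R n. cheb k (cosh (\<Sum>j<n. of_real (set_sign S j * fund R n 0 j) * v (p j)))) /
      of_nat (card (weyl_params R n))"
proof -
  let ?r = "root_rank R n" and ?L = "\<lambda>p S. \<Sum>j<n. of_real (set_sign S j * fund R n 0 j) * v (p j)"
  have r: "0 < ?r" using assms by (cases R) (auto simp: valid_type_def)
  have sum: "(\<Sum>i<?r. of_int ((a \<cdot>\<^sub>v unit_vec ?r 0) $ i) * fund R n i j) = of_int a * fund R n 0 j" for j and a :: int
  proof -
    have "(\<Sum>i<?r. of_int ((a \<cdot>\<^sub>v unit_vec ?r 0) $ i) * fund R n i j) = (\<Sum>i<?r. if i = 0 then of_int a * fund R n 0 j else 0)"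
      by (intro sum.cong refl) (simp add: unit_vec_def)
    then show ?thesis using r by simp
  qed
  have eq: "orbit_poly R n (a \<cdot>\<^sub>v unit_vec ?r 0) (exp_point R n v) =
      (\<Sum>(p, S) \<in> weyl_params R n. exp (of_int a * ?L p S)) / of_nat (card (weyl_params R n))" for a :: int
  proof -
    have "(\<Sum>j<n. of_real (set_sign S j * (of_int a * fund R n 0 j)) * v (p j)) = of_int a * ?L p S" for p S
      by (simp add: sum_distrib_left mult_ac)
    then show ?thesis
      by (subst orbit_poly_exp_point[OF assms]) (simp_all only: orbit_sum_def sum smult_carrier_vec unit_vec_carrier)
  qed
  have neg: "- (int k \<cdot>\<^sub>v unit_vec ?r 0) = (- int k) \<cdot>\<^sub>v (unit_vec ?r 0 :: int vec)"
    by (intro eq_vecI) auto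
  have "cheb k (cosh w) = (exp (of_int (int k) * w) + exp (of_int (- int k) * w)) / 2" for w :: complex
    unfolding cosh_joukowski by (subst cheb_joukowski) (simp_all add: exp_of_nat_mult exp_minus power_inverse)
  then show ?thesis
    unfolding real_cheb_value_def Let_def neg eq
    by (simp add: case_prod_unfold sum.distrib sum_divide_distrib add_divide_distrib mult.commute[of 2] del: of_int_minus of_int_of_nat_eq)
qed

section \<open>The permutation \<sigma>\<close>

lemma neg_unit_vec_eq_iff:
  assumes "valid_type R n" "(p, S) \<in> weyl_params R n" "i < root_rank R n" "j < root_rank R n"
  shows "- unit_vec (root_rank R n) i = weyl_int_mat R n (p, S) *\<^sub>v unit_vec (root_rank R n) j \<longleftrightarrow>
    (\<forall>m<n. weyl_act p S (fund R n j) m = - fund R n i m)"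
proof -
  let ?r = "root_rank R n" and ?B = "weyl_int_mat R n (p, S)"
  have B: "?B \<in> carrier_mat ?r ?r" by (rule weyl_int_mat_carrier)
  have col: "?B *\<^sub>v unit_vec ?r j = col ?B j"
    using B assms(4) by (intro eq_vecI) (auto simp: scalar_prod_right_unit)
  have "- unit_vec ?r i = ?B *\<^sub>v unit_vec ?r j \<longleftrightarrow> (\<forall>k<?r. ?B $$ (k, j) = (if k = i then - 1 else 0))"
    unfolding col using B assms(3,4) by (auto simp: vec_eq_iff unit_vec_def)
  also have "\<dots> \<longleftrightarrow> (\<forall>m<n. weyl_act p S (fund R n j) m = - fund R n i m)"
  proof
    assume entries: "\<forall>k<?r. ?B $$ (k, j) = (if k = i then - 1 else 0)"
    show "\<forall>m<n. weyl_act p S (fund R n j) m = - fund R n i m"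
    proof (intro allI impI)
      fix m assume "m < n"
      then have "weyl_act p S (fund R n j) m = (\<Sum>k<?r. real_of_int (?B $$ (k, j)) * fund R n k m)"
        by (rule weyl_act_fund_eq[OF assms(1,2) _ assms(4)])
      also have "\<dots> = (\<Sum>k<?r. if k = i then - fund R n i m else 0)"
        by (intro sum.cong refl) (simp add: entries)
      also have "\<dots> = - fund R n i m"
        using assms(3) by simp
      finally show "weyl_act p S (fund R n j) m = - fund R n i m" .
    qed
  next
    assume eq: "\<forall>m<n. weyl_act p S (fund R n j) m = - fund R n i m"
    show "\<forall>k<?r. ?B $$ (k, j) = (if k = i then - 1 else 0)"
    proof (intro allI impI)
      fix k assume k: "k < ?r"
      have "coord R n k (weyl_act p S (fund R n j)) = (if k = i then - 1 else 0)"
      proof (rule coord_sum_fund[OF assms(1) k])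
        fix m assume "m < n"
        then have "weyl_act p S (fund R n j) m = - fund R n i m" using eq by blast
        also have "\<dots> = (\<Sum>k<?r. if k = i then - fund R n i m else 0)" using assms(3) by simp
        also have "\<dots> = (\<Sum>k<?r. (if k = i then - 1 else 0) * fund R n k m)"
          by (intro sum.cong refl) simp
        finally show "weyl_act p S (fund R n j) m = (\<Sum>k<?r. (if k = i then - 1 else 0) * fund R n k m)" .
      qed
      then have "real_of_int (?B $$ (k, j)) = (if k = i then - 1 else 0)"
        using weyl_int_mat_index[OF assms(1,2) k assms(4)] by simp
      then show "?B $$ (k, j) = (if k = i then - 1 else 0)" by (simp split: if_splits)
    qed
  qed
  finally show ?thesis .
qed

lemma sum_weyl_act_invariant:
  assumes "(p, S) \<in> weyl_params R n" "R = A_type \<or> (\<forall>x. h (- x) = h x)"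
  shows "(\<Sum>m<n. h (weyl_act p S f m)) = (\<Sum>m<n. h (f m))"
proof -
  have p: "p permutes {..<n}" and S: "S \<in> sign_sets R n" using assms(1) by (auto simp: weyl_params_def)
  have "(\<Sum>m<n. h (weyl_act p S f m)) = (\<Sum>j<n. h (weyl_act p S f (p j)))"
    by (rule sum.permute[OF p, unfolded o_def])
  also have "\<dots> = (\<Sum>j<n. h (f j))"
    using assms(2) S by (intro sum.cong refl) (auto simp: weyl_act_def permutes_inverses[OF p] set_sign_def)
  finally show ?thesis .
qed

lemma prod_set_sign: "S \<subseteq> {..<n} \<Longrightarrow> (\<Prod>j<n. set_sign S j) = (- 1) ^ card S"
  by (simp add: set_sign_def prod.If_cases Int_absorb1 Int_absorb2 Int_commute)

lemma prod_weyl_act_invariant: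
  assumes "(p, S) \<in> weyl_params D_type n"
  shows "(\<Prod>m<n. weyl_act p S f m) = (\<Prod>m<n. f m)"
proof -
  have p: "p permutes {..<n}" and S: "S \<subseteq> {..<n}" "even (card S)" using assms by (auto simp: weyl_params_def)
  have "(\<Prod>m<n. weyl_act p S f m) = (\<Prod>j<n. weyl_act p S f (p j))"
    by (rule prod.permute[OF p, unfolded o_def])
  also have "\<dots> = (\<Prod>j<n. set_sign S j * f j)"
    by (simp add: weyl_act_def permutes_inverses[OF p])
  also have "\<dots> = (\<Prod>j<n. f j)"
    using S by (simp add: prod.distrib prod_set_sign)
  finally show ?thesis .
qed

lemma sum_indicator_less: "i \<le> n \<Longrightarrow> (\<Sum>m<n. if m < i then 1 else 0) = real i"
proof -
  assume "i \<le> n"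
  then have "{m. m < n \<and> m < i} = {..<i}" by auto
  then show ?thesis by (simp flip: sum.inter_filter)
qed

text \<open>Needed for the uniqueness in \<open>conj_perm\<close>. The orbits are told apart by
  invariants: the number of positive coordinates in type A, of nonzero coordinates in types B, C and
  D, and the squared length, 2 or 6, in type G2. The two half-spin weights of type D differ only in
  the sign of the product of coordinates, which even sign changes preserve.\<close>

lemma fund_eq_if_conjugate:
  assumes "valid_type R n" "(p, S) \<in> weyl_params R n" "(p', S') \<in> weyl_params R n"
    and "j < root_rank R n" "j' < root_rank R n"
    and eq: "\<And>m. m < n \<Longrightarrow> weyl_act p S (fund R n j) m = weyl_act p' S' (fund R n j') m"
  shows "j = j'"
proof -
  have inv: "(\<Sum>m<n. h (fund R n j m)) = (\<Sum>m<n. h (fund R n j' m))"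
    if "R = A_type \<or> (\<forall>x. h (- x) = h x)" for h :: "real \<Rightarrow> real"
  proof -
    have "(\<Sum>m<n. h (weyl_act p S (fund R n j) m)) = (\<Sum>m<n. h (weyl_act p' S' (fund R n j') m))"
      using eq by (intro sum.cong) auto
    then show ?thesis
      unfolding sum_weyl_act_invariant[where h = h, OF assms(2) that] sum_weyl_act_invariant[where h = h, OF assms(3) that] .
  qed
  have nonzero: "(\<Sum>m<n. if fund R n j m \<noteq> 0 then 1 else 0) = (\<Sum>m<n. if fund R n j' m \<noteq> 0 then 1 else (0 :: real))"
    if "R \<noteq> A_type" by (rule inv) simp
  have BC: "j = j'" if R: "R = B_type \<or> R = C_type" and lt: "j < n" "j' < n"
  proof -
    have "(\<Sum>m<n. if fund R n i m \<noteq> 0 then 1 else 0) = real (Suc i)" if "i < n" for i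
    proof -
      have "(\<Sum>m<n. if fund R n i m \<noteq> 0 then 1 else 0) = (\<Sum>m<n. if m < Suc i then 1 else 0 :: real)"
        using that R by (intro sum.cong refl) (cases "Suc i = n"; auto simp: fund_def split: if_splits)
      then show ?thesis using that by (simp only: sum_indicator_less)
    qed
    then show ?thesis using nonzero lt R by auto
  qed
  show ?thesis
  proof (cases R)
    case A_type
    have "(\<Sum>m<n. if fund R n i m > 0 then 1 else 0) = real (Suc i)" if "i < n - 1" for i
    proof -
      have "(\<Sum>m<n. if fund R n i m > 0 then 1 else 0) = (\<Sum>m<n. if m < Suc i then 1 else 0 :: real)"
        using that by (intro sum.cong refl) (auto simp: A_type fund_def field_simps)
      then show ?thesis using that by (simp only: sum_indicator_less)
    qed
    then show ?thesis using inv[of "\<lambda>x. if x > 0 then 1 else 0"] assms(4,5) by (simp add: A_type)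
  next
    case B_type
    then show ?thesis using BC assms(4,5) by simp
  next
    case C_type
    then show ?thesis using BC assms(4,5) by simp
  next
    case D_type
    then have n: "n \<ge> 4" using assms(1) by (simp add: valid_type_def)
    have count: "(\<Sum>m<n. if fund R n i m \<noteq> 0 then 1 else 0) = (if i < n - 2 then real (Suc i) else real n)" if "i < n" for i
    proof -
      have "(\<Sum>m<n. if fund R n i m \<noteq> 0 then 1 else 0) =
          (\<Sum>m<n. if m < (if i < n - 2 then Suc i else n) then 1 else 0 :: real)"
        using that n by (intro sum.cong refl) (auto simp: D_type fund_def)
      also have "\<dots> = real (if i < n - 2 then Suc i else n)"
        using that by (intro sum_indicator_less) auto
      finally show ?thesis by simp
    qed
    have prods: "(\<Prod>m<n. fund R n j m) = (\<Prod>m<n. fund R n j' m)"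
    proof -
      have "(\<Prod>m<n. weyl_act p S (fund R n j) m) = (\<Prod>m<n. weyl_act p' S' (fund R n j') m)"
        using eq by (intro prod.cong) auto
      then show ?thesis
        unfolding prod_weyl_act_invariant[OF assms(2)[unfolded D_type]] prod_weyl_act_invariant[OF assms(3)[unfolded D_type]] .
    qed
    have p1: "(\<Prod>m<n. fund R n (n - 1) m) > 0"
      using n by (intro prod_pos) (simp add: D_type fund_def)
    have p2: "(\<Prod>m<n. fund R n (n - 2) m) < 0"
    proof -
      define l where "l = n - 1"
      have l: "n = Suc l" "l \<ge> 3" using n by (auto simp: l_def)
      have "(\<Prod>m<l. fund R n (n - 2) m) > 0"
        by (intro prod_pos) (use l in \<open>simp add: D_type fund_def\<close>)
      moreover have "fund R n (n - 2) l < 0" using l by (simp add: D_type fund_def)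
      ultimately show ?thesis
        using mult_pos_neg by (simp add: l)
    qed
    have lt: "j < n" "j' < n" using assms(4,5) by (simp_all add: D_type)
    have c: "(if j < n - 2 then Suc j else n) = (if j' < n - 2 then Suc j' else n)"
      using nonzero count[OF lt(1)] count[OF lt(2)] D_type by (simp split: if_splits)
    show ?thesis
    proof (cases "j < n - 2")
      case True
      then show ?thesis using c lt by (simp split: if_splits)
    next
      case False
      then have "j' \<ge> n - 2" using c by (auto split: if_splits)
      then have "j = n - 2 \<or> j = n - 1" "j' = n - 2 \<or> j' = n - 1" using lt False by auto
      then show ?thesis using prods p1 p2 by auto
    qed
  next
    case G2_type
    then have "n = 3" using assms(1) by (simp add: valid_type_def)
    then show ?thesis
      using inv[of "\<lambda>x. x\<^sup>2"] assms(4,5)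
      by (auto simp: G2_type fund_def vec_of_list_index less_Suc_eq numeral_3_eq_3 nth_Cons')
  qed
qed

lemma conj_perm_eqI:
  assumes "valid_type R n" "(p, S) \<in> weyl_params R n" "i < root_rank R n" "j < root_rank R n"
    and "\<And>m. m < n \<Longrightarrow> weyl_act p S (fund R n j) m = - fund R n i m"
  shows "conj_perm R n i = j"
  unfolding conj_perm_def
proof (rule the_equality)
  show "j < root_rank R n \<and> (\<exists>B \<in> int_rep R n. - unit_vec (root_rank R n) i = B *\<^sub>v unit_vec (root_rank R n) j)"
    unfolding int_rep_eq[OF assms(1)] using assms neg_unit_vec_eq_iff[OF assms(1-4)] by blast
next
  fix j' assume "j' < root_rank R n \<and> (\<exists>B \<in> int_rep R n. - unit_vec (root_rank R n) i = B *\<^sub>v unit_vec (root_rank R n) j')"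
  then obtain p' S' where j': "j' < root_rank R n" and ps': "(p', S') \<in> weyl_params R n"
    and "- unit_vec (root_rank R n) i = weyl_int_mat R n (p', S') *\<^sub>v unit_vec (root_rank R n) j'"
    unfolding int_rep_eq[OF assms(1)] by auto
  then have "\<forall>m<n. weyl_act p' S' (fund R n j') m = - fund R n i m"
    using neg_unit_vec_eq_iff[OF assms(1) ps' assms(3) j'] by simp
  then show "j' = j"
    using fund_eq_if_conjugate[OF assms(1) ps' assms(2) j' assms(4)] assms(5) by simp
qed

section \<open>Means over permutations and sign changes\<close>

lemma exists_permutes_image:
  assumes "J \<subseteq> {..<n}" "card J = i"
  shows "\<exists>q. q permutes {..<n} \<and> q ` {..<i} = J \<and> inj_on q {..<i}"
proof -
  have fin: "finite J" using assms(1) finite_subset by blast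
  have i: "i \<le> n" using card_mono[of "{..<n}" J] assms by simp
  obtain h where h: "bij_betw h {..<i} J"
    using finite_same_card_bij[of "{..<i}" J] fin assms(2) by auto
  have "card ({..<n} - {..<i}) = card ({..<n} - J)"
    using assms fin i by (simp add: card_Diff_subset)
  then obtain g where g: "bij_betw g ({..<n} - {..<i}) ({..<n} - J)"
    using finite_same_card_bij[of "{..<n} - {..<i}" "{..<n} - J"] by auto
  define q where "q x = (if x < i then h x else if x < n then g x else x)" for x
  have q1: "bij_betw q {..<i} J"
    using h by (rule bij_betw_cong[THEN iffD1, rotated]) (simp add: q_def)
  have q2: "bij_betw q ({..<n} - {..<i}) ({..<n} - J)"
    using g by (rule bij_betw_cong[THEN iffD1, rotated]) (auto simp: q_def)
  have "bij_betw q ({..<i} \<union> ({..<n} - {..<i})) (J \<union> ({..<n} - J))"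
    using q1 q2 by (rule bij_betw_combine) auto
  moreover have "{..<i} \<union> ({..<n} - {..<i}) = {..<n}" "J \<union> ({..<n} - J) = {..<n}"
    using i assms(1) by auto
  ultimately have "bij_betw q {..<n} {..<n}" by simp
  then have "q permutes {..<n}"
    using i by (intro bij_imp_permutes) (auto simp: q_def)
  then show ?thesis using q1 by (auto simp: bij_betw_def)
qed

lemma esym_eq_sum_subsets: "esym n w i = (\<Sum>J | J \<subseteq> {..<n} \<and> card J = i. \<Prod>j\<in>J. w j)"
proof -
  have monom: "(\<Prod>l\<in>X. [:0, w l:]) = monom (\<Prod>l\<in>X. w l) (card X)" if "finite X" for X
    using that by induction (simp_all add: monom_0 monom_Suc one_pCons smult_monom)
  have "(\<Prod>l<n. [:1, w l:]) = (\<Prod>l<n. [:0, w l:] + 1)"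
    by (simp add: one_pCons)
  also have "\<dots> = (\<Sum>X\<in>Pow {..<n}. monom (\<Prod>l\<in>X. w l) (card X))"
    by (subst prod_add) (auto intro!: sum.cong simp: monom[OF finite_subset])
  finally have "esym n w i = (\<Sum>X\<in>Pow {..<n}. if card X = i then \<Prod>l\<in>X. w l else 0)"
    by (simp add: esym_def coeff_sum)
  then show ?thesis by (simp flip: sum.inter_filter)
qed

lemma esym_permutes: "p permutes {..<n} \<Longrightarrow> esym n (\<lambda>j. w (p j)) i = esym n w i"
  unfolding esym_def using prod.permute[of p "{..<n}" "\<lambda>l. [:1, w l:]"] by (simp add: o_def)

text \<open>Double counting: composing on the right with a permutation that maps {..<i} onto
  \<open>J\<close> shows that every i-subset \<open>J\<close> gives the same sum, and summing over
  all \<open>J\<close> gives n! times the elementary symmetric function.\<close>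

lemma sum_permutations_prod:
  fixes f :: "nat \<Rightarrow> complex"
  assumes "i \<le> n"
  shows "(\<Sum>p | p permutes {..<n}. \<Prod>j<i. f (p j)) / fact n = esym n f i / of_nat (n choose i)"
proof -
  let ?A = "\<Sum>p | p permutes {..<n}. \<Prod>j<i. f (p j)"
  have "(\<Sum>p | p permutes {..<n}. \<Prod>j\<in>J. f (p j)) = ?A" if J: "J \<subseteq> {..<n}" "card J = i" for J
  proof -
    obtain q where q: "q permutes {..<n}" "q ` {..<i} = J" "inj_on q {..<i}"
      using exists_permutes_image[OF J] by blast
    have "?A = (\<Sum>p | p permutes {..<n}. \<Prod>j<i. f ((p \<circ> q) j))"
      by (rule sum_permutations_compose_right[OF q(1)])
    also have "\<dots> = (\<Sum>p | p permutes {..<n}. \<Prod>j\<in>J. f (p j))"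
      by (simp add: q(2)[symmetric] prod.reindex[OF q(3)])
    finally show ?thesis ..
  qed
  then have "(\<Sum>J | J \<subseteq> {..<n} \<and> card J = i. \<Sum>p | p permutes {..<n}. \<Prod>j\<in>J. f (p j)) = of_nat (n choose i) * ?A"
    using n_subsets[of "{..<n}" i] by simp
  moreover have "(\<Sum>J | J \<subseteq> {..<n} \<and> card J = i. \<Sum>p | p permutes {..<n}. \<Prod>j\<in>J. f (p j)) =
      (\<Sum>p | p permutes {..<n}. esym n (\<lambda>j. f (p j)) i)"
    unfolding esym_eq_sum_subsets by (rule sum.swap)
  moreover have "\<dots> = fact n * esym n f i"
    using card_permutations[of "{..<n}" n] by (simp add: esym_permutes)
  ultimately have "of_nat (n choose i) * ?A = fact n * esym n f i" by simp
  moreover have "of_nat (n choose i) \<noteq> (0 :: complex)" using assms by simp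
  ultimately show ?thesis by (simp add: field_simps)
qed

lemma sum_permutations_apply:
  fixes f :: "nat \<Rightarrow> complex"
  assumes "0 < n"
  shows "(\<Sum>p | p permutes {..<n}. f (p 0)) / fact n = (\<Sum>l<n. f l) / of_nat n"
proof -
  have "esym n f 1 = (\<Sum>l<n. f l)"
    using newton_identity[of 0 n f] by simp
  then show ?thesis
    using sum_permutations_prod[of 1 n f] assms by simp
qed

lemma exp_signed_sum:
  assumes "S \<subseteq> {..<n}"
  shows "exp (\<Sum>j<n. of_real (set_sign S j) * a j) = (\<Prod>j\<in>S. exp (- a j)) * (\<Prod>j\<in>{..<n} - S. exp (a j) :: complex)"
proof -
  have "exp (\<Sum>j<n. of_real (set_sign S j) * a j) = (\<Prod>j<n. exp (of_real (set_sign S j) * a j))"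
    by (simp add: exp_sum)
  also have "\<dots> = (\<Prod>j\<in>{..<n} - S. exp (of_real (set_sign S j) * a j)) * (\<Prod>j\<in>S. exp (of_real (set_sign S j) * a j))"
    using assms by (intro prod.subset_diff) auto
  also have "(\<Prod>j\<in>{..<n} - S. exp (of_real (set_sign S j) * a j)) = (\<Prod>j\<in>{..<n} - S. exp (a j))"
    by (intro prod.cong refl) (simp add: set_sign_def)
  also have "(\<Prod>j\<in>S. exp (of_real (set_sign S j) * a j)) = (\<Prod>j\<in>S. exp (- a j))"
    by (intro prod.cong refl) (simp add: set_sign_def)
  finally show ?thesis by (simp only: mult.commute)
qed

lemma sum_signs_exp:
  fixes a :: "nat \<Rightarrow> complex"
  shows "(\<Sum>S\<in>Pow {..<n}. exp (\<Sum>j<n. of_real (set_sign S j) * a j)) = 2 ^ n * (\<Prod>j<n. cosh (a j))"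
proof -
  have "(\<Sum>S\<in>Pow {..<n}. exp (\<Sum>j<n. of_real (set_sign S j) * a j)) = (\<Prod>j<n. exp (- a j) + exp (a j))"
    by (subst prod_add) (auto intro!: sum.cong simp: exp_signed_sum)
  also have "\<dots> = (\<Prod>j<n. 2 * cosh (a j))"
    by (intro prod.cong refl) (simp add: cosh_field_def)
  finally show ?thesis by (simp add: prod.distrib)
qed

text \<open>Weighting with the sign character puts a minus before each exp(- a_j), so cosh becomes
  sinh. Averaged with \<open>sum_signs_exp\<close>, this selects the even sign changes of type
  D.\<close>

lemma sum_signs_alternating_exp:
  fixes a :: "nat \<Rightarrow> complex"
  shows "(\<Sum>S\<in>Pow {..<n}. (- 1) ^ card S * exp (\<Sum>j<n. of_real (set_sign S j) * a j)) = 2 ^ n * (\<Prod>j<n. sinh (a j))"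
proof -
  have *: "(\<Prod>j\<in>S. - exp (- a j)) = (- 1) ^ card S * (\<Prod>j\<in>S. exp (- a j))" for S
    using prod.distrib[of "\<lambda>_. - 1" "\<lambda>j. exp (- a j)" S] by simp
  have "(\<Sum>S\<in>Pow {..<n}. (- 1) ^ card S * exp (\<Sum>j<n. of_real (set_sign S j) * a j)) =
      (\<Prod>j<n. - exp (- a j) + exp (a j))"
    by (subst prod_add) (auto intro!: sum.cong simp: exp_signed_sum *)
  also have "\<dots> = (\<Prod>j<n. 2 * sinh (a j))"
    by (intro prod.cong refl) (simp add: sinh_field_def)
  finally show ?thesis by (simp add: prod.distrib)
qed

lemma sum_even_sets:
  fixes g :: "nat set \<Rightarrow> complex"
  shows "(\<Sum>S | S \<subseteq> {..<n} \<and> even (card S). g S) =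
    ((\<Sum>S\<in>Pow {..<n}. g S) + (\<Sum>S\<in>Pow {..<n}. (- 1) ^ card S * g S)) / 2"
proof -
  have "{S. S \<subseteq> {..<n} \<and> even (card S)} = {S \<in> Pow {..<n}. even (card S)}" by auto
  then have "(\<Sum>S | S \<subseteq> {..<n} \<and> even (card S). g S) = (\<Sum>S\<in>Pow {..<n}. if even (card S) then g S else 0)"
    by (simp only: sum.inter_filter finite_Pow_iff finite_lessThan)
  also have "\<dots> = (\<Sum>S\<in>Pow {..<n}. (g S + (- 1) ^ card S * g S) / 2)"
    by (intro sum.cong refl) auto
  finally show ?thesis unfolding sum_divide_distrib[symmetric] sum.distrib .
qed

text \<open>At a = 0 the alternating sum is a product of sinh(0), which vanishes because n > 0; so
  half of all subsets are even.\<close>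

lemma card_even_sets:
  assumes "0 < n"
  shows "of_nat (card {S. S \<subseteq> {..<n} \<and> even (card S)}) = (2 ^ n / 2 :: complex)"
  using sum_even_sets[of "\<lambda>_. 1" n] sum_signs_alternating_exp[of "\<lambda>_. 0" n] assms
  by (simp add: card_Pow)

lemma card_weyl_params: "card (weyl_params R n) = fact n * card (sign_sets R n)"
  using card_permutations[of "{..<n}" n] by (simp add: weyl_params_def card_cartesian_product)

lemma sum_weyl_params:
  "(\<Sum>(p, S) \<in> weyl_params R n. g p S) = (\<Sum>p | p permutes {..<n}. \<Sum>S \<in> sign_sets R n. g p S)"
  unfolding weyl_params_def by (rule sum.cartesian_product[symmetric])

lemma orbit_sum_BC:
  assumes "R = B_type \<or> R = C_type"
  shows "orbit_sum R n f v / of_nat (card (weyl_params R n)) =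
    (\<Sum>p | p permutes {..<n}. \<Prod>j<n. cosh (of_real (f j) * v (p j))) / fact n"
proof -
  have S: "sign_sets R n = Pow {..<n}" using assms by auto
  have "orbit_sum R n f v = (\<Sum>p | p permutes {..<n}. 2 ^ n * (\<Prod>j<n. cosh (of_real (f j) * v (p j))))"
    unfolding orbit_sum_def sum_weyl_params S by (simp only: of_real_mult mult.assoc sum_signs_exp)
  then show ?thesis
    by (simp add: card_weyl_params S card_Pow flip: sum_distrib_left)
qed

lemma orbit_sum_D:
  assumes "0 < n"
  shows "orbit_sum D_type n f v / of_nat (card (weyl_params D_type n)) =
    (\<Sum>p | p permutes {..<n}. (\<Prod>j<n. cosh (of_real (f j) * v (p j))) + (\<Prod>j<n. sinh (of_real (f j) * v (p j)))) / fact n"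
proof -
  have "orbit_sum D_type n f v = (\<Sum>p | p permutes {..<n}. (2 ^ n / 2) * 
      ((\<Prod>j<n. cosh (of_real (f j) * v (p j))) + (\<Prod>j<n. sinh (of_real (f j) * v (p j)))))"
    unfolding orbit_sum_def sum_weyl_params sign_sets.simps of_real_mult mult.assoc sum_even_sets sum_signs_exp
      sum_signs_alternating_exp by (intro sum.cong refl) (simp add: field_simps)
  then have eq: "orbit_sum D_type n f v = (2 ^ n / 2) * (\<Sum>p | p permutes {..<n}. 
      (\<Prod>j<n. cosh (of_real (f j) * v (p j))) + (\<Prod>j<n. sinh (of_real (f j) * v (p j))))"
    by (simp only: sum_distrib_left)
  have card: "of_nat (card (weyl_params D_type n)) = fact n * (2 ^ n / 2 :: complex)"
    using card_even_sets[OF assms] by (simp add: card_weyl_params)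
  show ?thesis unfolding eq card by simp
qed

lemma sum_permutations_const:
  assumes "\<And>p. p permutes {..<n} \<Longrightarrow> g p = C"
  shows "(\<Sum>p | p permutes {..<n}. g p) / fact n = (C :: complex)"
proof -
  have "(\<Sum>p | p permutes {..<n}. g p) = (\<Sum>p | p permutes {..<n}. C)"
    using assms by (intro sum.cong) auto
  then show ?thesis using card_permutations[of "{..<n}" n] by simp
qed

lemma orbit_sum_A:
  "orbit_sum A_type n f v / of_nat (card (weyl_params A_type n)) =
    (\<Sum>p | p permutes {..<n}. exp (\<Sum>j<n. of_real (f j) * v (p j))) / fact n"
  unfolding orbit_sum_def sum_weyl_params by (simp add: card_weyl_params set_sign_def)

text \<open>Here \<omega>_1 is \<epsilon>_1, up to a constant vector in type A which pairs to 0 with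
  \<open>v\<close>. Its orbit therefore pairs with \<open>v\<close> to the values \<plusminus>v_l,
  and cosh is even. In type G2 the first weight has two nonzero coordinates.\<close>

lemma real_cheb_value_classical:
  assumes "valid_type R n" "R \<noteq> G2_type" "R = A_type \<Longrightarrow> (\<Sum>j<n. v j) = 0"
  shows "real_cheb_value R n k (exp_point R n v) = (\<Sum>l<n. cheb k (cosh (v l))) / of_nat n"
proof -
  have n: "0 < n" using assms(1) by (auto simp: valid_type_def)
  have "cosh (\<Sum>j<n. of_real (set_sign S j * fund R n 0 j) * v (p j)) = cosh (v (p 0))"
    if ps: "(p, S) \<in> weyl_params R n" for p S
  proof -
    have p: "p permutes {..<n}" and S: "S \<in> sign_sets R n" using ps by (auto simp: weyl_params_def)
    show ?thesis
    proof (cases "R = A_type")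
      case True
      have "(\<Sum>j<n. v (p j)) = 0"
        using sum.permute[OF p, of v] assms(3)[OF True] by (simp add: o_def)
      moreover have "(\<Sum>j<n. of_real (set_sign S j * fund R n 0 j) * v (p j)) =
          (\<Sum>j<n. (if j = 0 then v (p 0) else 0) - 1 / of_nat n * v (p j))"
        using S by (intro sum.cong refl) (simp add: True fund_def set_sign_def left_diff_distrib)
      ultimately show ?thesis using n by (simp add: sum_subtractf flip: sum_distrib_left sum_divide_distrib)
    next
      case False
      have "(\<Sum>j<n. of_real (set_sign S j * fund R n 0 j) * v (p j)) =
          (\<Sum>j<n. if j = 0 then of_real (set_sign S 0) * v (p 0) else 0)"
        using False assms(1,2) by (intro sum.cong refl) (cases R; auto simp: fund_def valid_type_def)
      then show ?thesis using n by (simp add: set_sign_def)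
    qed
  qed
  then have "(\<Sum>(p, S) \<in> weyl_params R n. cheb k (cosh (\<Sum>j<n. of_real (set_sign S j * fund R n 0 j) * v (p j)))) =
      (\<Sum>(p, S) \<in> weyl_params R n. cheb k (cosh (v (p 0))))"
    by (intro sum.cong) auto
  also have "\<dots> = of_nat (card (sign_sets R n)) * (\<Sum>p | p permutes {..<n}. cheb k (cosh (v (p 0))))"
    unfolding sum_weyl_params by (simp add: sum_distrib_left)
  finally have "real_cheb_value R n k (exp_point R n v) = (\<Sum>p | p permutes {..<n}. cheb k (cosh (v (p 0)))) / fact n"
    using finite_sign_sets[of R n] sign_sets_nonempty[of R n]
    by (simp add: real_cheb_value_exp_point[OF assms(1)] card_weyl_params)
  then show ?thesis
    using sum_permutations_apply[OF n, of "\<lambda>l. cheb k (cosh (v l))"] by simp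
qed

lemma prod_lessThan_If:
  fixes i n :: nat
  assumes "i \<le> n"
  shows "(\<Prod>j<n. if j < i then f j else 1) = (\<Prod>j<i. f j)"
proof -
  have "{j. j < n \<and> j < i} = {..<i}" using assms by auto
  then show ?thesis by (simp flip: prod.inter_filter)
qed

lemma fund_orbit_poly_BCD_esym:
  assumes "valid_type R n" "(R = B_type \<and> Suc i < n) \<or> (R = C_type \<and> i < n) \<or> (R = D_type \<and> i < n - 2)"
  shows "fund_orbit_poly R n i (exp_point R n v) = esym n (\<lambda>l. cosh (v l)) (Suc i) / of_nat (n choose Suc i)"
proof -
  have i: "i < root_rank R n" "Suc i \<le> n" using assms by auto
  have fund: "fund R n i j = (if j < Suc i then 1 else 0)" if "j < n" for j
    using assms(2) that by (auto simp: fund_def)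
  have "(\<Prod>j<n. cosh (of_real (fund R n i j) * v (p j))) = (\<Prod>j<Suc i. cosh (v (p j)))" for p
  proof -
    have "(\<Prod>j<n. cosh (of_real (fund R n i j) * v (p j))) = (\<Prod>j<n. if j < Suc i then cosh (v (p j)) else 1)"
      by (intro prod.cong refl) (simp add: fund)
    then show ?thesis by (simp only: prod_lessThan_If[OF i(2)])
  qed
  \<comment> \<open>Away from the half-spin weights the last coordinate is 0, so the type D
    correction contains a factor sinh(0).\<close>
  moreover have "(\<Prod>j<n. sinh (of_real (fund R n i j) * v (p j))) = 0" if "R = D_type" for p
  proof -
    have *: "n - 1 < n" "\<not> n - 1 < Suc i" using assms(2) that by auto
    have "fund R n i (n - 1) = 0" using fund[OF *(1)] *(2) by simp
    with * show ?thesis by (intro prod_zero bexI[of _ "n - 1"]) auto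
  qed
  moreover have "0 < n" using i(2) by simp
  ultimately have "orbit_sum R n (fund R n i) v / of_nat (card (weyl_params R n)) =
      (\<Sum>p | p permutes {..<n}. \<Prod>j<Suc i. cosh (v (p j))) / fact n"
    using assms(2) orbit_sum_BC[of R n "fund R n i" v] orbit_sum_D[of n "fund R n i" v]
    by (elim disjE conjE) (simp_all only: simp_thms add_0_right)
  then show ?thesis
    unfolding fund_orbit_poly_exp_point[OF assms(1) i(1)] sum_permutations_prod[OF i(2), symmetric] .
qed

lemma fund_orbit_poly_B_last:
  assumes "valid_type B_type n"
  shows "fund_orbit_poly B_type n (n - 1) (exp_point B_type n v) = (\<Prod>l<n. cosh (v l / 2))"
proof -
  have n: "n - 1 < root_rank B_type n" "Suc (n - 1) = n" using assms by (auto simp: valid_type_def)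
  have "(\<Prod>j<n. cosh (of_real (fund B_type n (n - 1) j) * v (p j))) = (\<Prod>l<n. cosh (v l / 2))"
    if "p permutes {..<n}" for p
    using n prod.permute[OF that, of "\<lambda>l. cosh (v l / 2)"] by (simp add: fund_def o_def)
  then show ?thesis
    unfolding fund_orbit_poly_exp_point[OF assms n(1)]
    using card_permutations[of "{..<n}" n] by (subst orbit_sum_BC) simp_all
qed

text \<open>All coordinates are \<plusminus>1/2, so every permutation contributes the same. The even
  factor cosh ignores the sign of the last coordinate of \<omega>_(n-1), zero-based index
  \<open>n - 2\<close>, and the odd factor sinh produces the minus.\<close>

lemma fund_orbit_poly_D_spin:
  assumes "valid_type D_type n"
  shows "fund_orbit_poly D_type n (n - 1) (exp_point D_type n v) = (\<Prod>l<n. cosh (v l / 2)) + (\<Prod>l<n. sinh (v l / 2))"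
    and "fund_orbit_poly D_type n (n - 2) (exp_point D_type n v) = (\<Prod>l<n. cosh (v l / 2)) - (\<Prod>l<n. sinh (v l / 2))"
proof -
  obtain m where m: "n = Suc m" "m \<ge> 3" using assms by (cases n) (auto simp: valid_type_def)
  have n: "0 < n" "n - 1 < root_rank D_type n" "n - 2 < root_rank D_type n" using m by auto
  have perm: "(\<Prod>j<n. cosh (v (p j) / 2)) = (\<Prod>l<n. cosh (v l / 2))" "(\<Prod>j<n. sinh (v (p j) / 2)) = (\<Prod>l<n. sinh (v l / 2))"
    if "p permutes {..<n}" for p
    using prod.permute[OF that, of "\<lambda>l. cosh (v l / 2)"] prod.permute[OF that, of "\<lambda>l. sinh (v l / 2)"]
    by (simp_all add: o_def)
  have fund1: "fund D_type n (n - 1) j = 1 / 2" if "j < n" for j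
    using that m by (simp add: fund_def)
  have fund2: "fund D_type n (n - 2) j = (if j = m then - 1 / 2 else 1 / 2)" if "j < n" for j
    using that m by (auto simp: fund_def)
  show "fund_orbit_poly D_type n (n - 1) (exp_point D_type n v) = (\<Prod>l<n. cosh (v l / 2)) + (\<Prod>l<n. sinh (v l / 2))"
    unfolding fund_orbit_poly_exp_point[OF assms n(2)] orbit_sum_D[OF n(1)]
  proof (rule sum_permutations_const)
    fix p assume p: "p permutes {..<n}"
    show "(\<Prod>j<n. cosh (of_real (fund D_type n (n - 1) j) * v (p j))) + (\<Prod>j<n. sinh (of_real (fund D_type n (n - 1) j) * v (p j))) =
        (\<Prod>l<n. cosh (v l / 2)) + (\<Prod>l<n. sinh (v l / 2))"
      unfolding perm[OF p, symmetric]
      by (intro arg_cong2[where f = "(+)"] prod.cong refl) (simp_all add: fund1 del: One_nat_def)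
  qed
  show "fund_orbit_poly D_type n (n - 2) (exp_point D_type n v) = (\<Prod>l<n. cosh (v l / 2)) - (\<Prod>l<n. sinh (v l / 2))"
    unfolding fund_orbit_poly_exp_point[OF assms n(3)] orbit_sum_D[OF n(1)]
  proof (rule sum_permutations_const)
    fix p assume p: "p permutes {..<n}"
    have "(\<Prod>j<n. cosh (of_real (fund D_type n (n - 2) j) * v (p j))) = (\<Prod>j<n. cosh (v (p j) / 2))"
      by (intro prod.cong refl) (simp add: fund2)
    moreover have "(\<Prod>j<n. sinh (of_real (fund D_type n (n - 2) j) * v (p j))) =
        (\<Prod>j<n. (if j = m then - 1 else 1) * sinh (v (p j) / 2))"
      by (intro prod.cong refl) (simp add: fund2)
    moreover have "\<dots> = - (\<Prod>j<n. sinh (v (p j) / 2))"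
      using m by (simp add: prod.distrib)
    ultimately show "(\<Prod>j<n. cosh (of_real (fund D_type n (n - 2) j) * v (p j))) + (\<Prod>j<n. sinh (of_real (fund D_type n (n - 2) j) * v (p j))) =
        (\<Prod>l<n. cosh (v l / 2)) - (\<Prod>l<n. sinh (v l / 2))"
      by (simp only: perm[OF p] diff_conv_add_uminus)
  qed
qed

lemma fund_orbit_poly_A:
  assumes "valid_type A_type n" "Suc i < n" "(\<Sum>j<n. v j) = 0"
  shows "fund_orbit_poly A_type n i (exp_point A_type n v) = esym n (\<lambda>l. exp (v l)) (Suc i) / of_nat (n choose Suc i)"
proof -
  have i: "i < root_rank A_type n" "Suc i \<le> n" using assms by auto
  have "exp (\<Sum>j<n. of_real (fund A_type n i j) * v (p j)) = (\<Prod>j<Suc i. exp (v (p j)))"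
    if p: "p permutes {..<n}" for p
  proof -
    have 0: "(\<Sum>j<n. v (p j)) = 0" using sum.permute[OF p, of v] assms(3) by (simp add: o_def)
    have "(\<Sum>j<n. of_real (fund A_type n i j) * v (p j)) =
        (\<Sum>j<n. (if j < Suc i then v (p j) else 0) - of_real (real (Suc i) / real n) * v (p j))"
      by (intro sum.cong refl) (simp add: fund_def left_diff_distrib)
    also have "\<dots> = (\<Sum>j<n. if j < Suc i then v (p j) else 0)"
      unfolding sum_subtractf sum_distrib_left[symmetric] 0 by simp
    finally have "exp (\<Sum>j<n. of_real (fund A_type n i j) * v (p j)) = (\<Prod>j<n. if j < Suc i then exp (v (p j)) else 1)"
      by (simp add: exp_sum if_distrib[of exp] cong: if_cong)
    then show ?thesis by (simp only: prod_lessThan_If[OF i(2)])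
  qed
  then show ?thesis
    unfolding fund_orbit_poly_exp_point[OF assms(1) i(1)] sum_permutations_prod[OF i(2), symmetric] orbit_sum_A by simp
qed

subsection \<open>Types B, C and D\<close>

lemma real_fund_orbit_poly_self:
  "conj_perm R n i = i \<Longrightarrow> real_fund_orbit_poly R n i x = fund_orbit_poly R n i x"
  by (simp add: real_fund_orbit_poly_def)

lemma weyl_act_id: "weyl_act id S f m = set_sign S m * f m"
  by (simp add: weyl_act_def)

text \<open>Changing all signs is then in the group, and it maps every weight to its
  negative.\<close>

lemma conj_perm_self:
  assumes "valid_type R n" "i < root_rank R n" "{..<n} \<in> sign_sets R n"
  shows "conj_perm R n i = i"
proof (rule conj_perm_eqI[OF assms(1) _ assms(2,2)])
  show "(id, {..<n}) \<in> weyl_params R n" using assms(3) by (simp add: weyl_params_def permutes_id)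
qed (simp add: weyl_act_id set_sign_def)

lemma conj_perm_D:
  assumes "valid_type D_type n" "i < n - 2"
  shows "conj_perm D_type n i = i"
proof -
  \<comment> \<open>The first i + 1 coordinates are negated; if their number is odd, the sign of one
    more coordinate, which is 0, is changed to make the parity even.\<close>
  define S where "S = {..<if even (Suc i) then Suc i else Suc (Suc i)}"
  have S: "(id, S) \<in> weyl_params D_type n"
    using assms(2) by (auto simp: weyl_params_def S_def permutes_id)
  show ?thesis
  proof (rule conj_perm_eqI[OF assms(1) S])
    fix m assume "m < n"
    then show "weyl_act id S (fund D_type n i) m = - fund D_type n i m"
      using assms(2) by (auto simp: weyl_act_id set_sign_def S_def fund_def)
  qed (use assms in auto)
qed

lemma conj_perm_D_odd:
  assumes "valid_type D_type n" "odd n"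
  shows "conj_perm D_type n (n - 1) = n - 2" "conj_perm D_type n (n - 2) = n - 1"
proof -
  obtain m where m: "n = Suc m" "m \<ge> 3" using assms(1) by (cases n) (auto simp: valid_type_def)
  \<comment> \<open>\<open>m = n - 1\<close> is even, so all signs but the last may be changed; this
    maps each half-spin weight to the negative of the other.\<close>
  have S: "(id, {..<m}) \<in> weyl_params D_type n"
    using assms(2) m by (auto simp: weyl_params_def permutes_id)
  have act: "weyl_act id {..<m} (fund D_type n (n - 2)) k = - fund D_type n (n - 1) k" 
    "weyl_act id {..<m} (fund D_type n (n - 1)) k = - fund D_type n (n - 2) k" if "k < n" for k
    using that m by (auto simp: weyl_act_id set_sign_def fund_def)
  show "conj_perm D_type n (n - 1) = n - 2"
    by (rule conj_perm_eqI[OF assms(1) S]) (use m act in auto)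
  show "conj_perm D_type n (n - 2) = n - 1"
    by (rule conj_perm_eqI[OF assms(1) S]) (use m act in auto)
qed

section \<open>Prescribing hyperbolic cosines and half-angle products\<close>

lemma cosh_surj: "\<exists>v. cosh v = c" for c :: complex
proof -
  define s where "s = csqrt (c\<^sup>2 - 1)"
  have s: "(c + s) * (c - s) = 1"
    by (simp add: s_def square_diff_square_factored[symmetric] flip: power2_eq_square)
  then have nz: "c + s \<noteq> 0" by auto
  obtain v where "exp v = c + s" using exists_complex_log[OF nz] by blast
  moreover have "inverse (c + s) = c - s" using s nz by (simp add: inverse_unique)
  ultimately show ?thesis by (intro exI[of _ v]) (simp add: cosh_joukowski)
qed

lemma cosh_add_ipi: "cosh (w + \<i> * of_real pi) = - cosh w" "sinh (w + \<i> * of_real pi) = - sinh w"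
proof -
  have "exp (\<i> * of_real pi) = - 1" by (simp add: exp_pi_i')
  then show "cosh (w + \<i> * of_real pi) = - cosh w" "sinh (w + \<i> * of_real pi) = - sinh w"
    by (simp_all add: cosh_field_def sinh_field_def exp_add exp_diff exp_minus field_simps)
qed

lemma one_plus_cosh: "1 + cosh w = 2 * (cosh (w / 2))\<^sup>2" for w :: complex
  using cosh_double[of "w / 2"] cosh_square_eq[of "w / 2"] by (simp add: algebra_simps)

lemma one_minus_cosh: "1 - cosh w = - 2 * (sinh (w / 2))\<^sup>2" for w :: complex
  using cosh_double[of "w / 2"] cosh_square_eq[of "w / 2"] by (simp add: algebra_simps)

text \<open>The value cosh(v_0) leaves v_0 free up to sign and multiples of 2 \<pi> \<i>. Adding 2
  \<pi> \<i> flips both half-angle products, negating v_0 flips only the sinh product; together they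
  reach all four sign choices.\<close>

lemma adjust_half_signs:
  fixes v :: "nat \<Rightarrow> complex"
  assumes "0 < n" "(\<Prod>l<n. cosh (v l / 2))\<^sup>2 = a\<^sup>2" "(\<Prod>l<n. sinh (v l / 2))\<^sup>2 = b\<^sup>2"
  shows "\<exists>v'. (\<forall>l. cosh (v' l) = cosh (v l)) \<and> (\<Prod>l<n. cosh (v' l / 2)) = a \<and> (\<Prod>l<n. sinh (v' l / 2)) = b"
proof -
  obtain m where m: "n = Suc m" using assms(1) by (cases n) auto
  have flip_both: "(\<forall>l. cosh ((u(0 := u 0 + \<i> * of_real (2 * pi))) l) = cosh (u l)) \<and>
      (\<Prod>l<n. cosh ((u(0 := u 0 + \<i> * of_real (2 * pi))) l / 2)) = - (\<Prod>l<n. cosh (u l / 2)) \<and>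
      (\<Prod>l<n. sinh ((u(0 := u 0 + \<i> * of_real (2 * pi))) l / 2)) = - (\<Prod>l<n. sinh (u l / 2))" for u :: "nat \<Rightarrow> complex"
  proof -
    have "u 0 + \<i> * of_real (2 * pi) = u 0 + \<i> * of_real pi + \<i> * of_real pi" by simp
    then have "cosh (u 0 + \<i> * of_real (2 * pi)) = cosh (u 0)" by (simp only: cosh_add_ipi minus_minus)
    moreover have "(u 0 + \<i> * of_real (2 * pi)) / 2 = u 0 / 2 + \<i> * of_real pi" by simp
    then have "cosh ((u 0 + \<i> * of_real (2 * pi)) / 2) = - cosh (u 0 / 2)"
      "sinh ((u 0 + \<i> * of_real (2 * pi)) / 2) = - sinh (u 0 / 2)" by (simp_all only: cosh_add_ipi)
    ultimately show ?thesis
      unfolding m prod.lessThan_Suc_shift by (simp del: of_real_mult)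
  qed
  have flip_sinh: "(\<forall>l. cosh ((u(0 := - u 0)) l) = cosh (u l)) \<and>
      (\<Prod>l<n. cosh ((u(0 := - u 0)) l / 2)) = (\<Prod>l<n. cosh (u l / 2)) \<and>
      (\<Prod>l<n. sinh ((u(0 := - u 0)) l / 2)) = - (\<Prod>l<n. sinh (u l / 2))" for u :: "nat \<Rightarrow> complex"
    unfolding m prod.lessThan_Suc_shift by simp
  have "\<exists>u. (\<forall>l. cosh (u l) = cosh (v l)) \<and> (\<Prod>l<n. cosh (u l / 2)) = a \<and> (\<Prod>l<n. sinh (u l / 2))\<^sup>2 = b\<^sup>2"
  proof (cases "(\<Prod>l<n. cosh (v l / 2)) = a")
    case True
    then show ?thesis using assms(3) by blast
  next
    case False
    then have "(\<Prod>l<n. cosh (v l / 2)) = - a" using assms(2) by (simp add: power2_eq_iff)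
    then show ?thesis using flip_both[of v] assms(3)
      by (intro exI[of _ "v(0 := v 0 + \<i> * of_real (2 * pi))"]) (simp only: minus_minus power2_minus simp_thms)
  qed
  then obtain u where u: "\<And>l. cosh (u l) = cosh (v l)" "(\<Prod>l<n. cosh (u l / 2)) = a" "(\<Prod>l<n. sinh (u l / 2))\<^sup>2 = b\<^sup>2"
    by blast
  show ?thesis
  proof (cases "(\<Prod>l<n. sinh (u l / 2)) = b")
    case True
    then show ?thesis using u by blast
  next
    case False
    then have "(\<Prod>l<n. sinh (u l / 2)) = - b" using u(3) by (simp add: power2_eq_iff)
    then show ?thesis using flip_sinh[of u] u
      by (intro exI[of _ "u(0 := - u 0)"]) (simp only: minus_minus simp_thms)
  qed
qed

lemma esym_cosh_surj:
  assumes "e 0 = (1 :: complex)"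
  shows "\<exists>v. \<forall>i\<le>n. esym n (\<lambda>l. cosh (v l)) i = e i"
proof -
  obtain w where w: "\<forall>i\<le>n. esym n w i = e i" using esym_surj[of e n] assms by blast
  have "\<exists>v. \<forall>l. cosh (v l) = w l" by (intro choice allI cosh_surj)
  then obtain v where "\<And>l. cosh (v l) = w l" by blast
  then show ?thesis using w by (intro exI[of _ v]) simp
qed

text \<open>The generating polynomial at t = 1 and t = -1, with the half-angle formulas. These
  relations link the spin weights to the elementary symmetric functions that no single \<theta>_i
  provides.\<close>

lemma esym_sum_cosh:
  "(\<Sum>i\<le>n. esym n (\<lambda>l. cosh (v l)) i) = 2 ^ n * (\<Prod>l<n. cosh (v l / 2))\<^sup>2"
  "(\<Sum>i\<le>n. (- 1) ^ i * esym n (\<lambda>l. cosh (v l)) i) = (- 2) ^ n * (\<Prod>l<n. sinh (v l / 2))\<^sup>2"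
  for v :: "nat \<Rightarrow> complex"
proof -
  have "(\<Sum>i\<le>n. esym n (\<lambda>l. cosh (v l)) i) = (\<Prod>l<n. 1 + cosh (v l))"
    using prod_eq_sum_esym[where t = 1 and n = n and w = "\<lambda>l. cosh (v l)"] by simp
  then show "(\<Sum>i\<le>n. esym n (\<lambda>l. cosh (v l)) i) = 2 ^ n * (\<Prod>l<n. cosh (v l / 2))\<^sup>2"
    by (simp add: one_plus_cosh prod.distrib prod_power_distrib)
  have "(\<Sum>i\<le>n. (- 1) ^ i * esym n (\<lambda>l. cosh (v l)) i) = (\<Prod>l<n. 1 - cosh (v l))"
    using prod_eq_sum_esym[where t = "- 1" and n = n and w = "\<lambda>l. cosh (v l)"] by (simp add: mult.commute)
  also have "\<dots> = (- 2) ^ n * (\<Prod>l<n. sinh (v l / 2))\<^sup>2"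
    by (simp only: one_minus_cosh prod.distrib prod_constant card_lessThan prod_power_distrib)
  finally show "(\<Sum>i\<le>n. (- 1) ^ i * esym n (\<lambda>l. cosh (v l)) i) = (- 2) ^ n * (\<Prod>l<n. sinh (v l / 2))\<^sup>2" .
qed

lemma prod_Reals: "(\<And>i. i \<in> A \<Longrightarrow> f i \<in> \<real>) \<Longrightarrow> prod f A \<in> (\<real> :: complex set)"
  by (induction A rule: infinite_finite_induct) auto

lemma esym_Reals:
  assumes "\<And>l. l < n \<Longrightarrow> w l \<in> \<real>"
  shows "esym n w i \<in> (\<real> :: complex set)"
  unfolding esym_eq_sum_subsets using assms by (intro sum_in_Reals prod_Reals) auto

lemma cosh_Reals: "Re w = 0 \<Longrightarrow> cosh w \<in> \<real>" and sinh_ii_Reals: "Re w = 0 \<Longrightarrow> \<i> * sinh w \<in> \<real>"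
proof -
  assume "Re w = 0"
  then have "exp w = cis (Im w)" "exp (- w) = cis (- Im w)"
    by (simp_all add: exp_eq_polar)
  then have "cnj (cosh w) = cosh w" "cnj (\<i> * sinh w) = \<i> * sinh w"
    by (simp_all add: cosh_field_def sinh_field_def cis_cnj field_simps)
  then show "cosh w \<in> \<real>" "\<i> * sinh w \<in> \<real>" by (simp_all only: Reals_cnj_iff)
qed

lemma real_cheb_value_torus_Reals:
  assumes "\<And>l. l < n \<Longrightarrow> cmod (y l) = 1"
    and "real_cheb_value R n k x = (\<Sum>l<n. cheb k ((y l + inverse (y l)) / 2)) / of_nat n"
  shows "real_cheb_value R n k x = of_real (Re ((\<Sum>l<n. y l ^ k) / of_nat n))"
proof -
  have "cheb k ((y l + inverse (y l)) / 2) = of_real (Re (y l ^ k))" if "l < n" for l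
  proof -
    have y: "y l \<noteq> 0" using assms(1)[OF that] by auto
    have "inverse (y l) = cnj (y l)"
      using assms(1)[OF that] by (simp add: inverse_complex_def complex_eq_iff cmod_def)
    then have "inverse (y l) ^ k = cnj (y l ^ k)" by simp
    moreover have "(z + cnj z) / 2 = of_real (Re z)" for z by (simp add: complex_eq_iff)
    ultimately show ?thesis by (simp only: cheb_joukowski[OF y])
  qed
  then show ?thesis unfolding assms(2) by simp
qed

text \<open>\<open>P\<close> may have complex values, so its real part divided by n is used; on the
  torus the Chebyshev value is real and nothing is lost.\<close>

lemma cheb_poly_exists_of_esym:
  assumes "\<And>i. ratpoly_fun (root_rank R n) (E i)"
    and w: "\<And>x. x \<in> torus (root_rank R n) \<Longrightarrow> \<exists>w. (\<forall>i. esym n w i = E i (real_orbit_map R n x)) \<and>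
      real_cheb_value R n k x = (\<Sum>l<n. cheb k (w l)) / of_nat n \<and> real_cheb_value R n k x \<in> \<real>"
  shows "\<exists>p \<in> mpoly_ring (root_rank R n). \<forall>x \<in> torus (root_rank R n).
      of_real (mpoly_eval p (real_orbit_map R n x)) = real_cheb_value R n k x"
proof -
  let ?r = "root_rank R n"
  obtain P where P: "ratpoly_fun ?r P" "\<forall>z \<in> carrier_vec ?r. \<forall>w.
     (\<forall>i. esym n w i = E i z) \<longrightarrow> (\<Sum>l<n. w l ^ 0 * cheb k (w l)) = P z"
    using cheb_sum_ratpoly_fun[of ?r E n 0 k] assms(1) by blast
  have "ratpoly_fun ?r (\<lambda>z. of_rat (1 / of_nat n) * P z)"
    by (intro ratpoly_fun_intros P(1))
  then obtain p where p: "p \<in> mpoly_ring ?r" "\<forall>z \<in> carrier_vec ?r. mpoly_eval p z = Re (of_rat (1 / of_nat n) * P z)"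
    using ratpoly_fun_Re by blast
  have "of_real (mpoly_eval p (real_orbit_map R n x)) = real_cheb_value R n k x" if x: "x \<in> torus ?r" for x
  proof -
    obtain w where w: "\<forall>i. esym n w i = E i (real_orbit_map R n x)"
      "real_cheb_value R n k x = (\<Sum>l<n. cheb k (w l)) / of_nat n" "real_cheb_value R n k x \<in> \<real>"
      using w[OF x] by blast
    have z: "real_orbit_map R n x \<in> carrier_vec ?r" by (simp add: real_orbit_map_def)
    have "of_rat (1 / of_nat n) * P (real_orbit_map R n x) = real_cheb_value R n k x"
      using P(2) z w(1,2) by (simp add: of_rat_divide)
    then have "mpoly_eval p (real_orbit_map R n x) = Re (real_cheb_value R n k x)"
      using p(2) z by metis
    then show ?thesis using w(3) by simp
  qed
  then show ?thesis using p(1) by blast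
qed

lemma torus_exp_point:
  assumes "valid_type R n" "x \<in> torus (root_rank R n)"
  shows "\<exists>v. exp_point R n v = x \<and> (R = A_type \<longrightarrow> (\<Sum>j<n. v j) = 0) \<and> (\<forall>j. Re (v j) = 0)"
proof -
  have "x \<in> carrier_vec (root_rank R n)" "\<And>i. i < root_rank R n \<Longrightarrow> x $ i \<noteq> 0"
    using assms(2) by (force simp: torus_def)+
  then show ?thesis using exp_point_surj[OF assms(1)] assms(2) by blast
qed

text \<open>The functions \<open>b v\<close> are the logarithms of the \<open>y\<^sub>l\<close> at the point with exponential coordinates \<open>v\<close>.\<close>

lemma chebyshev_orbit_cosh:
  fixes b :: "(nat \<Rightarrow> complex) \<Rightarrow> nat \<Rightarrow> complex"
  assumes R: "valid_type R n" "R \<noteq> A_type"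
    and cheb_val: "\<And>k v. real_cheb_value R n k (exp_point R n v) = (\<Sum>l<n. cheb k (cosh (b v l))) / of_nat n"
    and b_Re: "\<And>v l. (\<And>j. Re (v j) = 0) \<Longrightarrow> Re (b v l) = 0"
    and b_torus: "\<And>v. (\<And>l. l < n \<Longrightarrow> Re (b v l) = 0) \<Longrightarrow> exp_point R n v \<in> torus (root_rank R n)"
    and E: "\<And>i. ratpoly_fun (root_rank R n) (\<lambda>z. e (\<lambda>j. of_real (z $ j)) i)"
    and e_cong: "\<And>\<theta> \<theta>' i. (\<And>j. j < root_rank R n \<Longrightarrow> \<theta> j = \<theta>' j) \<Longrightarrow> e \<theta> i = e \<theta>' i"
    and esym_e: "\<And>v i. esym n (\<lambda>l. cosh (b v l)) i = e (\<lambda>j. real_fund_orbit_poly R n j (exp_point R n v)) i"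
    and lift: "\<And>\<theta>. \<exists>v. \<forall>i<root_rank R n. real_fund_orbit_poly R n i (exp_point R n v) = \<theta> i"
    and real: "\<And>v i. (\<And>l. Re (v l) = 0) \<Longrightarrow> i < root_rank R n \<Longrightarrow> real_fund_orbit_poly R n i (exp_point R n v) \<in> \<real>"
  shows "chebyshev_orbit R n"
proof
  let ?r = "root_rank R n"
  have cheb_val': "real_cheb_value R n k (exp_point R n v) =
      (\<Sum>l<n. cheb k ((exp (b v l) + inverse (exp (b v l))) / 2)) / of_nat n" for k v
    unfolding cheb_val cosh_joukowski ..
  show "0 < n" using R(1) by (auto simp: valid_type_def)
  show real_torus: "real_fund_orbit_poly R n i x \<in> \<real>" if "x \<in> torus ?r" "i < ?r" for x i
    using torus_exp_point[OF R(1) that(1)] real that(2) by blast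
  show "\<exists>x \<in> carrier_vec ?r. (\<forall>i<?r. x $ i \<noteq> 0) \<and> (\<forall>i<?r. real_fund_orbit_poly R n i x = of_real (z $ i))"
    if "z \<in> carrier_vec ?r" for z
    using lift[of "\<lambda>i. of_real (z $ i)"] exp_point_carrier exp_point_nonzero by blast
  show "\<exists>y. (\<forall>l<n. y l \<noteq> 0) \<and>
        (\<forall>k. real_cheb_value R n k x = (\<Sum>l<n. cheb k ((y l + inverse (y l)) / 2)) / of_nat n) \<and>
        (x \<in> torus ?r \<longleftrightarrow> (\<forall>l<n. cmod (y l) = 1))"
    if x: "x \<in> carrier_vec ?r" "\<And>i. i < ?r \<Longrightarrow> x $ i \<noteq> 0" for x
  proof -
    obtain v where v: "exp_point R n v = x" "x \<in> torus ?r \<longrightarrow> (\<forall>j. Re (v j) = 0)"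
      using exp_point_surj[OF R(1) x] by blast
    have "x \<in> torus ?r \<longleftrightarrow> (\<forall>l<n. cmod (exp (b v l)) = 1)"
      using v b_Re[of v] b_torus[of v] by auto
    then show ?thesis
      using cheb_val'[of _ v] unfolding v(1) by (intro exI[of _ "\<lambda>l. exp (b v l)"]) simp
  qed
  show "\<exists>p \<in> mpoly_ring ?r. \<forall>x \<in> torus ?r. of_real (mpoly_eval p (real_orbit_map R n x)) = real_cheb_value R n k x" for k
  proof (rule cheb_poly_exists_of_esym[OF E])
    fix x assume x: "x \<in> torus ?r"
    obtain v where v: "exp_point R n v = x" "\<forall>j. Re (v j) = 0"
      using torus_exp_point[OF R(1) x] by blast
    have "real_cheb_value R n k x = of_real (Re ((\<Sum>l<n. exp (b v l) ^ k) / of_nat n))"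
      by (rule real_cheb_value_torus_Reals) (use v(2) b_Re cheb_val'[of k v, unfolded v(1)] in simp_all)
    then have "real_cheb_value R n k x \<in> \<real>" by (metis Reals_of_real)
    moreover have "esym n (\<lambda>l. cosh (b v l)) i = e (\<lambda>j. of_real (real_orbit_map R n x $ j)) i" for i
      unfolding esym_e v(1) using real_torus[OF x]
      by (intro e_cong) (simp add: real_orbit_map_def)
    ultimately show "\<exists>w. (\<forall>i. esym n w i = e (\<lambda>j. of_real (real_orbit_map R n x $ j)) i) \<and>
      real_cheb_value R n k x = (\<Sum>l<n. cheb k (w l)) / of_nat n \<and> real_cheb_value R n k x \<in> \<real>"
      using cheb_val[of k v] v(1) by (intro exI[of _ "\<lambda>l. cosh (b v l)"]) simp
  qed
qed

lemmas chebyshev_orbit_cosh_classical =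
  chebyshev_orbit_cosh[where b = "\<lambda>v. v", OF _ _ real_cheb_value_classical _ exp_point_torus]

lemma of_nat_mult_divide_Reals: "x \<in> \<real> \<Longrightarrow> x / of_nat k \<in> (\<real> :: complex set)"
  by (auto intro: Reals_divide)

lemma chebyshev_orbit_C:
  assumes "valid_type C_type n"
  shows "chebyshev_orbit C_type n"
proof -
  have fund: "real_fund_orbit_poly C_type n i (exp_point C_type n v) =
      esym n (\<lambda>l. cosh (v l)) (Suc i) / of_nat (n choose Suc i)" if "i < n" for i v
    using that conj_perm_self[OF assms, of i] fund_orbit_poly_BCD_esym[OF assms, of i v]
    by (simp add: real_fund_orbit_poly_self)
  \<comment> \<open>Undoes the normalisation by binomial coefficients; the zero-based \<theta>_(i-1)
    carries the i-th elementary symmetric function.\<close>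
  define e :: "(nat \<Rightarrow> complex) \<Rightarrow> nat \<Rightarrow> complex" where
    "e \<theta> i = (if i = 0 then 1 else if i \<le> n then of_nat (n choose i) * \<theta> (i - 1) else 0)" for \<theta> i
  show ?thesis
  proof (rule chebyshev_orbit_cosh_classical[where e = e, OF assms _ assms])
    show "ratpoly_fun (root_rank C_type n) (\<lambda>z. e (\<lambda>j. of_real (z $ j)) i)" for i
      unfolding e_def
      by (cases "i = 0"; cases "i \<le> n"; simp) (auto intro!: ratpoly_fun_intros)
    show "e \<theta> i = e \<theta>' i" if "\<And>j. j < root_rank C_type n \<Longrightarrow> \<theta> j = \<theta>' j" for \<theta> \<theta>' i
      using that by (simp add: e_def)
    show "esym n (\<lambda>l. cosh (v l)) i = e (\<lambda>j. real_fund_orbit_poly C_type n j (exp_point C_type n v)) i" for v i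
      by (cases i) (simp_all add: e_def fund esym_eq_0)
    show "\<exists>v. \<forall>i<root_rank C_type n. real_fund_orbit_poly C_type n i (exp_point C_type n v) = \<theta> i" for \<theta>
    proof -
      obtain v where "\<forall>i\<le>n. esym n (\<lambda>l. cosh (v l)) i = e \<theta> i"
        using esym_cosh_surj[of "e \<theta>" n] by (auto simp: e_def)
      then show ?thesis by (intro exI[of _ v]) (simp add: fund e_def)
    qed
    show "real_fund_orbit_poly C_type n i (exp_point C_type n v) \<in> \<real>"
      if "\<And>l. Re (v l) = 0" "i < root_rank C_type n" for v i
      using that by (simp add: fund of_nat_mult_divide_Reals esym_Reals cosh_Reals)
  qed auto
qed

lemma chebyshev_orbit_B:
  assumes "valid_type B_type n"
  shows "chebyshev_orbit B_type n"
proof -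
  define m where "m = n - 1"
  have m: "Suc m = n" "m < n" "0 < n" using assms by (auto simp: valid_type_def m_def)
  have less_m: "i < n \<Longrightarrow> i \<noteq> m \<Longrightarrow> i < m" for i using m(1) by simp
  have fund: "real_fund_orbit_poly B_type n i (exp_point B_type n v) =
      esym n (\<lambda>l. cosh (v l)) (Suc i) / of_nat (n choose Suc i)" if "i < m" for i v
    using that m conj_perm_self[OF assms, of i] fund_orbit_poly_BCD_esym[OF assms, of i v]
    by (simp add: real_fund_orbit_poly_self)
  have spin: "real_fund_orbit_poly B_type n m (exp_point B_type n v) = (\<Prod>l<n. cosh (v l / 2))" for v
    using conj_perm_self[OF assms, of m] fund_orbit_poly_B_last[OF assms, of v] m(2)
    by (simp add: real_fund_orbit_poly_self m_def)
  define e0 :: "(nat \<Rightarrow> complex) \<Rightarrow> nat \<Rightarrow> complex" where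
    "e0 \<theta> i = (if i = 0 then 1 else of_nat (n choose i) * \<theta> (i - 1))" for \<theta> i
  \<comment> \<open>The top function e_n is obtained from the spin value: all e_i together sum to
    \<Prod> (1 + cosh v_l) = 2^n \<theta>_m^2.\<close>
  define e :: "(nat \<Rightarrow> complex) \<Rightarrow> nat \<Rightarrow> complex" where
    "e \<theta> i = (if i < n then e0 \<theta> i else if i = n then 2 ^ n * (\<theta> m)\<^sup>2 - (\<Sum>k<n. e0 \<theta> k) else 0)" for \<theta> i
  have e_less: "esym n (\<lambda>l. cosh (v l)) i = e0 (\<lambda>j. real_fund_orbit_poly B_type n j (exp_point B_type n v)) i" if "i < n" for v i
    using that m(1) fund[of "i - 1" v] by (cases i) (simp_all add: e0_def)
  have rat_e0: "ratpoly_fun n (\<lambda>z. e0 (\<lambda>j. of_real (z $ j)) i)" if "i < n" for i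
    unfolding e0_def using that by (cases "i = 0"; simp) (auto intro!: ratpoly_fun_intros)
  show ?thesis
  proof (rule chebyshev_orbit_cosh_classical[where e = e, OF assms _ assms])
    show "ratpoly_fun (root_rank B_type n) (\<lambda>z. e (\<lambda>j. of_real (z $ j)) i)" for i
    proof -
      consider "i < n" | "i = n" | "i > n" by linarith
      then show ?thesis
      proof cases
        case 1
        then show ?thesis using rat_e0 by (simp add: e_def)
      next
        case 2
        have "ratpoly_fun n (\<lambda>z. 2 ^ n * (of_real (z $ m))\<^sup>2 - (\<Sum>k<n. e0 (\<lambda>j. of_real (z $ j)) k))"
          by (intro ratpoly_fun_intros rat_e0) (use m in auto)
        then show ?thesis using 2 by (simp add: e_def)
      next
        case 3
        then show ?thesis by (simp add: e_def ratpoly_fun_0)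
      qed
    qed
    show "e \<theta> i = e \<theta>' i" if "\<And>j. j < root_rank B_type n \<Longrightarrow> \<theta> j = \<theta>' j" for \<theta> \<theta>' i
    proof -
      have "e0 \<theta> k = e0 \<theta>' k" if "k < n" for k using that \<open>\<And>j. _ \<Longrightarrow> \<theta> j = \<theta>' j\<close> by (simp add: e0_def)
      then show ?thesis using that m(2) by (simp add: e_def)
    qed
    show "esym n (\<lambda>l. cosh (v l)) i = e (\<lambda>j. real_fund_orbit_poly B_type n j (exp_point B_type n v)) i" for v i
    proof -
      consider "i < n" | "i = n" | "i > n" by linarith
      then show ?thesis
      proof cases
        case 2
        have "(\<Sum>k<n. esym n (\<lambda>l. cosh (v l)) k) + esym n (\<lambda>l. cosh (v l)) n = 2 ^ n * (\<Prod>l<n. cosh (v l / 2))\<^sup>2"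
          using esym_sum_cosh(1)[where n = n and v = v] by (simp add: lessThan_Suc_atMost[symmetric])
        moreover have "(\<Sum>k<n. esym n (\<lambda>l. cosh (v l)) k) =
            (\<Sum>k<n. e0 (\<lambda>j. real_fund_orbit_poly B_type n j (exp_point B_type n v)) k)"
          by (intro sum.cong refl) (simp add: e_less)
        ultimately show ?thesis using 2 by (simp add: e_def spin eq_diff_eq add.commute)
      qed (simp_all add: e_def e_less esym_eq_0)
    qed
    show "\<exists>v. \<forall>i<root_rank B_type n. real_fund_orbit_poly B_type n i (exp_point B_type n v) = \<theta> i" for \<theta>
    proof -
      have "e \<theta> 0 = 1" using m by (simp add: e_def e0_def)
      then obtain u where u: "\<forall>i\<le>n. esym n (\<lambda>l. cosh (u l)) i = e \<theta> i"
        using esym_cosh_surj[of "e \<theta>" n] by auto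
      have "2 ^ n * (\<Prod>l<n. cosh (u l / 2))\<^sup>2 = (\<Sum>i\<le>n. e \<theta> i)"
        using esym_sum_cosh(1)[where n = n and v = u] u by simp
      also have "\<dots> = 2 ^ n * (\<theta> m)\<^sup>2"
        by (simp add: e_def lessThan_Suc_atMost[symmetric])
      finally have "(\<Prod>l<n. cosh (u l / 2))\<^sup>2 = (\<theta> m)\<^sup>2" by simp
      then obtain v where v: "\<forall>l. cosh (v l) = cosh (u l)" "(\<Prod>l<n. cosh (v l / 2)) = \<theta> m"
        using adjust_half_signs[of n u "\<theta> m"] m by blast
      have "real_fund_orbit_poly B_type n i (exp_point B_type n v) = \<theta> i" if "i < n" for i
      proof (cases "i = m")
        case True
        then show ?thesis by (simp add: spin v(2))
      next
        case False
        then have "i < m" "Suc i < n" using less_m[OF that] m(1) by auto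
        then show ?thesis using u v(1) by (simp add: fund e_def e0_def)
      qed
      then show ?thesis by auto
    qed
    show "real_fund_orbit_poly B_type n i (exp_point B_type n v) \<in> \<real>"
      if "\<And>l. Re (v l) = 0" "i < root_rank B_type n" for v i
      using that by (cases "i = m") (simp_all add: spin fund less_m of_nat_mult_divide_Reals esym_Reals cosh_Reals prod_Reals)
  qed auto
qed

lemma real_fund_orbit_poly_D_spin:
  assumes "valid_type D_type n" "c = (\<Prod>l<n. cosh (v l / 2))" "s = (\<Prod>l<n. sinh (v l / 2))"
  shows "real_fund_orbit_poly D_type n (n - 2) (exp_point D_type n v) = (if even n then c - s else c)"
    and "real_fund_orbit_poly D_type n (n - 1) (exp_point D_type n v) = (if even n then c + s else \<i> * s)"
proof -
  have n: "n - 2 < n" "n - 1 < n" "n - 2 \<noteq> n - 1" "n - 2 < n - 1" using assms(1) by (auto simp: valid_type_def)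
  note spin = fund_orbit_poly_D_spin[OF assms(1), of v, folded assms(2,3)]
  show "real_fund_orbit_poly D_type n (n - 2) (exp_point D_type n v) = (if even n then c - s else c)"
  proof (cases "even n")
    case True
    then have "conj_perm D_type n (n - 2) = n - 2" using n by (intro conj_perm_self[OF assms(1)]) auto
    then show ?thesis using True spin by (simp only: real_fund_orbit_poly_self if_True)
  next
    case False
    then show ?thesis
      unfolding real_fund_orbit_poly_def Let_def conj_perm_D_odd[OF assms(1) False] spin using n by simp
  qed
  show "real_fund_orbit_poly D_type n (n - 1) (exp_point D_type n v) = (if even n then c + s else \<i> * s)"
  proof (cases "even n")
    case True
    then have "conj_perm D_type n (n - 1) = n - 1" using n by (intro conj_perm_self[OF assms(1)]) auto
    then show ?thesis using True spin by (simp only: real_fund_orbit_poly_self if_True)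
  next
    case False
    have "(c - s - (c + s)) / (2 * \<i>) = \<i> * s" by (simp add: field_simps)
    then show ?thesis
      unfolding real_fund_orbit_poly_def Let_def conj_perm_D_odd[OF assms(1) False] spin using n False by simp
  qed
qed

lemma chebyshev_orbit_D:
  assumes "valid_type D_type n"
  shows "chebyshev_orbit D_type n"
proof -
  define m where "m = n - 2"
  have m: "Suc (Suc m) = n" "m < n" "Suc m < n" "0 < n" "n - 1 = Suc m" "n - 2 = m"
    using assms by (auto simp: valid_type_def m_def)
  have less_m: "i < n \<Longrightarrow> i \<noteq> m \<Longrightarrow> i \<noteq> Suc m \<Longrightarrow> i < m" for i using m(1) by simp
  have fund: "real_fund_orbit_poly D_type n i (exp_point D_type n v) =
      esym n (\<lambda>l. cosh (v l)) (Suc i) / of_nat (n choose Suc i)" if "i < m" for i v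
    using that conj_perm_D[OF assms, of i] fund_orbit_poly_BCD_esym[OF assms, of i v]
    by (simp add: real_fund_orbit_poly_self m_def)
  define \<theta>v where "\<theta>v v j = real_fund_orbit_poly D_type n j (exp_point D_type n v)" for v j
  \<comment> \<open>\<open>tc\<close> and \<open>ts\<close> recover the products of cosh(v_l / 2)
    and sinh(v_l / 2) from the last two real orbit values, whose form depends on the parity of
    n.\<close>
  define tc :: "(nat \<Rightarrow> complex) \<Rightarrow> complex" where
    "tc \<theta> = (if even n then (\<theta> (Suc m) + \<theta> m) / 2 else \<theta> m)" for \<theta>
  define ts :: "(nat \<Rightarrow> complex) \<Rightarrow> complex" where
    "ts \<theta> = (if even n then (\<theta> (Suc m) - \<theta> m) / 2 else - \<i> * \<theta> (Suc m))" for \<theta>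
  define e0 :: "(nat \<Rightarrow> complex) \<Rightarrow> nat \<Rightarrow> complex" where
    "e0 \<theta> i = (if i = 0 then 1 else of_nat (n choose i) * \<theta> (i - 1))" for \<theta> i
  \<comment> \<open>\<open>a\<close> and \<open>b\<close> stand for e_n + e_(n-1) and e_n - e_(n-1),
    read off the generating polynomial at 1 and -1; here \<open>Suc m\<close> is n - 1.\<close>
  define a where "a \<theta> = 2 ^ n * (tc \<theta>)\<^sup>2 - (\<Sum>k<Suc m. e0 \<theta> k)" for \<theta>
  define b where "b \<theta> = (- 1) ^ n * ((- 2) ^ n * (ts \<theta>)\<^sup>2 - (\<Sum>k<Suc m. (- 1) ^ k * e0 \<theta> k))" for \<theta>
  define e :: "(nat \<Rightarrow> complex) \<Rightarrow> nat \<Rightarrow> complex" where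
    "e \<theta> i = (if i < Suc m then e0 \<theta> i else if i = Suc m then (a \<theta> - b \<theta>) / 2
      else if i = n then (a \<theta> + b \<theta>) / 2 else 0)" for \<theta> i
  have e_Suc_m: "e \<theta> (Suc m) = (a \<theta> - b \<theta>) / 2" and e_n: "e \<theta> n = (a \<theta> + b \<theta>) / 2" for \<theta>
    using m(3) by (auto simp: e_def)
  have spin: "\<theta>v v m = (if even n then (\<Prod>l<n. cosh (v l / 2)) - (\<Prod>l<n. sinh (v l / 2)) else (\<Prod>l<n. cosh (v l / 2)))"
    "\<theta>v v (Suc m) = (if even n then (\<Prod>l<n. cosh (v l / 2)) + (\<Prod>l<n. sinh (v l / 2)) else \<i> * (\<Prod>l<n. sinh (v l / 2)))" for v
    using real_fund_orbit_poly_D_spin[OF assms refl refl, of v] by (simp_all only: \<theta>v_def m(5,6))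
  have tcv: "tc (\<theta>v v) = (\<Prod>l<n. cosh (v l / 2))" and tsv: "ts (\<theta>v v) = (\<Prod>l<n. sinh (v l / 2))" for v
    by (simp_all add: tc_def ts_def spin)
  have sum_n: "(\<Sum>i\<le>n. g i) = (\<Sum>i<Suc m. g i) + g (Suc m) + g n" for g :: "nat \<Rightarrow> complex"
    using m(1) by (metis lessThan_Suc_atMost sum.lessThan_Suc)
  have sgn: "(- 1) ^ Suc m = - ((- 1) ^ n :: complex)" using m(1) by (metis mult_minus1 power_Suc minus_minus)
  have sgn2: "(- 1) ^ n * (- 1) ^ n = (1 :: complex)" by (simp flip: power_mult_distrib)
  have sums_e: "(\<Sum>i\<le>n. e \<theta> i) = 2 ^ n * (tc \<theta>)\<^sup>2" "(\<Sum>i\<le>n. (- 1) ^ i * e \<theta> i) = (- 2) ^ n * (ts \<theta>)\<^sup>2" for \<theta>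
  proof -
    have "(\<Sum>i<Suc m. e \<theta> i) = (\<Sum>i<Suc m. e0 \<theta> i)" "(\<Sum>i<Suc m. (- 1) ^ i * e \<theta> i) = (\<Sum>i<Suc m. (- 1) ^ i * e0 \<theta> i)"
      by (intro sum.cong refl, simp add: e_def)+
    then have "(\<Sum>i\<le>n. e \<theta> i) = (\<Sum>i<Suc m. e0 \<theta> i) + a \<theta>"
      "(\<Sum>i\<le>n. (- 1) ^ i * e \<theta> i) = (\<Sum>i<Suc m. (- 1) ^ i * e0 \<theta> i) + (- 1) ^ n * b \<theta>"
      unfolding sum_n e_Suc_m e_n sgn by (simp_all add: field_simps)
    then show "(\<Sum>i\<le>n. e \<theta> i) = 2 ^ n * (tc \<theta>)\<^sup>2" "(\<Sum>i\<le>n. (- 1) ^ i * e \<theta> i) = (- 2) ^ n * (ts \<theta>)\<^sup>2"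
      unfolding a_def b_def mult.assoc[symmetric] sgn2 by simp_all
  qed
  have e_less: "esym n (\<lambda>l. cosh (v l)) i = e0 (\<theta>v v) i" if "i < Suc m" for v i
    using that fund[of "i - 1" v] m(1) by (cases i) (simp_all add: e0_def \<theta>v_def)
  have rat_e0: "ratpoly_fun n (\<lambda>z. e0 (\<lambda>j. of_real (z $ j)) i)" if "i < Suc m" for i
    unfolding e0_def using that m(2) by (cases "i = 0"; simp) (auto intro!: ratpoly_fun_intros)
  have "ratpoly_fun n (\<lambda>z. tc (\<lambda>j. of_real (z $ j)))" "ratpoly_fun n (\<lambda>z. ts (\<lambda>j. of_real (z $ j)))"
    unfolding tc_def ts_def using m(2,3) by (cases "even n"; simp; intro ratpoly_fun_intros; simp)+
  then have rat_ab: "ratpoly_fun n (\<lambda>z. a (\<lambda>j. of_real (z $ j)))" "ratpoly_fun n (\<lambda>z. b (\<lambda>j. of_real (z $ j)))"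
    unfolding a_def b_def by (intro ratpoly_fun_intros rat_e0; simp)+
  show ?thesis
  proof (rule chebyshev_orbit_cosh_classical[where e = e, OF assms _ assms])
    show "ratpoly_fun (root_rank D_type n) (\<lambda>z. e (\<lambda>j. of_real (z $ j)) i)" for i
    proof -
      consider "i < Suc m" | "i = Suc m" | "i = n" | "i > n" using m(1) by linarith
      then show ?thesis
      proof cases
        case 1
        then show ?thesis using rat_e0 by (simp add: e_def)
      next
        case 2
        show ?thesis unfolding 2 e_Suc_m root_rank.simps by (intro ratpoly_fun_intros rat_ab)
      next
        case 3
        show ?thesis unfolding 3 e_n root_rank.simps by (intro ratpoly_fun_intros rat_ab)
      next
        case 4
        then show ?thesis using m(3) by (simp add: e_def ratpoly_fun_0)
      qed
    qed
    show "e \<theta> i = e \<theta>' i" if eq: "\<And>j. j < root_rank D_type n \<Longrightarrow> \<theta> j = \<theta>' j" for \<theta> \<theta>' i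
    proof -
      have "e0 \<theta> k = e0 \<theta>' k" if "k < Suc m" for k using that eq[of "k - 1"] m(2) by (simp add: e0_def)
      moreover from this have "(\<Sum>k<Suc m. f k (e0 \<theta> k)) = (\<Sum>k<Suc m. f k (e0 \<theta>' k))" for f :: "nat \<Rightarrow> complex \<Rightarrow> complex"
        by (intro sum.cong) auto
      moreover have "tc \<theta> = tc \<theta>'" "ts \<theta> = ts \<theta>'" using eq m(2,3) by (simp_all add: tc_def ts_def)
      ultimately have "a \<theta> = a \<theta>'" "b \<theta> = b \<theta>'" "\<And>k. k < Suc m \<Longrightarrow> e0 \<theta> k = e0 \<theta>' k"
        unfolding a_def b_def by simp_all
      then show ?thesis by (simp add: e_def)
    qed
    show "esym n (\<lambda>l. cosh (v l)) i = e (\<lambda>j. real_fund_orbit_poly D_type n j (exp_point D_type n v)) i" for v i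
    proof -
      let ?E = "esym n (\<lambda>l. cosh (v l))"
      have "?E i = e (\<theta>v v) i"
      proof -
        have "(\<Sum>i<Suc m. ?E i) = (\<Sum>i<Suc m. e0 (\<theta>v v) i)"
          "(\<Sum>i<Suc m. (- 1) ^ i * ?E i) = (\<Sum>i<Suc m. (- 1) ^ i * e0 (\<theta>v v) i)"
          by (intro sum.cong refl, simp add: e_less)+
        then have "(\<Sum>i<Suc m. e0 (\<theta>v v) i) + ?E (Suc m) + ?E n = 2 ^ n * (tc (\<theta>v v))\<^sup>2"
          "(\<Sum>i<Suc m. (- 1) ^ i * e0 (\<theta>v v) i) - (- 1) ^ n * ?E (Suc m) + (- 1) ^ n * ?E n = (- 2) ^ n * (ts (\<theta>v v))\<^sup>2"
          using esym_sum_cosh[where n = n and v = v] unfolding tcv tsv sum_n sgn by simp_all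
        then have A: "?E (Suc m) + ?E n = a (\<theta>v v)" and "(- 1) ^ n * (?E n - ?E (Suc m)) = (- 1) ^ n * b (\<theta>v v)"
          unfolding a_def b_def mult.assoc[symmetric] sgn2 by (simp_all add: algebra_simps)
        then have "?E n - ?E (Suc m) = b (\<theta>v v)" by simp
        with A have "?E (Suc m) = (a (\<theta>v v) - b (\<theta>v v)) / 2" "?E n = (a (\<theta>v v) + b (\<theta>v v)) / 2"
          by (simp_all flip: A add: field_simps)
        then have eqs: "?E (Suc m) = e (\<theta>v v) (Suc m)" "?E n = e (\<theta>v v) n"
          unfolding e_Suc_m e_n .
        consider "i < Suc m" | "i = Suc m" | "i = n" | "i > n" using m(1) by linarith
        then show ?thesis
        proof cases
          case 1
          then show ?thesis by (simp add: e_def e_less)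
        next
          case 4
          then show ?thesis using m(3) by (simp add: e_def esym_eq_0)
        qed (simp_all only: eqs)
      qed
      then show ?thesis by (simp add: \<theta>v_def[abs_def])
    qed
    show "\<exists>v. \<forall>i<root_rank D_type n. real_fund_orbit_poly D_type n i (exp_point D_type n v) = \<theta> i" for \<theta>
    proof -
      have "e \<theta> 0 = 1" by (simp add: e_def e0_def)
      then obtain u where u: "\<forall>i\<le>n. esym n (\<lambda>l. cosh (u l)) i = e \<theta> i"
        using esym_cosh_surj[of "e \<theta>" n] by auto
      have "2 ^ n * (\<Prod>l<n. cosh (u l / 2))\<^sup>2 = 2 ^ n * (tc \<theta>)\<^sup>2"
        "(- 2) ^ n * (\<Prod>l<n. sinh (u l / 2))\<^sup>2 = (- 2) ^ n * (ts \<theta>)\<^sup>2"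
        unfolding esym_sum_cosh[symmetric] sums_e[symmetric] using u by simp_all
      then have "(\<Prod>l<n. cosh (u l / 2))\<^sup>2 = (tc \<theta>)\<^sup>2" "(\<Prod>l<n. sinh (u l / 2))\<^sup>2 = (ts \<theta>)\<^sup>2"
        by simp_all
      then obtain v where v: "\<forall>l. cosh (v l) = cosh (u l)" "(\<Prod>l<n. cosh (v l / 2)) = tc \<theta>" "(\<Prod>l<n. sinh (v l / 2)) = ts \<theta>"
        using adjust_half_signs[of n u "tc \<theta>" "ts \<theta>"] m(4) by blast
      have "\<theta>v v i = \<theta> i" if i: "i < n" for i
      proof -
        consider "i < m" | "i = m" | "i = Suc m" using less_m[OF i] by blast
        then show ?thesis
        proof cases
          case 1
          then show ?thesis using u v(1) m(1) by (simp add: \<theta>v_def fund e_def e0_def)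
        next
          case 2
          then show ?thesis by (simp add: spin v(2,3)) (simp add: tc_def ts_def field_simps)
        next
          case 3
          then show ?thesis by (simp add: spin v(2,3)) (simp add: tc_def ts_def field_simps)
        qed
      qed
      then show ?thesis by (auto simp: \<theta>v_def)
    qed
    show "real_fund_orbit_poly D_type n i (exp_point D_type n v) \<in> \<real>"
      if re: "\<And>l. Re (v l) = 0" and i: "i < root_rank D_type n" for v i
    proof -
      have c: "(\<Prod>l<n. cosh (v l / 2)) \<in> \<real>" using re by (intro prod_Reals cosh_Reals) simp
      \<comment> \<open>Each sinh(v_l / 2) is imaginary, so their product is real for even n and
        imaginary for odd n, matching the two shapes of the real orbit values.\<close>
      have "(\<Prod>l<n. \<i> * sinh (v l / 2)) \<in> \<real>" using re by (intro prod_Reals sinh_ii_Reals) simp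
      then have s: "\<i> ^ n * (\<Prod>l<n. sinh (v l / 2)) \<in> \<real>" by (simp add: prod.distrib)
      consider "i < m" | "i = m \<or> i = Suc m" using less_m[of i] i by auto
      then show ?thesis
      proof cases
        case 1
        then show ?thesis using re by (simp add: fund of_nat_mult_divide_Reals esym_Reals cosh_Reals)
      next
        case 2
        show ?thesis
        proof (cases "even n")
          case True
          then obtain k where "n = 2 * k" by blast
          then have "\<i> ^ n = (- 1) ^ k" by (simp add: power_mult)
          then have "(\<Prod>l<n. sinh (v l / 2)) \<in> \<real>" using s by (cases "even k") simp_all
          then show ?thesis using 2 c True spin[of v] unfolding \<theta>v_def by auto
        next
          case False
          then obtain k where "n = Suc (2 * k)" by (metis oddE Suc_eq_plus1)
          then have "\<i> ^ n = \<i> * (- 1) ^ k" by (simp add: power_mult)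
          then have "\<i> * (\<Prod>l<n. sinh (v l / 2)) \<in> \<real>" using s by (cases "even k") simp_all
          then show ?thesis using 2 c False spin[of v] unfolding \<theta>v_def by auto
        qed
      qed
    qed
  qed auto
qed

subsection \<open>Type A\<close>

text \<open>Reversing the coordinates, the longest element of the symmetric group, maps
  \<omega>_(n-i) to -\<omega>_i; with zero-based indices i goes to n - 2 - i.\<close>

lemma conj_perm_A:
  assumes "valid_type A_type n" "i < n - 1"
  shows "conj_perm A_type n i = n - 2 - i"
proof -
  define p where "p j = (if j < n then n - 1 - j else j)" for j
  have pp: "p (p j) = j" for j by (auto simp: p_def)
  have p: "p permutes {..<n}"
    by (rule bij_imp_permutes, rule bij_betw_byWitness[where f' = p]) (use pp in \<open>auto simp: p_def\<close>)
  have inv: "Hilbert_Choice.inv p = p"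
    by (rule inv_unique_comp) (auto simp: fun_eq_iff pp)
  have ps: "(p, {}) \<in> weyl_params A_type n" using p by (simp add: weyl_params_def)
  show ?thesis
  proof (rule conj_perm_eqI[OF assms(1) ps])
    fix m assume m: "m < n"
    have "n - 1 - m < Suc (n - 2 - i) \<longleftrightarrow> \<not> m < Suc i" using m assms(2) by auto
    moreover have "real (Suc (n - 2 - i)) / real n = 1 - real (Suc i) / real n"
      using assms(2) by (simp add: field_simps of_nat_diff)
    ultimately show "weyl_act p {} (fund A_type n (n - 2 - i)) m = - fund A_type n i m"
      using m by (simp add: weyl_act_def inv p_def set_sign_def fund_def)
  qed (use assms in auto)
qed

lemma esym_top: "esym n w n = (\<Prod>l<n. w l)"
proof -
  have "{J. J \<subseteq> {..<n} \<and> card J = n} = {{..<n}}"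
    using card_subset_eq[of "{..<n}"] by auto
  then show ?thesis by (simp add: esym_eq_sum_subsets)
qed

text \<open>The product over a complement is the inverse of the product over \<open>J\<close>, as
  the total product is 1, and on the unit circle inverse and conjugate coincide. This makes the real
  orbit polynomials of type A real on the torus.\<close>

lemma esym_complement_cnj:
  assumes "i \<le> n" "\<And>l. l < n \<Longrightarrow> cmod (w l) = 1" "(\<Prod>l<n. w l) = 1"
  shows "esym n w (n - i) = cnj (esym n w i)"
proof -
  have compl: "(\<Prod>j\<in>{..<n} - J. w j) = cnj (\<Prod>j\<in>J. w j)" if J: "J \<subseteq> {..<n}" for J
  proof -
    have "(\<Prod>j\<in>{..<n} - J. w j) * (\<Prod>j\<in>J. w j) = 1"
      using assms(3) prod.subset_diff[OF J, of w] by simp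
    moreover have "cnj (\<Prod>j\<in>J. w j) * (\<Prod>j\<in>J. w j) = 1"
    proof -
      have "cmod (\<Prod>j\<in>J. w j) = 1"
        unfolding prod_norm[symmetric] using assms(2) J by (intro prod.neutral) auto
      then show ?thesis by (metis complex_norm_square mult.commute of_real_1 power_one)
    qed
    ultimately show ?thesis by (metis mult_cancel_right mult_zero_right zero_neq_one)
  qed
  have card: "card ({..<n} - J) = n - card J" if "J \<subseteq> {..<n}" for J
    using that by (subst card_Diff_subset) (auto intro: finite_subset)
  have "esym n w (n - i) = (\<Sum>J | J \<subseteq> {..<n} \<and> card J = i. \<Prod>j\<in>{..<n} - J. w j)"
    unfolding esym_eq_sum_subsets
    by (rule sum.reindex_bij_witness[of _ "\<lambda>J. {..<n} - J" "\<lambda>J. {..<n} - J"])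
      (use assms(1) in \<open>auto simp: card double_diff\<close>)
  also have "\<dots> = (\<Sum>J | J \<subseteq> {..<n} \<and> card J = i. cnj (\<Prod>j\<in>J. w j))"
    by (intro sum.cong refl compl) auto
  finally show ?thesis by (simp add: esym_eq_sum_subsets)
qed

lemma cheb_value_A:
  assumes "valid_type A_type n"
    and "x \<in> carrier_vec (root_rank A_type n)" "\<And>i. i < root_rank A_type n \<Longrightarrow> x $ i \<noteq> 0"
  shows "\<exists>y. (\<forall>l<n. y l \<noteq> 0) \<and>
        (\<forall>k. real_cheb_value A_type n k x = (\<Sum>l<n. cheb k ((y l + inverse (y l)) / 2)) / of_nat n) \<and>
        (x \<in> torus (root_rank A_type n) \<longleftrightarrow> (\<forall>l<n. cmod (y l) = 1))"
proof -
  obtain v where v: "exp_point A_type n v = x" "(\<Sum>j<n. v j) = 0"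
    "x \<in> torus (root_rank A_type n) \<longrightarrow> (\<forall>j. Re (v j) = 0)"
    using exp_point_surj[OF assms] by blast
  have "x \<in> torus (root_rank A_type n) \<longleftrightarrow> (\<forall>l<n. cmod (exp (v l)) = 1)"
    using v(3) exp_point_torus[of n v A_type] by (auto simp: v(1))
  moreover have "real_cheb_value A_type n k x = (\<Sum>l<n. cheb k ((exp (v l) + inverse (exp (v l))) / 2)) / of_nat n" for k
    using real_cheb_value_classical[OF assms(1), of v k] v(1,2) by (simp add: cosh_joukowski)
  ultimately show ?thesis by (intro exI[of _ "\<lambda>l. exp (v l)"]) simp
qed

text \<open>Here the \<theta>_i are normalised elementary symmetric functions of the y_l = exp(v_l)
  with product 1, so \<open>chebyshev_orbit_cosh\<close>, which works with the c_l, is replaced by a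
  direct argument.\<close>

lemma chebyshev_orbit_A:
  assumes "valid_type A_type n"
  shows "chebyshev_orbit A_type n"
proof -
  have n: "n \<ge> 2" using assms by (simp add: valid_type_def)
  define \<phi> where "\<phi> v i = esym n (\<lambda>l. exp (v l)) (Suc i) / of_nat (n choose Suc i)" for v :: "nat \<Rightarrow> complex" and i
  have real_fund: "real_fund_orbit_poly A_type n i (exp_point A_type n v) =
      (if i = n - 2 - i then \<phi> v i else if i < n - 2 - i then (\<phi> v i + \<phi> v (n - 2 - i)) / 2
       else (\<phi> v (n - 2 - i) - \<phi> v i) / (2 * \<i>))"
    if "i < n - 1" "(\<Sum>j<n. v j) = 0" for i v
    using that fund_orbit_poly_A[OF assms _ that(2)]
    unfolding real_fund_orbit_poly_def Let_def conj_perm_A[OF assms that(1)]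
    by (simp add: \<phi>_def less_diff_conv del: binomial_Suc_Suc)
  \<comment> \<open>Inverts the passage to real versions: the smaller index of a conjugate pair
    holds the half-sum, the larger one the half-difference divided by \<i>.\<close>
  define \<psi> :: "(nat \<Rightarrow> complex) \<Rightarrow> nat \<Rightarrow> complex" where
    "\<psi> \<theta> i = (if i = n - 2 - i then \<theta> i else if i < n - 2 - i then \<theta> i + \<i> * \<theta> (n - 2 - i)
      else \<theta> (n - 2 - i) - \<i> * \<theta> i)" for \<theta> i
  define e :: "(nat \<Rightarrow> complex) \<Rightarrow> nat \<Rightarrow> complex" where
    "e \<theta> i = (if i = 0 \<or> i = n then 1 else if i < n then of_nat (n choose i) * \<psi> \<theta> (i - 1) else 0)" for \<theta> i
  have prod_exp: "(\<Prod>l<n. exp (v l)) = 1" if "(\<Sum>j<n. v j) = 0" for v :: "nat \<Rightarrow> complex"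
    using that by (simp flip: exp_sum)
  have \<psi>\<phi>: "\<psi> (\<lambda>j. real_fund_orbit_poly A_type n j (exp_point A_type n v)) i = \<phi> v i"
    if "i < n - 1" "(\<Sum>j<n. v j) = 0" for i v
  proof -
    have "n - 2 - i < n - 1" "n - 2 - (n - 2 - i) = i" using that(1) by auto
    note vals = real_fund[OF that] real_fund[OF this(1) that(2), unfolded this(2)]
    have "(a + b) / 2 + \<i> * ((a - b) / (2 * \<i>)) = a" "(b + a) / 2 - \<i> * ((b - a) / (2 * \<i>)) = a" for a b
      by (simp_all add: field_simps)
    then show ?thesis
      unfolding \<psi>_def vals by auto
  qed
  have esym_e: "esym n (\<lambda>l. exp (v l)) i = e (\<lambda>j. real_fund_orbit_poly A_type n j (exp_point A_type n v)) i"
    if "(\<Sum>j<n. v j) = 0" for i v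
  proof (cases "i = 0 \<or> i \<ge> n")
    case True
    then show ?thesis using prod_exp[OF that] n by (auto simp: e_def esym_eq_0 esym_top le_less)
  next
    case False
    then obtain k where k: "i = Suc k" "k < n - 1" by (cases i) auto
    then show ?thesis using \<psi>\<phi>[OF k(2) that] by (simp add: e_def \<phi>_def less_diff_conv del: binomial_Suc_Suc)
  qed
  show ?thesis
  proof
    show "0 < n" using n by simp
    show real_torus: "real_fund_orbit_poly A_type n i x \<in> \<real>" if x: "x \<in> torus (root_rank A_type n)" and i: "i < root_rank A_type n" for x i
    proof -
      obtain v where v: "exp_point A_type n v = x" "(\<Sum>j<n. v j) = 0" "\<forall>j. Re (v j) = 0"
        using torus_exp_point[OF assms x] by blast
      have i': "i < n - 1" "Suc i \<le> n" using i by auto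
      have "esym n (\<lambda>l. exp (v l)) (n - Suc i) = cnj (esym n (\<lambda>l. exp (v l)) (Suc i))"
        by (rule esym_complement_cnj) (use i' v prod_exp in auto)
      moreover have "Suc (n - 2 - i) = n - Suc i" using i' by auto
      moreover have "n choose (n - Suc i) = n choose Suc i" using i' binomial_symmetric[of "Suc i" n] by simp
      ultimately have cnj: "\<phi> v (n - 2 - i) = cnj (\<phi> v i)"
        by (simp add: \<phi>_def del: binomial_Suc_Suc)
      have "w = cnj w \<Longrightarrow> w \<in> \<real>" for w using Reals_cnj_iff[of w] by simp
      moreover have "(w + cnj w) / 2 \<in> \<real>" "(cnj w - w) / (2 * \<i>) \<in> \<real>" for w
        by (simp_all add: Reals_cnj_iff complex_eq_iff)
      ultimately show ?thesis
        unfolding v(1)[symmetric] real_fund[OF i'(1) v(2)] using cnj by auto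
    qed
    show "\<exists>x \<in> carrier_vec (root_rank A_type n). (\<forall>i<root_rank A_type n. x $ i \<noteq> 0) \<and>
        (\<forall>i<root_rank A_type n. real_fund_orbit_poly A_type n i x = of_real (z $ i))"
      if "z \<in> carrier_vec (root_rank A_type n)" for z
    proof -
      let ?\<theta> = "\<lambda>i. complex_of_real (z $ i)"
      obtain w where w: "\<forall>i\<le>n. esym n w i = e ?\<theta> i" using esym_surj[of "e ?\<theta>" n] by (auto simp: e_def)
      then have prod_w: "(\<Prod>l<n. w l) = 1" by (simp add: e_def flip: esym_top)
      obtain m where m: "n = Suc m" using n by (cases n) auto
      have "w l \<noteq> 0" if "l < n" for l
      proof
        assume "w l = 0"
        then have "(\<Prod>l<n. w l) = 0" using that by (intro prod_zero) auto
        then show False using prod_w by simp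
      qed
      then have "\<exists>u. \<forall>l. l < n \<longrightarrow> exp (u l) = w l" using exists_complex_log by (intro choice) blast
      then obtain u where u: "\<And>l. l < n \<Longrightarrow> exp (u l) = w l" by blast
      \<comment> \<open>The last logarithm is replaced so that the sum is 0; it is still a logarithm
        of w_m because the w_l have product 1.\<close>
      define v where "v = u(m := - (\<Sum>l<m. u l))"
      have sum_v: "(\<Sum>j<n. v j) = 0" by (simp add: v_def m)
      have exp_v: "exp (v l) = w l" if "l < n" for l
      proof (cases "l = m")
        case True
        have "(\<Prod>l<m. w l) = exp (\<Sum>l<m. u l)" using u m by (simp add: exp_sum)
        then have "exp (\<Sum>l<m. u l) * w m = 1" using prod_w m by simp
        then show ?thesis using True by (simp add: v_def exp_minus inverse_unique)
      qed (use that u in \<open>simp add: v_def\<close>)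
      have "esym n (\<lambda>l. exp (v l)) i = esym n w i" for i
        unfolding esym_def using exp_v by (intro arg_cong2[where f = coeff] prod.cong) auto
      then have \<phi>: "\<phi> v i = \<psi> ?\<theta> i" if "i < n - 1" for i
        using w that by (simp add: \<phi>_def e_def less_diff_conv del: binomial_Suc_Suc)
      have "real_fund_orbit_poly A_type n i (exp_point A_type n v) = ?\<theta> i" if i: "i < n - 1" for i
      proof -
        have "n - 2 - i < n - 1" "n - 2 - (n - 2 - i) = i" using i by auto
        then show ?thesis
          unfolding real_fund[OF i sum_v] using \<phi>[OF i] \<phi>[of "n - 2 - i"]
          by (cases "i = n - 2 - i"; cases "i < n - 2 - i") (simp_all add: \<psi>_def field_simps)
      qed
      then show ?thesis using exp_point_carrier[of A_type n v] exp_point_nonzero[of _ A_type n v] by auto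
    qed
    show "\<exists>y. (\<forall>l<n. y l \<noteq> 0) \<and>
        (\<forall>k. real_cheb_value A_type n k x = (\<Sum>l<n. cheb k ((y l + inverse (y l)) / 2)) / of_nat n) \<and>
        (x \<in> torus (root_rank A_type n) \<longleftrightarrow> (\<forall>l<n. cmod (y l) = 1))"
      if "x \<in> carrier_vec (root_rank A_type n)" "\<And>i. i < root_rank A_type n \<Longrightarrow> x $ i \<noteq> 0" for x
      by (rule cheb_value_A[OF assms that])
    show "\<exists>p \<in> mpoly_ring (root_rank A_type n). \<forall>x \<in> torus (root_rank A_type n).
        of_real (mpoly_eval p (real_orbit_map A_type n x)) = real_cheb_value A_type n k x" for k
    proof -
      let ?r = "root_rank A_type n"
      have "ratpoly_fun (n - 1) (\<lambda>z. \<psi> (\<lambda>j. of_real (z $ j)) i)" if "i < n - 1" for i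
      proof -
        have "n - 2 - i < n - 1" using that by auto
        then show ?thesis
          unfolding \<psi>_def using that
          by (cases "i = n - 2 - i"; cases "i < n - 2 - i") (simp_all, (intro ratpoly_fun_intros; simp)+)
      qed
      then have "ratpoly_fun ?r (\<lambda>z. e (\<lambda>j. of_real (z $ j)) i)" for i
        unfolding e_def by (cases "i = 0 \<or> i = n"; cases "i < n") (auto intro!: ratpoly_fun_intros)
      then obtain P where P: "ratpoly_fun ?r P" "\<forall>z \<in> carrier_vec ?r. \<forall>w.
          (\<forall>i. esym n w i = e (\<lambda>j. of_real (z $ j)) i) \<longrightarrow> (\<Sum>l<n. w l ^ k) = P z"
        using power_sum_ratpoly_fun[of ?r "\<lambda>i z. e (\<lambda>j. of_real (z $ j)) i" n k] by blast
      have "ratpoly_fun ?r (\<lambda>z. of_rat (1 / of_nat n) * P z)"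
        by (intro ratpoly_fun_intros P(1))
      then obtain p where p: "p \<in> mpoly_ring ?r" "\<forall>z \<in> carrier_vec ?r. mpoly_eval p z = Re (of_rat (1 / of_nat n) * P z)"
        using ratpoly_fun_Re by blast
      have "of_real (mpoly_eval p (real_orbit_map A_type n x)) = real_cheb_value A_type n k x" if x: "x \<in> torus ?r" for x
      proof -
        obtain v where v: "exp_point A_type n v = x" "(\<Sum>j<n. v j) = 0" "\<forall>j. Re (v j) = 0"
          using torus_exp_point[OF assms x] by blast
        have z: "real_orbit_map A_type n x \<in> carrier_vec ?r" by (simp add: real_orbit_map_def)
        have e_cong: "e \<theta> i = e \<theta>' i" if "\<And>j. j < n - 1 \<Longrightarrow> \<theta> j = \<theta>' j" for \<theta> \<theta>' i
          using that n by (auto simp: e_def \<psi>_def)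
        have "esym n (\<lambda>l. exp (v l)) i = e (\<lambda>j. of_real (real_orbit_map A_type n x $ j)) i" for i
          unfolding esym_e[OF v(2)] v(1)
          by (rule e_cong) (use real_torus[OF x] in \<open>simp add: real_orbit_map_def\<close>)
        then have sum: "(\<Sum>l<n. exp (v l) ^ k) = P (real_orbit_map A_type n x)"
          using P(2) z by blast
        \<comment> \<open>On the torus T_k(c_l) is the real part of y_l^k, so the real part of
          \<open>P\<close> divided by n represents the Chebyshev value.\<close>
        have "real_cheb_value A_type n k x = of_real (Re ((\<Sum>l<n. exp (v l) ^ k) / of_nat n))"
          by (rule real_cheb_value_torus_Reals)
            (use v(3) real_cheb_value_classical[OF assms _ v(2), of k] in \<open>simp_all add: v(1) cosh_joukowski\<close>)
        also have "(\<Sum>l<n. exp (v l) ^ k) / of_nat n = of_rat (1 / of_nat n) * P (real_orbit_map A_type n x)"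
          unfolding sum by (simp add: of_rat_divide)
        finally show ?thesis using p(2) z by metis
      qed
      then show ?thesis using p(1) by blast
    qed
  qed
qed

section \<open>Orbit sums of type G2\<close>

lemma lessThan_3: "{..<3} = {0, 1, 2 :: nat}"
  by auto

lemma sum_permutations_3:
  fixes F :: "nat \<Rightarrow> nat \<Rightarrow> nat \<Rightarrow> complex"
  shows "(\<Sum>p | p permutes {..<3}. F (p 0) (p 1) (p 2)) =
    F 0 1 2 + F 0 2 1 + F 1 0 2 + F 1 2 0 + F 2 0 1 + F 2 1 0"
  unfolding lessThan_3 by (simp add: sum_over_permutations_insert transpose_def)

lemma orbit_sum_G2:
  "orbit_sum G2_type 3 f v / of_nat (card (weyl_params G2_type 3)) =
    (\<Sum>p | p permutes {..<3}. cosh (\<Sum>j<3. of_real (f j) * v (p j))) / 6"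
proof -
  have ne: "{..<3} \<noteq> ({} :: nat set)" by (simp add: lessThan_3)
  have signs: "(\<Sum>S \<in> sign_sets G2_type 3. exp (\<Sum>j<3. of_real (set_sign S j * f j) * v (p j))) =
      2 * cosh (\<Sum>j<3. of_real (f j) * v (p j))" for p
  proof -
    have "(\<Sum>j<3. of_real (set_sign {..<3} j * f j) * v (p j)) = - (\<Sum>j<3. of_real (f j) * v (p j))"
      unfolding sum_negf[symmetric] by (intro sum.cong refl) (simp add: set_sign_def)
    then show ?thesis using ne[symmetric] by (simp add: set_sign_def cosh_field_def)
  qed
  have "card (weyl_params G2_type 3) = 12"
    using ne[symmetric] by (simp add: card_weyl_params fact_numeral)
  then show ?thesis
    unfolding orbit_sum_def sum_weyl_params signs by (simp flip: sum_distrib_left)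
qed

lemma fund_G2:
  "fund G2_type n 0 0 = 0" "fund G2_type n 0 1 = - 1" "fund G2_type n 0 2 = 1"
  "fund G2_type n 1 0 = - 1" "fund G2_type n 1 1 = - 1" "fund G2_type n 1 2 = 2"
  by (simp_all add: fund_def vec_of_list_index numeral_2_eq_2)

lemma sum_lessThan_3: "(\<Sum>j<3. g j) = g 0 + g 1 + g (2 :: nat)"
  by (simp add: numeral_3_eq_3 numeral_2_eq_2)

lemma real_fund_orbit_poly_G2:
  "real_fund_orbit_poly G2_type 3 0 (exp_point G2_type 3 v) =
     (cosh (v 1 - v 2) + cosh (v 2 - v 0) + cosh (v 0 - v 1)) / 3" (is ?A)
  "real_fund_orbit_poly G2_type 3 1 (exp_point G2_type 3 v) =
     (cosh (2 * v 2 - v 0 - v 1) + cosh (2 * v 0 - v 1 - v 2) + cosh (2 * v 1 - v 2 - v 0)) / 3" (is ?B)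
proof -
  have valid: "valid_type G2_type 3" by (simp add: valid_type_def)
  have self: "real_fund_orbit_poly G2_type 3 i x = fund_orbit_poly G2_type 3 i x" if "i < 2" for i x
    using that by (intro real_fund_orbit_poly_self conj_perm_self[OF valid]) auto
  have third: "x * 3 = a + (b + c)" if "x * 6 = 2 * a + (2 * b + 2 * c)" for a b c x :: complex
  proof -
    have "x * 3 = x * 6 / 2" by simp
    also have "\<dots> = a + (b + c)" unfolding that by (simp add: add_divide_distrib)
    finally show ?thesis .
  qed
  have cosh_swap: "cosh (a - b) = cosh (b - a)" for a b :: complex
    using cosh_minus[of "a - b"] by simp
  have "(\<Sum>j<3. of_real (fund G2_type 3 0 j) * v (p j)) = v (p 2) - v (p 1)" for p
    unfolding sum_lessThan_3 fund_G2 by simp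
  then have "fund_orbit_poly G2_type 3 0 (exp_point G2_type 3 v) = (\<Sum>p | p permutes {..<3}. cosh (v (p 2) - v (p 1))) / 6"
    by (simp add: fund_orbit_poly_exp_point[OF valid] orbit_sum_G2)
  then show ?A
    unfolding sum_permutations_3[of "\<lambda>a b c. cosh (v c - v b)"]
      cosh_swap[of "v 2" "v 1"] cosh_swap[of "v 0" "v 2"] cosh_swap[of "v 1" "v 0"]
    by (simp add: self add_ac del: One_nat_def) (erule third)
  have "(\<Sum>j<3. of_real (fund G2_type 3 1 j) * v (p j)) = 2 * v (p 2) - v (p 0) - v (p 1)" for p
    unfolding sum_lessThan_3 fund_G2 by simp
  then have "fund_orbit_poly G2_type 3 1 (exp_point G2_type 3 v) = (\<Sum>p | p permutes {..<3}. cosh (2 * v (p 2) - v (p 0) - v (p 1))) / 6"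
    by (simp add: fund_orbit_poly_exp_point[OF valid] orbit_sum_G2 del: One_nat_def)
  then show ?B
    unfolding sum_permutations_3[of "\<lambda>a b c. cosh (2 * v c - v a - v b)"]
    by (simp add: self diff_diff_eq add_ac del: One_nat_def) (erule third)
qed

lemma real_cheb_value_G2:
  "real_cheb_value G2_type 3 k (exp_point G2_type 3 v) =
    (cheb k (cosh (v 1 - v 2)) + cheb k (cosh (v 2 - v 0)) + cheb k (cosh (v 0 - v 1))) / 3"
proof -
  have valid: "valid_type G2_type 3" by (simp add: valid_type_def)
  have ne: "{..<3} \<noteq> ({} :: nat set)" by (simp add: lessThan_3)
  have third: "x * 3 = a + (b + c)" if "x * 6 = 2 * a + (2 * b + 2 * c)" for a b c x :: complex
  proof -
    have "x * 3 = x * 6 / 2" by simp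
    also have "\<dots> = a + (b + c)" unfolding that by (simp add: add_divide_distrib)
    finally show ?thesis .
  qed
  have cosh_swap: "cosh (a - b) = cosh (b - a)" for a b :: complex
    using cosh_minus[of "a - b"] by simp
  have "cosh (\<Sum>j<3. of_real (set_sign S j * fund G2_type 3 0 j) * v (p j)) = cosh (v (p 2) - v (p 1))"
    if "S \<in> sign_sets G2_type 3" for S p
    using that cosh_swap[of "v (p 2)"] unfolding sum_lessThan_3 fund_G2 by (auto simp: set_sign_def)
  then have "(\<Sum>S \<in> sign_sets G2_type 3. cheb k (cosh (\<Sum>j<3. of_real (set_sign S j * fund G2_type 3 0 j) * v (p j)))) =
      2 * cheb k (cosh (v (p 2) - v (p 1)))" for p
    using ne[symmetric] by simp
  moreover have "card (weyl_params G2_type 3) = 12"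
    using ne[symmetric] by (simp add: card_weyl_params fact_numeral)
  ultimately have "real_cheb_value G2_type 3 k (exp_point G2_type 3 v) =
      (\<Sum>p | p permutes {..<3}. cheb k (cosh (v (p 2) - v (p 1)))) / 6"
    unfolding real_cheb_value_exp_point[OF valid] sum_weyl_params by (simp flip: sum_distrib_left)
  then show ?thesis
    unfolding sum_permutations_3[of "\<lambda>a b c. cheb k (cosh (v c - v b))"]
      cosh_swap[of "v 2" "v 1"] cosh_swap[of "v 0" "v 2"] cosh_swap[of "v 1" "v 0"]
    by (simp add: add_ac del: One_nat_def) (erule third)
qed

lemma esym_3:
  "esym 3 w 1 = w 0 + w 1 + w 2" "esym 3 w 2 = w 0 * w 1 + w 0 * w 2 + w 1 * w 2" "esym 3 w 3 = w 0 * w 1 * w 2"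
  by (simp_all add: numeral_3_eq_3 numeral_2_eq_2 esym_Suc_Suc esym_eq_0 algebra_simps)

subsection \<open>Type \<open>G\<^sub>2\<close>\<close>

text \<open>With y_0 = a, y_1 = b and y_2 = (a b)^-1, \<open>S\<close> and \<open>T\<close> are the
  sums over the six short and the six long roots. The left-hand sides are the symmetric functions of
  the 2 c_l. Inverses are separate variables \<open>A\<close> and \<open>B\<close>, which keeps all
  identities polynomial.\<close>

lemma g2_invariant_relations:
  fixes a b A B :: complex
  assumes "a * A = 1" "b * B = 1"
  defines "S \<equiv> a + A + b + B + A * B + a * b"
    and "T \<equiv> b * A + a * B + A * B * B + a * b * b + a * a * b + A * A * B"
  shows "(a + A) * (b + B) + (a + A) * (A * B + a * b) + (b + B) * (A * B + a * b) = S + T"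
    and "(a + A) * (b + B) * (A * B + a * b) = S\<^sup>2 - 2 * S - 2 * T - 4"
proof -
  \<comment> \<open>\<open>w\<close> is what the product of x and y contains besides z. Then x y z =
    z^2 + w z, and w z = x^2 + y^2 - 4 leads back to the square of S.\<close>
  define x y z w where xyzw: "x = a + A" "y = b + B" "z = A * B + a * b" "w = a * B + A * b"
  have "x * z = (a * A) * B + a * a * b + A * A * B + (a * A) * b"
    "y * z = A * (b * B) + a * b * b + A * B * B + a * (b * B)"
    "w * z = (a * A) * (B * B) + a * a * (b * B) + A * A * (b * B) + (a * A) * (b * b)"
    "x * x = a * a + A * A + 2 * (a * A)" "y * y = b * b + B * B + 2 * (b * B)"
    by (simp_all add: xyzw algebra_simps)
  then have xz: "x * z = B + a * a * b + A * A * B + b" and yz: "y * z = A + a * b * b + A * B * B + a"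
    and wz: "w * z = B * B + a * a + A * A + b * b"
    and xx: "x * x = a * a + A * A + 2" and yy: "y * y = b * b + B * B + 2"
    by (simp_all only: assms(1,2) mult_1_left mult_1_right)
  have xy: "x * y = z + w" by (simp add: xyzw algebra_simps)
  have S: "S = x + y + z" by (simp add: S_def xyzw)
  have e2: "x * y + x * z + y * z = S + T"
    unfolding xy xz yz S T_def by (simp add: xyzw algebra_simps)
  then show "(a + A) * (b + B) + (a + A) * (A * B + a * b) + (b + B) * (A * B + a * b) = S + T"
    unfolding xyzw .
  have "S\<^sup>2 = x * x + y * y + z * z + 2 * (x * y + x * z + y * z)"
    unfolding S by (simp add: power2_eq_square algebra_simps)
  also have "\<dots> = w * z + z * z + 4 + 2 * (S + T)"
    unfolding e2 xx yy wz by simp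
  finally have "x * y * z = S\<^sup>2 - 2 * S - 2 * T - 4"
    unfolding xy by (simp add: algebra_simps)
  then show "(a + A) * (b + B) * (A * B + a * b) = S\<^sup>2 - 2 * S - 2 * T - 4"
    unfolding xyzw .
qed

lemma chebyshev_orbit_G2: "chebyshev_orbit G2_type 3"
proof -
  have valid: "valid_type G2_type 3" by (simp add: valid_type_def)
  have rank: "root_rank G2_type 3 = 2" by simp
  have less_2_iff: "i < 2 \<longleftrightarrow> i = 0 \<or> i = 1" for i :: nat by auto
  note One_nat_def [simp del]
  \<comment> \<open>Pairings of \<open>v\<close> with three short roots of sum 0; with their
    negatives they form the orbit of \<omega>_1, and the y_l have product 1.\<close>
  define b where "b v l = (if l = 0 then v 1 - v 2 else if l = 1 then v 2 - v 0 else v 0 - v 1)"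
    for v :: "nat \<Rightarrow> complex" and l :: nat
  have b_simps: "b v 0 = v 1 - v 2" "b v 1 = v 2 - v 0" "b v 2 = v 0 - v 1" for v
    by (simp_all add: b_def)
  define \<theta> where "\<theta> v i = real_fund_orbit_poly G2_type 3 i (exp_point G2_type 3 v)" for v i
  define y where "y v l = exp (b v l)" for v l
  have y0: "y v l \<noteq> 0" for v l by (simp add: y_def)
  have y2: "y v 2 = inverse (y v 0 * y v 1)" for v
  proof -
    have "b v 2 = - (b v 0 + b v 1)" by (simp add: b_simps)
    then show ?thesis by (simp only: y_def exp_minus exp_add)
  qed
  have cosh_b: "cosh (b v l) = (y v l + inverse (y v l)) / 2" for v l
    by (simp add: y_def cosh_joukowski)
  have cosh_diff: "cosh (b v k - b v l) = (y v k / y v l + y v l / y v k) / 2" for v k l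
    by (simp add: y_def cosh_joukowski exp_diff field_simps)
  have \<theta>0: "\<theta> v 0 = (cosh (b v 0) + cosh (b v 1) + cosh (b v 2)) / 3" for v
    unfolding \<theta>_def real_fund_orbit_poly_G2 b_simps ..
  have \<theta>1: "\<theta> v 1 = (cosh (b v 1 - b v 0) + cosh (b v 2 - b v 1) + cosh (b v 0 - b v 2)) / 3" for v
  proof -
    have "2 * v 2 - v 0 - v 1 = b v 1 - b v 0" "2 * v 0 - v 1 - v 2 = b v 2 - b v 1"
      "2 * v 1 - v 2 - v 0 = b v 0 - b v 2" by (simp_all add: b_simps)
    then show ?thesis unfolding \<theta>_def real_fund_orbit_poly_G2 by (simp only:)
  qed
  have cheb_val: "real_cheb_value G2_type 3 k (exp_point G2_type 3 v) = (\<Sum>l<3. cheb k (cosh (b v l))) / of_nat 3" for k v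
    unfolding real_cheb_value_G2 sum_lessThan_3 b_simps by simp
  have pairings: "pairing 3 (fund G2_type 3 0) v = - b v 0" "pairing 3 (fund G2_type 3 1) v = b v 1 - b v 0" for v
    unfolding pairing_def sum_lessThan_3 fund_G2 b_simps by simp_all
  \<comment> \<open>The relations of \<open>g2_invariant_relations\<close> at S = 6 \<theta>_0 and T
    = 6 \<theta>_1; the denominators 4 and 8 come from c_l being half of y_l + y_l^-1.\<close>
  define e :: "(nat \<Rightarrow> complex) \<Rightarrow> nat \<Rightarrow> complex" where
    "e t i = (if i = 0 then 1 else if i = 1 then 3 * t 0 else if i = 2 then (6 * t 0 + 6 * t 1) / 4
      else if i = 3 then (36 * (t 0)\<^sup>2 - 12 * t 0 - 12 * t 1 - 4) / 8 else 0)" for t i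
  have esym_e: "esym 3 (\<lambda>l. cosh (b v l)) i = e (\<theta> v) i" for v i
  proof -
    define a b' A B where ab: "a = y v 0" "b' = y v 1" "A = inverse (y v 0)" "B = inverse (y v 1)"
    have inv: "a * A = 1" "b' * B = 1" using y0 by (simp_all add: ab)
    define S where "S = a + A + b' + B + A * B + a * b'"
    define T where "T = b' * A + a * B + A * B * B + a * b' * b' + a * a * b' + A * A * B"
    have c: "cosh (b v 0) = (a + A) / 2" "cosh (b v 1) = (b' + B) / 2" "cosh (b v 2) = (A * B + a * b') / 2"
      unfolding cosh_b y2 by (simp_all add: ab)
    have th0: "\<theta> v 0 = S / 6"
      unfolding \<theta>0 c S_def by (simp add: add_divide_distrib)
    have quot: "y v 1 / y v 0 = b' * A" "y v 0 / y v 1 = a * B" "y v 2 / y v 1 = A * B * B"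
      "y v 1 / y v 2 = a * b' * b'" "y v 0 / y v 2 = a * a * b'" "y v 2 / y v 0 = A * A * B"
      unfolding ab y2 divide_inverse inverse_mult_distrib inverse_inverse_eq by (simp_all only: mult_ac)
    have th1: "\<theta> v 1 = T / 6"
      unfolding \<theta>1 cosh_diff quot T_def by (simp add: add_divide_distrib)
    have halves: "(p / 2) * (q / 2) + (p / 2) * (r / 2) + (q / 2) * (r / 2) = (p * q + p * r + q * r) / 4"
      for p q r :: complex by (simp add: add_divide_distrib)
    note rel = g2_invariant_relations[OF inv, folded S_def T_def]
    consider "i = 0" | "i = 1" | "i = 2" | "i = 3" | "i > 3" by linarith
    then show ?thesis
    proof cases
      case 2
      show ?thesis unfolding 2 esym_3 by (simp add: e_def \<theta>0)
    next
      case 3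
      have "esym 3 (\<lambda>l. cosh (b v l)) 2 =
          ((a + A) * (b' + B) + (a + A) * (A * B + a * b') + (b' + B) * (A * B + a * b')) / 4"
        unfolding esym_3 c halves ..
      then show ?thesis unfolding rel 3 by (simp add: e_def th0 th1)
    next
      case 4
      have "esym 3 (\<lambda>l. cosh (b v l)) 3 = (a + A) * (b' + B) * (A * B + a * b') / 8"
        unfolding esym_3 c by simp
      then show ?thesis unfolding rel 4 by (simp add: e_def th0 th1 power_divide)
    qed (simp_all add: e_def esym_eq_0)
  qed
  show ?thesis
  proof (rule chebyshev_orbit_cosh[where e = e and b = b, OF valid _ cheb_val])
    show "Re (b v l) = 0" if "\<And>j. Re (v j) = 0" for v l
      using that by (simp add: b_def)
    show "exp_point G2_type 3 v \<in> torus (root_rank G2_type 3)" if re: "\<And>l. l < 3 \<Longrightarrow> Re (b v l) = 0" for v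
    proof -
      have "Re (pairing 3 (fund G2_type 3 i) v) = 0" if "i < 2" for i
        using that re[of 0] re[of 1] pairings[of v] by (auto simp: less_2_iff)
      then show ?thesis by (simp add: torus_def exp_point_def)
    qed
    show "ratpoly_fun (root_rank G2_type 3) (\<lambda>z. e (\<lambda>j. of_real (z $ j)) i)" for i
    proof -
      have "ratpoly_fun 2 (\<lambda>z. 3 * complex_of_real (z $ 0))"
        "ratpoly_fun 2 (\<lambda>z. (6 * complex_of_real (z $ 0) + 6 * complex_of_real (z $ 1)) / 4)"
        "ratpoly_fun 2 (\<lambda>z. (36 * (complex_of_real (z $ 0))\<^sup>2 - 12 * complex_of_real (z $ 0) - 12 * complex_of_real (z $ 1) - 4) / 8)"
        by (intro ratpoly_fun_intros; simp)+
      then show ?thesis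
        unfolding e_def rank
        by (cases "i = 0"; cases "i = 1"; cases "i = 2"; cases "i = 3")
          (simp_all add: ratpoly_fun_1 ratpoly_fun_0)
    qed
    show "e t i = e t' i" if "\<And>j. j < root_rank G2_type 3 \<Longrightarrow> t j = t' j" for t t' i
      using that by (simp add: e_def)
    show "esym 3 (\<lambda>l. cosh (b v l)) i = e (\<lambda>j. real_fund_orbit_poly G2_type 3 j (exp_point G2_type 3 v)) i" for v i
      using esym_e by (simp add: \<theta>_def[abs_def])
    show "\<exists>v. \<forall>i<root_rank G2_type 3. real_fund_orbit_poly G2_type 3 i (exp_point G2_type 3 v) = t i" for t
    proof -
      define t0 t1 where "t0 = t 0" and "t1 = t 1"
      \<comment> \<open>If w_0 w_1 w_2 = 1, the inverses of the w_l are the pairwise products, so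
        e_1 + e_2 = S = 6 t0 and e_1 e_2 = T + 3 = 6 t1 + 3. Hence e_1 and e_2 must be the roots 3
        t0 \<plusminus> d of a quadratic equation.\<close>
      define d where "d = csqrt (9 * t0\<^sup>2 - 3 - 6 * t1)"
      have d: "d\<^sup>2 = 9 * t0\<^sup>2 - 3 - 6 * t1" by (simp add: d_def)
      have s: "(3 * t0 + d) + (3 * t0 - d) = 6 * t0" "(3 * t0 + d) * (3 * t0 - d) = 3 + 6 * t1"
        using d by (simp_all add: algebra_simps power2_eq_square)
      obtain w where w: "\<forall>i\<le>3. esym 3 w i = (if i = 1 then 3 * t0 + d else if i = 2 then 3 * t0 - d else 1)"
        using esym_surj[of "\<lambda>i. if i = 1 then 3 * t0 + d else if i = 2 then 3 * t0 - d else 1" 3] by auto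
      have w1: "w 0 + w 1 + w 2 = 3 * t0 + d" "w 0 * w 1 + w 0 * w 2 + w 1 * w 2 = 3 * t0 - d" "w 0 * w 1 * w 2 = 1"
        using w unfolding esym_3[symmetric] by simp_all
      then have w0: "w 0 \<noteq> 0" "w 1 \<noteq> 0" "w 2 \<noteq> 0" by auto
      obtain b0 b1 where b01: "exp b0 = w 0" "exp b1 = w 1"
        using exists_complex_log w0 by metis
      \<comment> \<open>Solves v_1 - v_2 = b0 and v_2 - v_0 = b1 with v_0 = 0.\<close>
      define v where "v j = (if j = 0 then 0 else if j = 1 then b0 + b1 else b1)" for j :: nat
      have yw: "y v 0 = w 0" "y v 1 = w 1" by (simp_all add: y_def b_def v_def b01)
      have "w 2 = inverse (w 0 * w 1)" by (rule inverse_unique[symmetric]) (rule w1(3))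
      then have yw2: "y v 2 = w 2" by (simp add: y2 yw)
      have inv: "inverse (w 0) = w 1 * w 2" "inverse (w 1) = w 0 * w 2" "inverse (w 2) = w 0 * w 1"
        using w1(3) by (simp_all add: inverse_unique mult_ac)
      have "\<theta> v 0 = ((w 0 + w 1 + w 2) + (w 0 * w 1 + w 0 * w 2 + w 1 * w 2)) / 6"
        unfolding \<theta>0 cosh_b yw yw2 inv by (simp add: add_divide_distrib)
      then have th0: "\<theta> v 0 = t0" unfolding w1 s by simp
      \<comment> \<open>Of the nine products w_k / w_l three equal 1 and the other six are the long
        root terms.\<close>
      have "6 * \<theta> v 1 + 3 = (w 0 + w 1 + w 2) * (inverse (w 0) + inverse (w 1) + inverse (w 2))"
      proof -
        have "(p + q + r) * (i + j + k) = p * i + q * j + r * k + (q * i + p * j) + (r * j + q * k) + (p * k + r * i)"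
          for p q r i j k :: complex by (simp add: algebra_simps)
        from this[of "w 0" "w 1" "w 2" "inverse (w 0)" "inverse (w 1)" "inverse (w 2)"]
        show ?thesis
          unfolding \<theta>1 cosh_diff yw yw2 using w0 by (simp add: divide_inverse[of "w _" "w _"] add_divide_distrib)
      qed
      also have "inverse (w 0) + inverse (w 1) + inverse (w 2) = w 0 * w 1 + w 0 * w 2 + w 1 * w 2"
        unfolding inv by simp
      finally have th1: "\<theta> v 1 = t1" unfolding w1 s by simp
      show ?thesis
        using th0 th1 by (intro exI[of _ v]) (auto simp: less_2_iff \<theta>_def t0_def t1_def)
    qed
    show "real_fund_orbit_poly G2_type 3 i (exp_point G2_type 3 v) \<in> \<real>"
      if re: "\<And>l. Re (v l) = 0" and i: "i < root_rank G2_type 3" for v i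
    proof -
      have "Re (b v l) = 0" for l using re by (simp add: b_def)
      then have "cosh (b v l) \<in> \<real>" "cosh (b v l - b v k) \<in> \<real>" for l k
        by (auto intro!: cosh_Reals)
      then have "\<theta> v 0 \<in> \<real>" "\<theta> v 1 \<in> \<real>"
        unfolding \<theta>0 \<theta>1 by (intro Reals_divide Reals_add; simp)+
      then show ?thesis using i by (auto simp: \<theta>_def less_2_iff)
    qed
  qed simp
qed

theorem theorem1p1:
  fixes R :: root_type and n :: nat
  assumes "(R = A_type \<and> n \<ge> 2) \<or> (R = B_type \<and> n \<ge> 2) \<or> (R = C_type \<and> n \<ge> 2)
    \<or> (R = D_type \<and> n \<ge> 4) \<or> (R = G2_type \<and> n = 3)"
  shows "real_orbit_space R n =
    {z \<in> carrier_vec (root_rank R n).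
       pos_semidef (map_mat (\<lambda>p. mpoly_eval p z) (hankel_mat R n))}"
proof -
  have "chebyshev_orbit R n"
    using assms chebyshev_orbit_A chebyshev_orbit_B chebyshev_orbit_C chebyshev_orbit_D chebyshev_orbit_G2
    by (cases R) (auto simp: valid_type_def)
  then show ?thesis by (rule chebyshev_orbit.real_orbit_space_eq)
qed

end
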